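(* For every positive integer $k$, there exists an extremal Type~II $\mathbb{Z}_{2k}$-code of length $64$.
   Context: $\mathbb{Z}_m$ denotes the ring of integers modulo $m$. A $\mathbb{Z}_m$-code of length $n$ is a $\mathbb{Z}_m$-submodule of $\mathbb{Z}_m^n$; it is self-dual if $C=C^\perp$ with respect to the standard inner product. The Euclidean weight of $x=(x_1,\dots,x_n)\in\mathbb{Z}_m^n$ is $\sum_{\alpha=1}^{\lfloor m/2\rfloor} n_\alpha(x)\alpha^2$, where $n_\alpha(x)$ is the number of $i$ with $x_i\equiv\pm\alpha \pmod m$; $d_E(C)$ is the minimum Euclidean weight of a nonzero codeword. A Type~II $\mathbb{Z}_{2k}$-code is a self-dual $\mathbb{Z}_{2k}$-code all of whose codewords have Euclidean weight divisible by $4k$. For a Type~II $\mathbb{Z}_{2k}$-code $C$ of length $n\le 136$ one has $d_E(C)\le 4k\lfloor n/24\rfloor+4k$, and $C$ is called extremal if equality holds. *)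

theory Defs
  imports Main
begin

text \<open>Vectors of Z_m^n are represented as functions nat => int whose values at
coordinates i < n lie in {0..<m} (canonical residues) and which are 0 at i >= n.\<close>

definition vecs :: "int \<Rightarrow> nat \<Rightarrow> (nat \<Rightarrow> int) set" where
  "vecs m n = {x. (\<forall>i<n. 0 \<le> x i \<and> x i < m) \<and> (\<forall>i\<ge>n. x i = 0)}"

definition vadd :: "int \<Rightarrow> nat \<Rightarrow> (nat \<Rightarrow> int) \<Rightarrow> (nat \<Rightarrow> int) \<Rightarrow> (nat \<Rightarrow> int)" where
  "vadd m n x y = (\<lambda>i. if i < n then (x i + y i) mod m else 0)"

definition vsmul :: "int \<Rightarrow> nat \<Rightarrow> int \<Rightarrow> (nat \<Rightarrow> int) \<Rightarrow> (nat \<Rightarrow> int)" where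
  "vsmul m n a x = (\<lambda>i. if i < n then (a * x i) mod m else 0)"

definition inner_m :: "int \<Rightarrow> nat \<Rightarrow> (nat \<Rightarrow> int) \<Rightarrow> (nat \<Rightarrow> int) \<Rightarrow> int" where
  "inner_m m n x y = (\<Sum>i<n. x i * y i) mod m"

definition is_code :: "int \<Rightarrow> nat \<Rightarrow> (nat \<Rightarrow> int) set \<Rightarrow> bool" where
  "is_code m n C \<longleftrightarrow> C \<subseteq> vecs m n \<and> (\<lambda>i. 0) \<in> C
     \<and> (\<forall>x\<in>C. \<forall>y\<in>C. vadd m n x y \<in> C)
     \<and> (\<forall>a. \<forall>x\<in>C. vsmul m n a x \<in> C)"

definition dual_code :: "int \<Rightarrow> nat \<Rightarrow> (nat \<Rightarrow> int) set \<Rightarrow> (nat \<Rightarrow> int) set" where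
  "dual_code m n C = {y \<in> vecs m n. \<forall>x\<in>C. inner_m m n x y = 0}"

definition self_dual :: "int \<Rightarrow> nat \<Rightarrow> (nat \<Rightarrow> int) set \<Rightarrow> bool" where
  "self_dual m n C \<longleftrightarrow> is_code m n C \<and> C = dual_code m n C"

definition n_alpha :: "int \<Rightarrow> nat \<Rightarrow> (nat \<Rightarrow> int) \<Rightarrow> int \<Rightarrow> nat" where
  "n_alpha m n x \<alpha> = card {i. i < n \<and> (x i mod m = \<alpha> mod m \<or> x i mod m = (- \<alpha>) mod m)}"

definition euclid_wt :: "int \<Rightarrow> nat \<Rightarrow> (nat \<Rightarrow> int) \<Rightarrow> int" where
  "euclid_wt m n x = (\<Sum>\<alpha>\<in>{1..m div 2}. int (n_alpha m n x \<alpha>) * \<alpha>\<^sup>2)"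

definition min_euclid :: "int \<Rightarrow> nat \<Rightarrow> (nat \<Rightarrow> int) set \<Rightarrow> int" where
  "min_euclid m n C = Min (euclid_wt m n ` (C - {\<lambda>i. 0}))"

definition typeII :: "nat \<Rightarrow> nat \<Rightarrow> (nat \<Rightarrow> int) set \<Rightarrow> bool" where
  "typeII k n C \<longleftrightarrow> self_dual (2 * int k) n C
     \<and> (\<forall>x\<in>C. (4 * int k) dvd euclid_wt (2 * int k) n x)"

definition extremal_typeII :: "nat \<Rightarrow> nat \<Rightarrow> (nat \<Rightarrow> int) set \<Rightarrow> bool" where
  "extremal_typeII k n C \<longleftrightarrow> typeII k n C
     \<and> min_euclid (2 * int k) n C = 4 * int k * int (n div 24) + 4 * int k"

end

theory Submission
  imports Defs "HOL-Computational_Algebra.Primes"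
begin

text \<open>A Type II code over \<open>\<int>/2k\<close> is the same as an even unimodular lattice of rank 64 together with a
  frame of 64 orthogonal vectors of norm \<open>2k\<close>, and it is extremal if the lattice has minimum norm 6
  and \<open>k \<ge> 3\<close>. One lattice serves all \<open>k \<ge> 3\<close>: glue eight copies of \<open>E\<^sub>8\<close> modulo 3 along a
  quaternionic \<open>4 \<times> 4\<close> matrix \<open>Q\<close> with \<open>Q Q\<^sup>* = 11\<close>. It has similarities \<open>3\<xi> + bT\<close> of norm
  \<open>9|\<xi>|\<^sup>2 + (a\<^sup>2 + 11c\<^sup>2)b\<^sup>2\<close> with integral quaternions \<open>\<xi>\<close>, which carry the unit vectors to frames;
  by the four squares theorem these norms, for \<open>b = 0\<close> and for \<open>b = 1\<close> with \<open>(a, c) = (1, 1)\<close> or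
  \<open>(2, -1)\<close>, are the numbers \<open>3k\<close> with \<open>k \<ge> 3\<close>. A nonzero vector of norm less than 6 would have a
  half meeting at most three of its four \<open>E\<^sub>8\<close> blocks, which a finite check of classes modulo 3
  excludes. For \<open>k = 1\<close> and \<open>k = 2\<close> the codes are built from extended BCH codes of length 32 and 64.\<close>

section \<open>Quaternions and sums of four squares\<close>

text \<open>The lattice cannot serve k = 1 and k = 2: the frame vectors belong to it and have norm
  2k, so a minimum norm of 6 forces k >= 3. Quaternions enter because left multiplication by them
  commutes with a matrix acting from the right: the glue stays invariant, and every natural number
  is a norm. Alone they reach only the multiples of 3, because of the factor 3 in
  \<open>3\<xi>\<close>; T supplies the other residues of k through 1 + 11 = 3 * 4 and 4 + 11 = 3 *
  5. The number 11 is tied to the modulus 3: it is -1 modulo 3, so the graph of Q modulo 3 is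
  self-orthogonal, and it splits as 7 + 2 + 1 + 1 in every row and column of Q, so every entry is
  invertible modulo 3. Invertibility lets a zero or root class in one image block determine an
  unknown block, which keeps the finite check small. Blocks are bounded by a count: in the integral
  scale the norms to exclude are 12 and 24, the smaller half has norm at most 12, and a nonzero
  block has norm at least 4.\<close>

datatype quat = Quat (qre: int) (qi: int) (qj: int) (qk: int)

instantiation quat :: ring_1
begin

definition "0 = Quat 0 0 0 0"
definition "1 = Quat 1 0 0 0"
definition "x + y = Quat (qre x + qre y) (qi x + qi y) (qj x + qj y) (qk x + qk y)"
definition "- x = Quat (- qre x) (- qi x) (- qj x) (- qk x)"
definition "x - y = Quat (qre x - qre y) (qi x - qi y) (qj x - qj y) (qk x - qk y)"
definition "x * y = Quat
  (qre x * qre y - qi x * qi y - qj x * qj y - qk x * qk y)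
  (qre x * qi y + qi x * qre y + qj x * qk y - qk x * qj y)
  (qre x * qj y - qi x * qk y + qj x * qre y + qk x * qi y)
  (qre x * qk y + qi x * qj y - qj x * qi y + qk x * qre y)"

instance
  by standard
    (auto simp: zero_quat_def one_quat_def plus_quat_def uminus_quat_def minus_quat_def
      times_quat_def algebra_simps intro: quat.expand)

end

lemma quat_sel [simp]:
  "qre 0 = 0" "qi 0 = 0" "qj 0 = 0" "qk 0 = 0"
  "qre 1 = 1" "qi 1 = 0" "qj 1 = 0" "qk 1 = 0"
  "qre (x + y) = qre x + qre y" "qi (x + y) = qi x + qi y"
  "qj (x + y) = qj x + qj y" "qk (x + y) = qk x + qk y"
  "qre (- x) = - qre x" "qi (- x) = - qi x" "qj (- x) = - qj x" "qk (- x) = - qk x"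
  "qre (x - y) = qre x - qre y" "qi (x - y) = qi x - qi y"
  "qj (x - y) = qj x - qj y" "qk (x - y) = qk x - qk y"
  by (simp_all add: zero_quat_def one_quat_def plus_quat_def uminus_quat_def minus_quat_def)

lemma quat_mult_sel [simp]:
  "qre (x * y) = qre x * qre y - qi x * qi y - qj x * qj y - qk x * qk y"
  "qi (x * y) = qre x * qi y + qi x * qre y + qj x * qk y - qk x * qj y"
  "qj (x * y) = qre x * qj y - qi x * qk y + qj x * qre y + qk x * qi y"
  "qk (x * y) = qre x * qk y + qi x * qj y - qj x * qi y + qk x * qre y"
  by (simp_all add: times_quat_def)

lemma quat_eq_iff: "x = y \<longleftrightarrow> qre x = qre y \<and> qi x = qi y \<and> qj x = qj y \<and> qk x = qk y"
  using quat.expand by auto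

lemma of_int_quat_sel [simp]:
  "qre (of_int n) = n" "qi (of_int n) = 0" "qj (of_int n) = 0" "qk (of_int n) = 0"
proof -
  have nat: "of_nat m = Quat (int m) 0 0 0" for m
    by (induction m) (simp_all add: quat_eq_iff)
  have "of_int n = Quat n 0 0 0"
    by (cases n rule: int_cases) (simp_all add: nat quat_eq_iff)
  then show "qre (of_int n) = n" "qi (of_int n) = 0" "qj (of_int n) = 0" "qk (of_int n) = 0"
    by simp_all
qed

lemma of_nat_quat_sel [simp]:
  "qre (of_nat n) = int n" "qi (of_nat n) = 0" "qj (of_nat n) = 0" "qk (of_nat n) = 0"
  using of_int_quat_sel[of "int n"] by simp_all

lemma numeral_quat_sel [simp]:
  "qre (numeral w) = numeral w" "qi (numeral w) = 0" "qj (numeral w) = 0" "qk (numeral w) = 0"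
  using of_int_quat_sel[of "numeral w"] by simp_all

definition qcnj :: "quat \<Rightarrow> quat" where
  "qcnj x = Quat (qre x) (- qi x) (- qj x) (- qk x)"

definition qdot :: "quat \<Rightarrow> quat \<Rightarrow> int" where
  "qdot x y = qre x * qre y + qi x * qi y + qj x * qj y + qk x * qk y"

abbreviation qnorm :: "quat \<Rightarrow> int" where
  "qnorm x \<equiv> qdot x x"

lemma qcnj_sel [simp]:
  "qre (qcnj x) = qre x" "qi (qcnj x) = - qi x" "qj (qcnj x) = - qj x" "qk (qcnj x) = - qk x"
  by (simp_all add: qcnj_def)

lemma qcnj_simps [simp]:
  "qcnj (x + y) = qcnj x + qcnj y" "qcnj (x * y) = qcnj y * qcnj x" "qcnj (qcnj x) = x"
  "qcnj 0 = 0" "qcnj (- x) = - qcnj x" "qcnj (x - y) = qcnj x - qcnj y"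
  by (simp_all add: quat_eq_iff)

lemma of_int_quat_commute: "x * of_int n = of_int n * (x :: quat)"
  by (simp add: quat_eq_iff mult.commute)

lemma mult_qcnj: "x * qcnj x = of_int (qnorm x)" "qcnj x * x = of_int (qnorm x)"
  by (simp_all add: quat_eq_iff qdot_def)

lemma qdot_commute: "qdot x y = qdot y x"
  by (simp add: qdot_def mult.commute)

lemma qdot_simps [simp]:
  "qdot (x + y) z = qdot x z + qdot y z" "qdot x (y + z) = qdot x y + qdot x z"
  "qdot (x - y) z = qdot x z - qdot y z" "qdot x (y - z) = qdot x y - qdot x z"
  "qdot (- x) y = - qdot x y" "qdot x (- y) = - qdot x y"
  "qdot 0 x = 0" "qdot x 0 = 0"
  "qdot (of_int n * x) y = n * qdot x y" "qdot x (of_int n * y) = n * qdot x y"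
  "qdot (of_nat m * x) y = int m * qdot x y" "qdot x (of_nat m * y) = int m * qdot x y"
  "qdot (numeral w * x) y = numeral w * qdot x y" "qdot x (numeral w * y) = numeral w * qdot x y"
  by (simp_all add: qdot_def algebra_simps)

lemma qdot_sum: "qdot (sum f A) y = (\<Sum>a\<in>A. qdot (f a) y)" "qdot y (sum f A) = (\<Sum>a\<in>A. qdot y (f a))"
  by (induction A rule: infinite_finite_induct) auto

lemma qdot_mult_left: "qdot (u * x) y = qdot x (qcnj u * y)"
  by (simp add: qdot_def algebra_simps)

lemma qdot_mult_right: "qdot (x * u) y = qdot x (y * qcnj u)"
  by (simp add: qdot_def algebra_simps)

lemma qnorm_mult: "qnorm (x * y) = qnorm x * qnorm y"
  by (simp add: qdot_def algebra_simps)

lemma qnorm_qcnj [simp]: "qnorm (qcnj x) = qnorm x"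
  by (simp add: qdot_def)

lemma qnorm_nonneg [simp]: "0 \<le> qnorm x"
  by (simp add: qdot_def)

lemma qnorm_eq_0_iff [simp]: "qnorm x = 0 \<longleftrightarrow> x = 0"
proof
  assume "qnorm x = 0"
  then have "qre x * qre x = 0 \<and> qi x * qi x = 0 \<and> qj x * qj x = 0 \<and> qk x * qk x = 0"
    using zero_le_square[of "qre x"] zero_le_square[of "qi x"] zero_le_square[of "qj x"]
      zero_le_square[of "qk x"] unfolding qdot_def by linarith
  then show "x = 0" by (simp add: quat_eq_iff)
qed simp

text \<open>Pigeonhole: for a and b below p/2 the (p + 1)/2 values a^2 are distinct modulo p, and so
  are the (p + 1)/2 values -1 - b^2, hence the two families share a residue. The bounds below p/2
  keep the resulting multiple of p below p^2.\<close>

lemma prime_dvd_sum_two_squares_plus_one: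
  assumes p: "prime p" and "odd p"
  obtains a b :: int where "0 \<le> a" "2 * a < int p" "0 \<le> b" "2 * b < int p" "int p dvd a\<^sup>2 + b\<^sup>2 + 1"
proof -
  define A where "A = {a :: int. 0 \<le> a \<and> 2 * a < int p}"
  obtain h where h: "p = 2 * h + 1" using \<open>odd p\<close> by (elim oddE)
  have A: "A = {0..int h}" by (auto simp: A_def h)
  have fin: "finite A" and card: "card A = h + 1" by (simp_all add: A)
  have inj: "a = b" if "a \<in> A" "b \<in> A" "int p dvd a\<^sup>2 - b\<^sup>2" for a b
  proof -
    have "int p dvd (a - b) * (a + b)"
      using that(3) by (simp add: power2_eq_square algebra_simps)
    then have "int p dvd a - b \<or> int p dvd a + b"
      using p by (metis prime_dvd_mult_iff prime_nat_int_transfer)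
    then show "a = b"
    proof
      assume d: "int p dvd a - b"
      have "\<bar>a - b\<bar> < int p" using that(1,2) by (auto simp: A h)
      with d show ?thesis using zdvd_not_zless[of "\<bar>a - b\<bar>" "int p"] by (cases "a = b") auto
    next
      assume d: "int p dvd a + b"
      have "0 \<le> a + b" "a + b < int p" using that(1,2) by (auto simp: A h)
      with d have "a + b = 0" using zdvd_not_zless[of "a + b" "int p"] by fastforce
      then show ?thesis using that(1,2) by (auto simp: A)
    qed
  qed
  define f where "f = (\<lambda>a :: int. a\<^sup>2 mod int p)"
  define g where "g = (\<lambda>b :: int. (- 1 - b\<^sup>2) mod int p)"
  have f: "inj_on f A"
    by (rule inj_onI) (auto simp: f_def mod_eq_dvd_iff intro: inj)
  have g: "inj_on g A"
  proof (rule inj_onI)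
    fix a b assume "a \<in> A" "b \<in> A" "g a = g b"
    moreover from this have "int p dvd b\<^sup>2 - a\<^sup>2" by (simp add: g_def mod_eq_dvd_iff)
    ultimately show "a = b" using inj[of b a] by auto
  qed
  have "f ` A \<inter> g ` A \<noteq> {}"
  proof
    assume "f ` A \<inter> g ` A = {}"
    then have "card (f ` A \<union> g ` A) = 2 * h + 2"
      using fin f g by (simp add: card_Un_disjoint card_image card)
    moreover have "card (f ` A \<union> g ` A) \<le> card {0..<int p}"
      by (rule card_mono) (auto simp: f_def g_def h)
    ultimately show False by (simp add: h)
  qed
  then obtain a b where ab: "a \<in> A" "b \<in> A" "f a = g b" by auto
  then have "int p dvd a\<^sup>2 + b\<^sup>2 + 1"
    by (simp add: f_def g_def mod_eq_dvd_iff algebra_simps)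
  with ab show thesis by (intro that[of a b]) (auto simp: A_def)
qed

lemma exists_centered_residue:
  fixes x m :: int assumes "0 < m"
  obtains y t where "x = y + m * t" "2 * \<bar>y\<bar> \<le> m"
proof (cases "2 * (x mod m) \<le> m")
  case True
  show ?thesis
    by (rule that[of "x mod m" "x div m"]) (use True assms in auto)
next
  case False
  have "x = (x mod m - m) + m * (x div m + 1)" by (simp add: algebra_simps)
  moreover have "2 * \<bar>r - m\<bar> \<le> m" if "\<not> 2 * r \<le> m" "r < m" for r
    using that by (simp add: abs_if)
  then have "2 * \<bar>x mod m - m\<bar> \<le> m"
    using False pos_mod_bound[OF assms] by blast
  ultimately show ?thesis by (rule that)
qed

text \<open>Lagrange's descent in quaternion form. Take the least m > 0 such that m p is the norm of
  some x. If m > 1, centred residues of x modulo m form some y of norm r m; then x times the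
  conjugate of y is m times a quaternion of norm r p, and 0 < r < m contradicts minimality.\<close>

lemma prime_is_qnorm:
  assumes p: "prime p"
  shows "\<exists>x. qnorm x = int p"
proof (cases "odd p")
  case False
  then have "p = 2" using p by (metis primes_dvd_imp_eq two_is_prime_nat)
  then show ?thesis by (intro exI[of _ "Quat 1 1 0 0"]) (simp add: qdot_def)
next
  case True
  define P where "P = (\<lambda>m :: nat. 0 < m \<and> (\<exists>x. qnorm x = int m * int p))"
  obtain a b :: int where ab: "0 \<le> a" "2 * a < int p" "0 \<le> b" "2 * b < int p"
      "int p dvd a\<^sup>2 + b\<^sup>2 + 1"
    using prime_dvd_sum_two_squares_plus_one[OF p True] .
  from ab(5) obtain m0 where m0: "a\<^sup>2 + b\<^sup>2 + 1 = int p * m0" by blast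
  have p2: "2 < int p" using True prime_gt_1_nat[OF p] by (cases "p = 2") auto
  have "4 * (a\<^sup>2 + b\<^sup>2 + 1) < 4 * (int p)\<^sup>2"
  proof -
    have "(2 * a)\<^sup>2 < (int p)\<^sup>2" "(2 * b)\<^sup>2 < (int p)\<^sup>2"
      using ab(1-4) by (intro power_strict_mono; simp)+
    moreover have "2\<^sup>2 < (int p)\<^sup>2" using p2 by (intro power_strict_mono) auto
    ultimately show ?thesis by (simp add: power_mult_distrib)
  qed
  then have lt: "int p * m0 < int p * int p" using m0 by (simp add: power2_eq_square)
  have "0 < int p * m0" using m0 zero_le_power2[of a] zero_le_power2[of b] by linarith
  then have m0pos: "0 < m0" using p2 by (simp add: zero_less_mult_iff)
  have "P (nat m0)"
    using m0 m0pos by (auto simp: P_def qdot_def power2_eq_square mult.commute intro!: exI[of _ "Quat a b 1 0"])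
  define m where "m = (LEAST m. P m)"
  have Pm: "P m" and least: "\<And>r. P r \<Longrightarrow> m \<le> r"
    unfolding m_def using \<open>P (nat m0)\<close> by (auto intro: LeastI Least_le)
  have "m < p"
    using least[OF \<open>P (nat m0)\<close>] lt p2 m0pos by (simp add: mult_less_cancel_left)
  from Pm obtain x where m: "0 < m" and x: "qnorm x = int m * int p" by (auto simp: P_def)
  have "m = 1"
  proof (rule ccontr)
    assume "m \<noteq> 1"
    then have ndvd: "\<not> int m dvd int p"
      using p \<open>m < p\<close> m by (metis int_dvd_int_iff order_less_irrefl prime_nat_iff)
    have mpos: "0 < int m" using m by simp
    obtain y0 t0 where 0: "qre x = y0 + int m * t0" "2 * \<bar>y0\<bar> \<le> int m"
      using exists_centered_residue[OF mpos] .
    obtain y1 t1 where 1: "qi x = y1 + int m * t1" "2 * \<bar>y1\<bar> \<le> int m"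
      using exists_centered_residue[OF mpos] .
    obtain y2 t2 where 2: "qj x = y2 + int m * t2" "2 * \<bar>y2\<bar> \<le> int m"
      using exists_centered_residue[OF mpos] .
    obtain y3 t3 where 3: "qk x = y3 + int m * t3" "2 * \<bar>y3\<bar> \<le> int m"
      using exists_centered_residue[OF mpos] .
    define y where "y = Quat y0 y1 y2 y3"
    define t where "t = Quat t0 t1 t2 t3"
    have xyt: "x = y + of_int (int m) * t"
      using 0 1 2 3 by (simp add: quat_eq_iff y_def t_def)
    have sq: "4 * c\<^sup>2 \<le> (int m)\<^sup>2" if "2 * \<bar>c\<bar> \<le> int m" for c
      using power_mono[OF that, of 2] by (simp add: power_mult_distrib)
    have le: "qnorm y \<le> (int m)\<^sup>2"
      using sq[OF 0(2)] sq[OF 1(2)] sq[OF 2(2)] sq[OF 3(2)]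
      by (simp add: y_def qdot_def power2_eq_square)
    have "qnorm x = qnorm y + int m * (2 * qdot y t + int m * qnorm t)"
      by (simp add: xyt algebra_simps qdot_commute[of t y])
    then have "qnorm y = int m * (int p - (2 * qdot y t + int m * qnorm t))"
      using x by (simp add: algebra_simps)
    then obtain r where r: "qnorm y = int m * r" by blast
    have r0: "0 \<le> r" using r qnorm_nonneg[of y] mpos by (simp add: zero_le_mult_iff)
    have rm: "r \<le> int m" using le r mpos by (simp add: power2_eq_square)
    have "r \<noteq> 0"
    proof
      assume "r = 0"
      then have "y = 0" using r by simp
      then have "int m * int p = int m * (int m * qnorm t)" using x xyt by (auto simp: mult.assoc)
      then show False using ndvd mpos by simp
    qed
    \<comment> \<open>Equality forces every coordinate of y to be m/2 in absolute value. Then x is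
      congruent to (s, s, s, s) modulo m = 2s, a quaternion of norm m^2, and m^2 would divide m
      p.\<close>
    moreover have "r \<noteq> int m"
    proof
      assume "r = int m"
      then have "qnorm y = (int m)\<^sup>2" using r by (simp add: power2_eq_square)
      then have eq: "4 * y0\<^sup>2 = (int m)\<^sup>2" "4 * y1\<^sup>2 = (int m)\<^sup>2" "4 * y2\<^sup>2 = (int m)\<^sup>2" "4 * y3\<^sup>2 = (int m)\<^sup>2"
        using sq[OF 0(2)] sq[OF 1(2)] sq[OF 2(2)] sq[OF 3(2)]
        by (simp_all add: y_def qdot_def power2_eq_square)
      have half: "\<exists>s. int m = 2 * s \<and> (\<exists>w. c = s + int m * w)" if "4 * c\<^sup>2 = (int m)\<^sup>2" for c
      proof -
        have "(2 * c)\<^sup>2 = (int m)\<^sup>2" using that by (simp add: power_mult_distrib)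
        then have "2 * c = int m \<or> 2 * c = - int m" using power2_eq_iff by blast
        then show ?thesis
        proof
          assume "2 * c = int m" then show ?thesis by (intro exI[of _ c]) auto
        next
          assume "2 * c = - int m" then show ?thesis
            by (intro exI[of _ "- c"]) (auto intro: exI[of _ "-1"])
        qed
      qed
      from half[OF eq(1)] obtain s where s: "int m = 2 * s" by blast
      have "\<exists>w. c = s + int m * w" if "4 * c\<^sup>2 = (int m)\<^sup>2" for c using half[OF that] s by auto
      then obtain w0 w1 w2 w3 where w: "y0 = s + int m * w0" "y1 = s + int m * w1"
          "y2 = s + int m * w2" "y3 = s + int m * w3" using eq by meson
      define u where "u = Quat (w0 + t0) (w1 + t1) (w2 + t2) (w3 + t3)"
      have "x = Quat s s s s + of_int (int m) * u"
        using xyt w by (simp add: quat_eq_iff y_def t_def u_def algebra_simps)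
      then have "qnorm x = (int m)\<^sup>2 + (int m)\<^sup>2 * (qre u + qi u + qj u + qk u) + (int m)\<^sup>2 * qnorm u"
        by (simp add: qdot_def s algebra_simps power2_eq_square)
      then have "int m * int p = int m * (int m * (1 + (qre u + qi u + qj u + qk u) + qnorm u))"
        using x by (simp add: algebra_simps power2_eq_square)
      then show False using ndvd mpos by simp
    qed
    ultimately have r: "0 < r" "r < int m" "qnorm y = int m * r" using r0 rm r by auto
    define v where "v = of_int r + t * qcnj y"
    have "x * qcnj y = of_int (int m) * v"
      using r(3) by (simp add: xyt v_def distrib_right distrib_left mult_qcnj mult.assoc)
    then have "(int m)\<^sup>2 * qnorm v = qnorm x * qnorm y"
      by (metis qnorm_mult qnorm_qcnj qdot_simps(9,10) mult.assoc power2_eq_square)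
    also have "\<dots> = (int m)\<^sup>2 * (r * int p)" using x r(3) by (simp add: power2_eq_square)
    finally have "qnorm v = r * int p" using mpos by simp
    then have "P (nat r)" using r by (auto simp: P_def)
    then show False using least r by fastforce
  qed
  then show ?thesis using x by auto
qed

theorem exists_qnorm_eq: "\<exists>x. qnorm x = int n"
proof (induction n rule: less_induct)
  case (less n)
  consider "n = 0" | "n = 1" | "1 < n" by linarith
  then show ?case
  proof cases
    case 1 then show ?thesis by (intro exI[of _ 0]) simp
  next
    case 2 then show ?thesis by (intro exI[of _ 1]) (simp add: qdot_def)
  next
    case 3
    then obtain p m where p: "prime p" "n = p * m" using prime_factor_nat[of n] by auto
    then have "m < n" using 3 prime_gt_1_nat[OF p(1)] by (cases "m = 0") auto
    then obtain x y where "qnorm x = int m" "qnorm y = int p"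
      using less prime_is_qnorm[OF p(1)] by blast
    then show ?thesis using p by (intro exI[of _ "y * x"]) (simp add: qnorm_mult)
  qed
qed

section \<open>From lattices to codes\<close>

text \<open>The distance from v to the nearest multiple of 2k.\<close>

definition lee :: "int \<Rightarrow> int \<Rightarrow> int" where
  "lee k v = min (v mod (2 * k)) (2 * k - v mod (2 * k))"

lemma euclid_wt_eq_sum_lee:
  assumes "0 < k"
  shows "euclid_wt (2 * k) n x = (\<Sum>i<n. (lee k (x i))\<^sup>2)"
proof -
  define P where "P = (\<lambda>i \<alpha>. x i mod (2 * k) = \<alpha> mod (2 * k) \<or> x i mod (2 * k) = (- \<alpha>) mod (2 * k))"
  have "int (n_alpha (2 * k) n x \<alpha>) = (\<Sum>i<n. if P i \<alpha> then 1 else 0)" for \<alpha>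
  proof -
    have "{i. i < n \<and> P i \<alpha>} = {i \<in> {..<n}. P i \<alpha>}" by auto
    then show ?thesis by (simp add: n_alpha_def P_def sum.If_cases Int_def)
  qed
  then have "euclid_wt (2 * k) n x = (\<Sum>i<n. \<Sum>\<alpha>\<in>{1..k}. if P i \<alpha> then \<alpha>\<^sup>2 else 0)"
    by (simp add: euclid_wt_def sum_distrib_right if_distrib if_distribR sum.swap[of _ "{1..k}"] cong: if_cong)
  \<comment> \<open>A residue is \<alpha> or -\<alpha> exactly when its distance to the multiples of
    2k is \<alpha>; at \<alpha> = k the two residues coincide and are counted once.\<close>
  also have "\<dots> = (\<Sum>i<n. \<Sum>\<alpha>\<in>{1..k}. if lee k (x i) = \<alpha> then \<alpha>\<^sup>2 else 0)"
  proof (intro sum.cong refl if_cong)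
    fix i \<alpha> assume "\<alpha> \<in> {1..k}"
    then have a: "1 \<le> \<alpha>" "\<alpha> \<le> k" by auto
    then have "\<alpha> mod (2 * k) = \<alpha>" by (intro mod_pos_pos_trivial) auto
    moreover have "(- \<alpha>) mod (2 * k) = 2 * k - \<alpha>"
      using a by (subst zmod_zminus1_eq_if) (simp add: mod_pos_pos_trivial)
    moreover have "0 \<le> x i mod (2 * k)" "x i mod (2 * k) < 2 * k" using assms by auto
    ultimately show "P i \<alpha> \<longleftrightarrow> lee k (x i) = \<alpha>"
      using a unfolding P_def lee_def by (auto simp: min_def)
  qed
  also have "\<dots> = (\<Sum>i<n. (lee k (x i))\<^sup>2)"
  proof (rule sum.cong)
    fix i
    have "0 \<le> x i mod (2 * k)" "x i mod (2 * k) < 2 * k" using assms by auto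
    then have "0 \<le> lee k (x i)" "lee k (x i) \<le> k" by (auto simp: lee_def min_def)
    then show "(\<Sum>\<alpha>\<in>{1..k}. if lee k (x i) = \<alpha> then \<alpha>\<^sup>2 else 0) = (lee k (x i))\<^sup>2"
      by (cases "lee k (x i) = 0") (auto simp: sum.delta')
  qed simp
  finally show ?thesis .
qed

lemma lee_representative:
  assumes "0 < k"
  obtains w t where "v = w + 2 * k * t" "w\<^sup>2 = (lee k v)\<^sup>2"
proof (cases "v mod (2 * k) \<le> k")
  case True
  show thesis
  proof (rule that)
    show "v = v mod (2 * k) + 2 * k * (v div (2 * k))" by simp
    show "(v mod (2 * k))\<^sup>2 = (lee k v)\<^sup>2" using True by (simp add: lee_def)
  qed
next
  case False
  show thesis
  proof (rule that)
    have "v mod (2 * k) + 2 * k * (v div (2 * k)) = v" by simp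
    then show "v = (v mod (2 * k) - 2 * k) + 2 * k * (v div (2 * k) + 1)"
      unfolding distrib_left by linarith
    show "(v mod (2 * k) - 2 * k)\<^sup>2 = (lee k v)\<^sup>2" using False by (simp add: lee_def power2_commute)
  qed
qed

lemma lee_sq_le:
  assumes "0 < k" "2 * k dvd w - v"
  shows "(lee k v)\<^sup>2 \<le> w\<^sup>2"
proof -
  define u where "u = v mod (2 * k)"
  have u: "0 \<le> u" "u < 2 * k" using assms by (auto simp: u_def)
  have "w mod (2 * k) = u" using assms(2) by (simp add: u_def mod_eq_dvd_iff)
  then have w: "w = u + 2 * k * (w div (2 * k))" by (metis mod_mult_div_eq)
  define s where "s = w div (2 * k)"
  have "\<bar>lee k v\<bar> \<le> \<bar>w\<bar>"
  proof (cases "0 \<le> s")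
    case True
    then have "0 \<le> 2 * k * s" using assms(1) by simp
    then show ?thesis using u w by (auto simp: lee_def u_def[symmetric] s_def[symmetric])
  next
    case False
    then have "2 * k * s \<le> 2 * k * (- 1)" using assms(1) by (intro mult_left_mono) auto
    then show ?thesis using u w by (auto simp: lee_def u_def[symmetric] s_def[symmetric])
  qed
  then show ?thesis by (simp add: abs_le_square_iff)
qed

lemma finite_vecs: "finite (vecs m n)"
proof (rule finite_subset)
  show "vecs m n \<subseteq> {f. \<forall>i. (i \<in> {..<n} \<longrightarrow> f i \<in> {0..<m}) \<and> (i \<notin> {..<n} \<longrightarrow> f i = 0)}"
    by (auto simp: vecs_def)
qed (rule finite_set_of_finite_funs; simp)

section \<open>Codes of length 64 through integer vectors\<close>

definition dot :: "(nat \<Rightarrow> int) \<Rightarrow> (nat \<Rightarrow> int) \<Rightarrow> int" where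
  "dot u v = (\<Sum>i<64. u i * v i)"

lemma dot_cong: "(\<And>i. i < 64 \<Longrightarrow> u i = u' i) \<Longrightarrow> (\<And>i. i < 64 \<Longrightarrow> v i = v' i) \<Longrightarrow> dot u v = dot u' v'"
  by (simp add: dot_def)

lemma dot_lin:
  "dot (\<lambda>i. u i + a * v i) w = dot u w + a * dot v w"
  "dot w (\<lambda>i. u i + a * v i) = dot w u + a * dot w v"
  by (simp_all add: dot_def algebra_simps sum.distrib sum_distrib_left)

lemma dot_scale: "dot (\<lambda>i. a * u i) w = a * dot u w" "dot w (\<lambda>i. a * u i) = a * dot w u"
  by (simp_all add: dot_def algebra_simps sum_distrib_left)

lemma dot_commute: "dot u v = dot v u"
  by (simp add: dot_def mult.commute)

lemma dot_self_eq_0: "dot u u = 0 \<Longrightarrow> i < 64 \<Longrightarrow> u i = 0"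
  by (simp add: dot_def sum_nonneg_eq_0_iff)

text \<open>A code over \<open>\<int>/2k\<close> is handled through the predicate \<open>I\<close> of being an integral
  representative of a codeword, so that all reductions modulo \<open>2k\<close> are confined to this proof.\<close>

lemma extremal_typeII_if_representatives:
  fixes I :: "(nat \<Rightarrow> int) \<Rightarrow> bool" and k :: nat
  assumes k: "0 < k"
    and cong: "\<And>u v. I u \<Longrightarrow> (\<And>i. i < 64 \<Longrightarrow> u i = v i) \<Longrightarrow> I v"
    and lin: "\<And>u v a. I u \<Longrightarrow> I v \<Longrightarrow> I (\<lambda>i. u i + a * v i)"
    and mult: "\<And>t. I (\<lambda>i. 2 * int k * t i)"
    and orth: "\<And>u v. I u \<Longrightarrow> I v \<Longrightarrow> 2 * int k dvd dot u v"
    and dual: "\<And>u. (\<And>v. I v \<Longrightarrow> 2 * int k dvd dot u v) \<Longrightarrow> I u"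
    and even: "\<And>u. I u \<Longrightarrow> 4 * int k dvd dot u u"
    and min: "\<And>u i. I u \<Longrightarrow> dot u u < 12 * int k \<Longrightarrow> i < 64 \<Longrightarrow> 2 * int k dvd u i"
    and ex: "I u0" "dot u0 u0 = 12 * int k" "i0 < 64" "\<not> 2 * int k dvd u0 i0"
  shows "\<exists>C. extremal_typeII k 64 C"
proof -
  define m where "m = 2 * int k"
  have m: "0 < m" using k by (simp add: m_def)
  define C where "C = {c \<in> vecs m 64. I c}"
  have shift: "I v" if "I u" "\<And>i. i < 64 \<Longrightarrow> m dvd v i - u i" for u v
  proof -
    have "I (\<lambda>i. u i + 1 * (2 * int k * ((v i - u i) div m)))"
      using that(1) mult by (rule lin)
    then show ?thesis by (rule cong) (use that(2) in \<open>auto simp: m_def\<close>)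
  qed
  define red where "red = (\<lambda>u i. if i < (64 :: nat) then u i mod m else (0 :: int))"
  have red_dvd: "m dvd red u i - u i" if "i < 64" for u i
    using that by (simp add: red_def mod_eq_dvd_iff[symmetric])
  have red_C: "red u \<in> C" if "I u" for u
    using m shift[of u "red u"] red_dvd that by (auto simp: C_def red_def vecs_def)
  have vecs_eq_0: "c i = 0" if "c \<in> vecs m 64" "m dvd c i" for c i
  proof (cases "i < 64")
    case True
    then have "0 \<le> c i" "c i < m" using that(1) by (auto simp: vecs_def)
    then show ?thesis using that(2) zdvd_not_zless[of "c i" m] by force
  qed (use that(1) in \<open>simp add: vecs_def\<close>)
  have I0: "I (\<lambda>i. 0)" using mult[of "\<lambda>i. 0"] by simp
  have code: "is_code m 64 C"
    unfolding is_code_def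
  proof (intro conjI allI ballI)
    show "(\<lambda>i. 0) \<in> C" using m I0 by (simp add: C_def vecs_def)
    show "vadd m 64 x y \<in> C" if "x \<in> C" "y \<in> C" for x y
    proof -
      have "vadd m 64 x y = red (\<lambda>i. x i + 1 * y i)" by (simp add: vadd_def red_def)
      moreover have "I (\<lambda>i. x i + 1 * y i)" by (rule lin) (use that in \<open>simp_all add: C_def\<close>)
      ultimately show ?thesis using red_C by simp
    qed
    show "vsmul m 64 a x \<in> C" if "x \<in> C" for a x
    proof -
      have "vsmul m 64 a x = red (\<lambda>i. 0 + a * x i)" by (simp add: vsmul_def red_def)
      moreover have "I (\<lambda>i. 0 + a * x i)" by (rule lin[OF I0]) (use that in \<open>simp add: C_def\<close>)
      ultimately show ?thesis using red_C by simp
    qed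
  qed (auto simp: C_def)
  have inner: "inner_m m 64 x y = 0 \<longleftrightarrow> m dvd dot x y" for x y
    by (simp add: inner_m_def dot_def dvd_eq_mod_eq_0)
  have dot_red: "m dvd dot u (red v) - dot u v" for u v
    unfolding dot_def sum_subtractf[symmetric]
    by (rule dvd_sum) (use red_dvd[of _ v] in \<open>simp add: right_diff_distrib[symmetric]\<close>)
  have self_dual: "self_dual m 64 C"
    unfolding self_dual_def
  proof (intro conjI code equalityI subsetI)
    show "y \<in> dual_code m 64 C" if "y \<in> C" for y
      using that orth[folded m_def] by (auto simp: dual_code_def inner C_def)
    show "y \<in> C" if "y \<in> dual_code m 64 C" for y
    proof -
      have y: "y \<in> vecs m 64" "\<And>x. x \<in> C \<Longrightarrow> m dvd dot x y"
        using that by (auto simp: dual_code_def inner)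
      have "I y"
      proof (rule dual)
        fix v assume "I v"
        then have "m dvd dot y (red v)" using y(2)[OF red_C] by (simp add: dot_commute[of y])
        then show "2 * int k dvd dot y v" using dot_red[of y v] by (simp add: m_def dvd_diff_right_iff)
      qed
      then show ?thesis using y by (simp add: C_def)
    qed
  qed
  have wt: "euclid_wt m 64 c = (\<Sum>i<64. (lee (int k) (c i))\<^sup>2)" for c
    unfolding m_def by (rule euclid_wt_eq_sum_lee) (use k in simp)
  \<comment> \<open>Choosing all entries of least absolute value turns Euclidean weights into norms
    of integer vectors in \<open>I\<close>.\<close>
  have rep: "\<exists>w. I w \<and> euclid_wt m 64 c = dot w w \<and> (\<forall>i<64. m dvd c i - w i)" if "I c" for c
  proof -
    have "\<exists>w. m dvd c i - w \<and> w\<^sup>2 = (lee (int k) (c i))\<^sup>2" for i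
    proof -
      obtain w t where "c i = w + 2 * int k * t" "w\<^sup>2 = (lee (int k) (c i))\<^sup>2"
        using lee_representative[of "int k" "c i"] k by auto
      then show ?thesis by (intro exI[of _ w]) (simp add: m_def)
    qed
    then obtain w where w: "\<And>i. m dvd c i - w i" "\<And>i. (w i)\<^sup>2 = (lee (int k) (c i))\<^sup>2" by metis
    have "m dvd w i - c i" for i using w(1)[of i] by (simp add: dvd_diff_commute)
    then have "I w" using shift[OF that] by blast
    moreover have "euclid_wt m 64 c = dot w w"
      by (simp add: wt dot_def w(2)[unfolded power2_eq_square] power2_eq_square)
    ultimately show ?thesis using w(1) by blast
  qed
  have typeII: "typeII k 64 C"
    unfolding typeII_def m_def[symmetric]
  proof (intro conjI self_dual ballI)
    fix c assume "c \<in> C"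
    then obtain w where "I w" "euclid_wt m 64 c = dot w w" using rep[of c] by (auto simp: C_def)
    then show "4 * int k dvd euclid_wt m 64 c" using even by simp
  qed
  define S where "S = euclid_wt m 64 ` (C - {\<lambda>i. 0})"
  \<comment> \<open>64 div 24 = 2, so the extremal value is 4k * 2 + 4k.\<close>
  have "Min S = 12 * int k"
  proof (rule Min_eqI)
    show "finite S" unfolding S_def C_def by (auto intro: finite_subset[OF _ finite_vecs])
    show "12 * int k \<le> y" if y: "y \<in> S" for y
    proof (rule ccontr)
      assume less: "\<not> 12 * int k \<le> y"
      obtain c where c: "c \<in> C" "c \<noteq> (\<lambda>i. 0)" "y = euclid_wt m 64 c" using y by (auto simp: S_def)
      then obtain w where w: "I w" "y = dot w w" "\<forall>i<64. m dvd c i - w i" using rep by (auto simp: C_def)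
      \<comment> \<open>Only divisibility by 2k can be expected below 12k: for k = 1 and k = 2 a
        vector with the single nonzero entry 2k has norm 4k^2 < 12k.\<close>
      have "m dvd c i" if "i < 64" for i
        using min[OF w(1) _ that] less w(2,3) that by (auto simp: m_def dvd_diff_left_iff)
      then have "c i = 0" for i using vecs_eq_0[of c i] c(1) by (cases "i < 64") (auto simp: C_def vecs_def)
      then show False using c(2) by auto
    qed
    have nz: "red u0 \<noteq> (\<lambda>i. 0)"
    proof
      assume "red u0 = (\<lambda>i. 0)"
      then have "red u0 i0 = 0" by metis
      then show False using ex(3,4) by (auto simp: red_def m_def dvd_eq_mod_eq_0)
    qed
    have inS: "euclid_wt m 64 (red u0) \<in> S" using red_C[OF ex(1)] nz by (auto simp: S_def)
    have "euclid_wt m 64 (red u0) \<le> dot u0 u0"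
      unfolding wt dot_def power2_eq_square[symmetric]
    proof (rule sum_mono)
      fix i :: nat assume "i \<in> {..<64}"
      then have "m dvd u0 i - red u0 i" using red_dvd[of i u0] by (simp add: dvd_diff_commute)
      then show "(lee (int k) (red u0 i))\<^sup>2 \<le> (u0 i)\<^sup>2" using k by (intro lee_sq_le) (auto simp: m_def)
    qed
    moreover have "12 * int k \<le> euclid_wt m 64 (red u0)"
      by (rule \<open>\<And>y. y \<in> S \<Longrightarrow> 12 * int k \<le> y\<close>[OF inS])
    ultimately show "12 * int k \<in> S" using inS ex(2) by simp
  qed
  then show ?thesis using typeII by (auto simp: extremal_typeII_def min_euclid_def S_def m_def)
qed

text \<open>The even unimodular lattice is \<open>\<Lambda> / \<surd>6\<close>, so its vectors of norm 2 and 4 correspond to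
  vectors of norm 12 and 24 in \<open>\<Lambda>\<close>. The images under \<open>2F / \<surd>6\<close> of the unit vectors form
  a \<open>2k\<close>-frame, and the codeword \<open>u\<close> of a lattice vector \<open>z\<close> lists its inner products with the
  frame, that is, \<open>F u = k z\<close>.\<close>

lemma extremal_typeII_if_frame:
  fixes \<Lambda> :: "(nat \<Rightarrow> int) \<Rightarrow> bool" and F G :: "(nat \<Rightarrow> int) \<Rightarrow> nat \<Rightarrow> int" and k :: nat
  assumes k: "0 < k"
    and cong: "\<And>u v. \<Lambda> u \<Longrightarrow> (\<And>i. i < 64 \<Longrightarrow> u i = v i) \<Longrightarrow> \<Lambda> v"
    and lin: "\<And>u v a. \<Lambda> u \<Longrightarrow> \<Lambda> v \<Longrightarrow> \<Lambda> (\<lambda>i. u i + a * v i)"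
    and norm: "\<And>u. \<Lambda> u \<Longrightarrow> 12 dvd dot u u"
    and min: "\<And>u i. \<Lambda> u \<Longrightarrow> dot u u < 36 \<Longrightarrow> i < 64 \<Longrightarrow> u i = 0"
    and dual: "\<And>u. (\<And>v. \<Lambda> v \<Longrightarrow> 6 dvd dot u v) \<Longrightarrow> \<Lambda> u"
    and z0: "\<Lambda> z0" "dot z0 z0 = 36" "i0 < 64" "odd (z0 i0)"
    and F_cong: "\<And>u v i. (\<And>i. i < 64 \<Longrightarrow> u i = v i) \<Longrightarrow> F u i = F v i"
    and F_lin: "\<And>u v a i. F (\<lambda>i. u i + a * v i) i = F u i + a * F v i"
    and G_cong: "\<And>u v i. (\<And>i. i < 64 \<Longrightarrow> u i = v i) \<Longrightarrow> G u i = G v i"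
    and G_lin: "\<And>u v a i. G (\<lambda>i. u i + a * v i) i = G u i + a * G v i"
    and adj: "\<And>u v. dot (F u) v = dot u (G v)"
    and FG: "\<And>u i. i < 64 \<Longrightarrow> F (G u) i = 3 * int k * u i"
    and GF: "\<And>u i. i < 64 \<Longrightarrow> G (F u) i = 3 * int k * u i"
    and G3: "\<And>u i. \<Lambda> u \<Longrightarrow> 3 dvd G u i"
    and F2: "\<And>u. \<Lambda> (\<lambda>i. 2 * F u i)"
  shows "\<exists>C. extremal_typeII k 64 C"
proof -
  have F_scale: "F (\<lambda>i. a * u i) i = a * F u i" for a u i
  proof -
    have "F (\<lambda>i. 0) i = 0" using F_lin[of "\<lambda>i. 0" 1 "\<lambda>i. 0" i] by simp
    then show ?thesis using F_lin[of "\<lambda>i. 0" a u i] by simp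
  qed
  have G_scale: "G (\<lambda>i. a * u i) i = a * G u i" for a u i
  proof -
    have "G (\<lambda>i. 0) i = 0" using G_lin[of "\<lambda>i. 0" 1 "\<lambda>i. 0" i] by simp
    then show ?thesis using G_lin[of "\<lambda>i. 0" a u i] by simp
  qed
  have FF: "dot (F u) (F v) = 3 * int k * dot u v" for u v
  proof -
    have "dot u (G (F v)) = dot u (\<lambda>i. 3 * int k * v i)" by (rule dot_cong) (simp_all add: GF)
    then show ?thesis by (simp add: adj dot_scale)
  qed
  have polar: "6 dvd dot u v" if "\<Lambda> u" "\<Lambda> v" for u v
  proof -
    have "12 dvd dot (\<lambda>i. u i + 1 * v i) (\<lambda>i. u i + 1 * v i)" by (intro norm lin that)
    then have "12 dvd (dot u u + dot v v) + 2 * dot u v"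
      unfolding dot_lin by (simp add: dot_commute[of v u] algebra_simps)
    then have "12 dvd 2 * dot u v" using norm[OF that(1)] norm[OF that(2)] dvd_add_right_iff dvd_add by blast
    then show ?thesis by presburger
  qed
  define I where "I = (\<lambda>u. \<exists>z. \<Lambda> z \<and> (\<forall>i<64. F u i = int k * z i))"
  show ?thesis
  proof (rule extremal_typeII_if_representatives[where I = I])
    show "0 < k" by (rule k)
    show "I v" if "I u" "\<And>i. i < 64 \<Longrightarrow> u i = v i" for u v
      using that(1) F_cong[OF that(2)] by (auto simp: I_def)
    show "I (\<lambda>i. u i + a * v i)" if uv: "I u" "I v" for u v a
    proof -
      obtain y z where "\<Lambda> y" "\<forall>i<64. F u i = int k * y i" "\<Lambda> z" "\<forall>i<64. F v i = int k * z i"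
        using uv unfolding I_def by blast
      then show ?thesis unfolding I_def
        by (intro exI[of _ "\<lambda>i. y i + a * z i"]) (auto simp: F_lin lin algebra_simps)
    qed
    show "I (\<lambda>i. 2 * int k * t i)" for t
      unfolding I_def by (rule exI[of _ "\<lambda>i. 2 * F t i"]) (simp add: F2 F_scale)
    show "2 * int k dvd dot u v" if uv: "I u" "I v" for u v
    proof -
      obtain y z where y: "\<Lambda> y" "\<forall>i<64. F u i = int k * y i" and z: "\<Lambda> z" "\<forall>i<64. F v i = int k * z i"
        using uv unfolding I_def by blast
      have "3 * int k * dot u v = dot (\<lambda>i. int k * y i) (\<lambda>i. int k * z i)"
        unfolding FF[symmetric] by (rule dot_cong) (use y z in auto)
      then have "3 * dot u v = int k * dot y z" using k by (simp add: dot_scale)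
      moreover obtain s where "dot y z = 6 * s" using polar[OF y(1) z(1)] by blast
      ultimately have "dot u v = 2 * int k * s" by simp
      then show ?thesis by simp
    qed
    have norm_I: "\<exists>z. \<Lambda> z \<and> 3 * dot u u = int k * dot z z \<and> (dot z z = 0 \<longrightarrow> (\<forall>i<64. u i = 0))" if u: "I u" for u
    proof -
      obtain z where z: "\<Lambda> z" "\<forall>i<64. F u i = int k * z i" using u unfolding I_def by blast
      have "3 * int k * dot u u = dot (\<lambda>i. int k * z i) (\<lambda>i. int k * z i)"
        unfolding FF[symmetric] by (rule dot_cong) (use z in auto)
      then have eq: "3 * dot u u = int k * dot z z" using k by (simp add: dot_scale)
      moreover have "\<forall>i<64. u i = 0" if "dot z z = 0"
        using eq that dot_self_eq_0[of u] by simp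
      ultimately show ?thesis using z(1) by blast
    qed
    show "4 * int k dvd dot u u" if u: "I u" for u
    proof -
      obtain z where "\<Lambda> z" "3 * dot u u = int k * dot z z" using norm_I[OF u] by blast
      moreover then obtain s where "dot z z = 12 * s" using norm by blast
      ultimately have "dot u u = 4 * int k * s" by simp
      then show ?thesis by simp
    qed
    show "2 * int k dvd u i" if u: "I u" "dot u u < 12 * int k" "i < 64" for u i
    proof -
      obtain z where z: "\<Lambda> z" "3 * dot u u = int k * dot z z" "dot z z = 0 \<longrightarrow> (\<forall>i<64. u i = 0)"
        using norm_I[OF u(1)] by blast
      have "int k * dot z z < int k * 36" using z(2) u(2) by linarith
      then have "dot z z < 36" using k by simp
      then have "dot z z = dot (\<lambda>i. 0) (\<lambda>i. 0)" by (intro dot_cong) (auto intro: min z(1))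
      then have "u i = 0" using z(3) u(3) by (simp add: dot_def)
      then show ?thesis by simp
    qed
    \<comment> \<open>The inner products of z / sqrt 6 with the frame vectors 2 F e_i / sqrt 6 are
      the entries of G z / 3, and F G = 3k turns this into F u = k z.\<close>
    have third: "I (\<lambda>i. G z i div 3)" if "\<Lambda> z" for z
      unfolding I_def
    proof (rule exI[of _ z], intro conjI allI impI that)
      fix i :: nat assume "i < 64"
      have "3 * F (\<lambda>i. G z i div 3) i = F (\<lambda>i. 3 * (G z i div 3)) i" by (simp add: F_scale)
      also have "\<dots> = F (G z) i" by (rule F_cong) (simp add: G3[OF that])
      finally show "F (\<lambda>i. G z i div 3) i = int k * z i" using FG[OF \<open>i < 64\<close>, of z] by simp
    qed
    show "I u" if u: "\<And>v. I v \<Longrightarrow> 2 * int k dvd dot u v" for u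
    proof -
      have dvd: "6 * int k dvd dot (F u) z" if "\<Lambda> z" for z
      proof -
        have "2 * int k dvd dot u (\<lambda>i. G z i div 3)" by (intro u third that)
        moreover have "dot u (G z) = dot u (\<lambda>i. 3 * (G z i div 3))"
          by (rule dot_cong) (simp_all add: G3[OF that])
        ultimately show ?thesis by (auto simp: adj dot_scale elim!: dvdE)
      qed
      \<comment> \<open>The vectors 6 e_i lie in the lattice. Pairing F u with them shows that k
        divides F u, so that F u / k is an integral candidate for z.\<close>
      have six: "\<Lambda> (\<lambda>j. if j = i then 6 else 0)" for i
        by (rule dual) (auto simp: dot_def if_distrib if_distribR sum.delta cong: if_cong intro!: dvd_sum)
      have kdvd: "int k dvd F u i" if "i < 64" for i
      proof -
        have "dot (F u) (\<lambda>j. if j = i then 6 else 0) = 6 * F u i"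
          using that by (simp add: dot_def if_distrib if_distribR sum.delta cong: if_cong)
        then show ?thesis using dvd[OF six[of i]] by (auto elim!: dvdE)
      qed
      define y where "y = (\<lambda>i. F u i div int k)"
      have y: "F u i = int k * y i" if "i < 64" for i using kdvd[OF that] by (simp add: y_def)
      have "\<Lambda> y"
      proof (rule dual)
        fix z assume "\<Lambda> z"
        have "dot (F u) z = dot (\<lambda>i. int k * y i) z" by (rule dot_cong) (simp_all add: y)
        then show "6 dvd dot y z" using dvd[OF \<open>\<Lambda> z\<close>] k by (auto simp: dot_scale mult.commute)
      qed
      then show ?thesis using y by (auto simp: I_def)
    qed
    define u0 where "u0 = (\<lambda>i. G z0 i div 3)"
    show "I u0" unfolding u0_def by (rule third[OF z0(1)])
    have u0: "F u0 i = int k * z0 i" if "i < 64" for i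
    proof -
      have "3 * F u0 i = F (\<lambda>i. 3 * u0 i) i" by (simp add: F_scale)
      also have "\<dots> = F (G z0) i" unfolding u0_def by (rule F_cong) (simp add: G3[OF z0(1)])
      finally show ?thesis using FG[OF that, of z0] by simp
    qed
    have "3 * int k * dot u0 u0 = dot (\<lambda>i. int k * z0 i) (\<lambda>i. int k * z0 i)"
      unfolding FF[symmetric] by (rule dot_cong) (use u0 in auto)
    then show "dot u0 u0 = 12 * int k" using k z0(2) by (simp add: dot_scale)
    \<comment> \<open>If 2k divided all of u0, then z0 = F u0 / k would have only even
      entries.\<close>
    have "\<exists>i<64. \<not> 2 * int k dvd u0 i"
    proof (rule ccontr)
      assume "\<not> (\<exists>i<64. \<not> 2 * int k dvd u0 i)"
      then have "u0 i = 2 * int k * (u0 i div (2 * int k))" if "i < 64" for i using that by simp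
      then have "F u0 i0 = F (\<lambda>i. 2 * int k * (u0 i div (2 * int k))) i0" by (rule F_cong)
      then have "z0 i0 = 2 * F (\<lambda>i. u0 i div (2 * int k)) i0"
        using u0[OF z0(3)] k by (simp add: F_scale)
      then show False using z0(4) by simp
    qed
    then show "(SOME i. i < 64 \<and> \<not> 2 * int k dvd u0 i) < 64"
      "\<not> 2 * int k dvd u0 (SOME i. i < 64 \<and> \<not> 2 * int k dvd u0 i)"
      by (metis (mono_tags, lifting) someI_ex)+
  qed
qed

section \<open>The lattice and its similarities\<close>

text \<open>Vectors are rows and the matrix acts from the right, so that left multiplication by
  quaternions commutes with it.\<close>

definition rmul :: "(nat \<Rightarrow> nat \<Rightarrow> quat) \<Rightarrow> (nat \<Rightarrow> quat) \<Rightarrow> nat \<Rightarrow> quat" where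
  "rmul M p = (\<lambda>j. \<Sum>i<4. p i * M i j)"

definition adjm :: "(nat \<Rightarrow> nat \<Rightarrow> quat) \<Rightarrow> nat \<Rightarrow> nat \<Rightarrow> quat" where
  "adjm M = (\<lambda>i j. qcnj (M j i))"

definition ip :: "(nat \<Rightarrow> quat) \<Rightarrow> (nat \<Rightarrow> quat) \<Rightarrow> int" where
  "ip p q = (\<Sum>i<4. qdot (p i) (q i))"

lemma rmul_lin:
  "rmul M (\<lambda>i. p i + q i) j = rmul M p j + rmul M q j"
  "rmul M (\<lambda>i. p i - q i) j = rmul M p j - rmul M q j"
  "rmul M (\<lambda>i. u * p i) j = u * rmul M p j"
  "rmul M (\<lambda>i. - p i) j = - rmul M p j"
  "rmul M (\<lambda>i. 0) j = 0"
  by (simp_all add: rmul_def algebra_simps sum.distrib sum_subtractf sum_distrib_left sum_negf)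

lemma ip_lin:
  "ip (\<lambda>i. p i + q i) r = ip p r + ip q r" "ip r (\<lambda>i. p i + q i) = ip r p + ip r q"
  "ip (\<lambda>i. p i - q i) r = ip p r - ip q r" "ip r (\<lambda>i. p i - q i) = ip r p - ip r q"
  "ip (\<lambda>i. of_int n * p i) r = n * ip p r" "ip r (\<lambda>i. of_int n * p i) = n * ip r p"
  "ip (\<lambda>i. numeral w * p i) r = numeral w * ip p r" "ip r (\<lambda>i. numeral w * p i) = numeral w * ip r p"
  by (simp_all add: ip_def algebra_simps sum.distrib sum_subtractf sum_distrib_left)

lemma ip_mult_left: "ip (\<lambda>i. u * p i) q = ip p (\<lambda>i. qcnj u * q i)"
  by (simp add: ip_def qdot_mult_left)

lemma ip_rmul: "ip (rmul M p) q = ip p (rmul (adjm M) q)"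
proof -
  have "ip (rmul M p) q = (\<Sum>j<4. \<Sum>i<4. qdot (p i) (q j * qcnj (M i j)))"
    by (simp add: ip_def rmul_def qdot_sum qdot_mult_right)
  also have "\<dots> = ip p (rmul (adjm M) q)"
    by (subst sum.swap) (simp add: ip_def rmul_def adjm_def qdot_sum)
  finally show ?thesis .
qed

lemma adjm_adjm [simp]: "adjm (adjm M) = M"
  by (simp add: adjm_def)

lemma ip_rmul_adjm: "ip (rmul (adjm M) p) q = ip p (rmul M q)"
  using ip_rmul[of "adjm M"] by simp

definition Qm :: "nat \<Rightarrow> nat \<Rightarrow> quat" where
  "Qm i j =
    [[Quat 1 2 (-1) 1, Quat (-1) 0 0 0, Quat (-1) 0 1 0, Quat 1 0 0 0],
     [Quat 1 0 0 0, Quat 1 (-2) (-1) (-1), Quat 1 0 0 0, Quat 1 0 (-1) 0],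
     [Quat 1 0 0 0, Quat 0 1 1 0, Quat 1 (-2) (-1) 1, Quat 1 0 0 0],
     [Quat 0 1 (-1) 0, Quat 1 0 0 0, Quat 1 0 0 0, Quat (-1) (-2) 1 1]] ! i ! j"

abbreviation "K \<equiv> rmul Qm"
abbreviation "K' \<equiv> rmul (adjm Qm)"

lemma less_4_cases: "i < (4::nat) \<Longrightarrow> i = 0 \<or> i = 1 \<or> i = 2 \<or> i = 3"
  by auto

lemma rmul_rmul_scalar:
  assumes "\<And>i l. i < 4 \<Longrightarrow> l < 4 \<Longrightarrow> (\<Sum>j<4. M i j * N j l) = (if i = l then 11 else 0)" "l < 4"
  shows "rmul N (rmul M p) l = 11 * p l"
proof -
  have "rmul N (rmul M p) l = (\<Sum>j<4. \<Sum>i<4. p i * M i j * N j l)"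
    by (simp add: rmul_def sum_distrib_right)
  also have "\<dots> = (\<Sum>i<4. p i * (\<Sum>j<4. M i j * N j l))"
    by (subst sum.swap) (simp add: sum_distrib_left mult.assoc)
  also have "\<dots> = (\<Sum>i<4. if i = l then p i * 11 else 0)"
    by (rule sum.cong) (use assms in auto)
  also have "\<dots> = 11 * p l"
    using assms(2) by (simp add: sum.delta quat_eq_iff)
  finally show ?thesis .
qed

lemma sum_4: "(\<Sum>i<4. f i) = f 0 + f 1 + f 2 + f (3::nat)"
  by (simp add: eval_nat_numeral)

lemma Qm_unitary:
  "i < 4 \<Longrightarrow> l < 4 \<Longrightarrow> (\<Sum>j<4. Qm i j * adjm Qm j l) = (if i = l then 11 else 0)"
  "i < 4 \<Longrightarrow> l < 4 \<Longrightarrow> (\<Sum>j<4. adjm Qm i j * Qm j l) = (if i = l then 11 else 0)"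
  by (drule less_4_cases, drule less_4_cases, elim disjE;
      simp add: sum_4 Qm_def adjm_def quat_eq_iff)+

lemma K_inverse: "l < 4 \<Longrightarrow> K' (K p) l = 11 * p l" "l < 4 \<Longrightarrow> K (K' p) l = 11 * p l"
  by (rule rmul_rmul_scalar; simp add: Qm_unitary)+

text \<open>\<open>Fop \<xi> b a c\<close> is the endomorphism \<open>3\<xi> + bT\<close> of the lattice, where \<open>T\<close> is skew-adjoint,
  \<open>T\<^sup>2 = -(a\<^sup>2 + 11c\<^sup>2)\<close>, and \<open>T\<close> intertwines \<open>\<xi>\<close> with its conjugate.\<close>

definition Fop :: "quat \<Rightarrow> int \<Rightarrow> int \<Rightarrow> int \<Rightarrow> (nat \<Rightarrow> nat \<Rightarrow> quat) \<Rightarrow> nat \<Rightarrow> nat \<Rightarrow> quat" where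
  "Fop \<xi> b a c z s =
    (if s = 0 then (\<lambda>i. 3 * (\<xi> * z 0 i) - of_int b * (of_int a * z 2 i + of_int c * K' (z 3) i))
     else if s = 1 then (\<lambda>i. 3 * (\<xi> * z 1 i) - of_int b * (of_int a * z 3 i - of_int c * K (z 2) i))
     else if s = 2 then (\<lambda>i. 3 * (qcnj \<xi> * z 2 i) + of_int b * (of_int a * z 0 i - of_int c * K' (z 1) i))
     else (\<lambda>i. 3 * (qcnj \<xi> * z 3 i) + of_int b * (of_int a * z 1 i + of_int c * K (z 0) i)))"

text \<open>The conjugate of \<xi> on the last two components makes the mixed terms of 3\<xi> and bT
  cancel. What remains is 9 |\<xi>|^2 - b^2 T^2, where \<open>K'\<close> after \<open>K\<close>
  accounts for the 11.\<close>

lemma Fop_inverse: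
  assumes "s < 4" "i < 4"
  shows "Fop (qcnj \<xi>) (- b) a c (Fop \<xi> b a c z) s i
    = of_int (9 * qnorm \<xi> + (a\<^sup>2 + 11 * c\<^sup>2) * b\<^sup>2) * z s i"
proof -
  have "q * (of_int n * x) = of_int n * (q * x)" "q * (3 * x) = 3 * (q * x)" for q x :: quat and n
    by (simp_all add: quat_eq_iff algebra_simps)
  note sc = this[where q = \<xi>] this[where q = "qcnj \<xi>"]
  have cnj: "\<xi> * (qcnj \<xi> * x) = of_int (qnorm \<xi>) * x" "qcnj \<xi> * (\<xi> * x) = of_int (qnorm \<xi>) * x" for x
    by (simp_all add: mult.assoc[symmetric] mult_qcnj)
  have sel: "qre (of_int n * x) = n * qre x" "qi (of_int n * x) = n * qi x"
    "qj (of_int n * x) = n * qj x" "qk (of_int n * x) = n * qk x"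
    "qre (numeral w * x) = numeral w * qre x" "qi (numeral w * x) = numeral w * qi x"
    "qj (numeral w * x) = numeral w * qj x" "qk (numeral w * x) = numeral w * qk x"
    for n :: int and w and x :: quat
    by simp_all
  show ?thesis
    using less_4_cases[OF assms(1)]
    by (elim disjE; simp add: Fop_def rmul_lin K_inverse[OF assms(2)] distrib_left right_diff_distrib sc cnj;
      simp add: quat_eq_iff sel algebra_simps power2_eq_square del: quat_mult_sel)
qed

definition D :: "(nat \<Rightarrow> nat \<Rightarrow> quat) \<Rightarrow> (nat \<Rightarrow> nat \<Rightarrow> quat) \<Rightarrow> int" where
  "D x y = (\<Sum>s<4. ip (x s) (y s))"

lemma Fop_adjoint: "D (Fop \<xi> b a c x) y = D x (Fop (qcnj \<xi>) (- b) a c y)"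
proof -
  have "ip (\<lambda>i. u * p i) q = ip p (\<lambda>i. qcnj u * q i)" for u p q by (rule ip_mult_left)
  then show ?thesis
    by (simp add: D_def sum_4 Fop_def ip_lin ip_rmul ip_rmul_adjm algebra_simps)
qed

section \<open>Vectors of length 64 as quaternion blocks\<close>

definition blk :: "(nat \<Rightarrow> int) \<Rightarrow> nat \<Rightarrow> nat \<Rightarrow> quat" where
  "blk u s i = (let n = 16 * s + 4 * i in Quat (u n) (u (n + 1)) (u (n + 2)) (u (n + 3)))"

definition flat :: "(nat \<Rightarrow> nat \<Rightarrow> quat) \<Rightarrow> nat \<Rightarrow> int" where
  "flat z n = (if n < 64 then
     (let q = z (n div 16) (n div 4 mod 4) in [qre q, qi q, qj q, qk q] ! (n mod 4)) else 0)"

lemma sum_lessThan_numeral: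
  "(\<Sum>i<numeral w. f i) = (\<Sum>i<pred_numeral w. f i) + (f (pred_numeral w) :: int)"
  by (simp add: numeral_eq_Suc)

lemma dot_eq_D: "dot u v = D (blk u) (blk v)"
proof -
  have "dot u v = (\<Sum>s<4. \<Sum>i<4. \<Sum>h<4. u (16 * s + 4 * i + h) * v (16 * s + 4 * i + h))"
    unfolding dot_def by (simp only: sum_lessThan_numeral pred_numeral_simps arith_simps)
      (simp add: sum_lessThan_numeral)
  then show ?thesis
    by (simp add: D_def ip_def sum_4[of "\<lambda>h. u (16 * s + 4 * i + h) * v (16 * s + 4 * i + h)" for s i]
        blk_def qdot_def Let_def)
qed

lemma blk_flat: "s < 4 \<Longrightarrow> i < 4 \<Longrightarrow> blk (flat z) s i = z s i"
  by (drule less_4_cases, drule less_4_cases, elim disjE; simp add: blk_def flat_def Let_def quat_eq_iff)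

lemma flat_blk:
  assumes "n < 64" shows "flat (blk u) n = u n"
proof -
  define s i where "s = n div 16" and "i = n div 4 mod 4"
  have n: "n = 16 * s + 4 * i + n mod 4"
    using div_mult2_eq[of n 4 4, simplified] div_mult_mod_eq[of "n div 4" 4] div_mult_mod_eq[of n 4]
    unfolding s_def i_def by linarith
  have "n mod 4 < 4" by simp
  then have "n mod 4 = 0 \<or> n mod 4 = 1 \<or> n mod 4 = 2 \<or> n mod 4 = 3" by (rule less_4_cases)
  then show ?thesis
    using n assms by (auto simp: flat_def blk_def Let_def s_def[symmetric] i_def[symmetric])
qed

lemma D_cong:
  "(\<And>s i. s < 4 \<Longrightarrow> i < 4 \<Longrightarrow> x s i = x' s i) \<Longrightarrow> (\<And>s i. s < 4 \<Longrightarrow> i < 4 \<Longrightarrow> y s i = y' s i) \<Longrightarrow> D x y = D x' y'"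
  by (simp add: D_def ip_def)

lemma dot_flat: "dot (flat x) v = D x (blk v)" "dot v (flat x) = D (blk v) x"
  by (auto simp: dot_eq_D blk_flat intro!: D_cong)

section \<open>Congruence modulo 3, E8 blocks and the glue\<close>

definition c3 :: "quat \<Rightarrow> bool" where "c3 x \<longleftrightarrow> (\<exists>y. x = 3 * y)"

lemma c3_iff: "c3 x \<longleftrightarrow> 3 dvd qre x \<and> 3 dvd qi x \<and> 3 dvd qj x \<and> 3 dvd qk x"
proof
  assume "3 dvd qre x \<and> 3 dvd qi x \<and> 3 dvd qj x \<and> 3 dvd qk x"
  then have "x = 3 * Quat (qre x div 3) (qi x div 3) (qj x div 3) (qk x div 3)"
    by (simp add: quat_eq_iff)
  then show "c3 x" unfolding c3_def by blast
qed (auto simp: c3_def)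

lemma c3_closed:
  "c3 x \<Longrightarrow> c3 y \<Longrightarrow> c3 (x + y)" "c3 x \<Longrightarrow> c3 y \<Longrightarrow> c3 (x - y)" "c3 x \<Longrightarrow> c3 (u * x)" "c3 x \<Longrightarrow> c3 (x * u)"
  "c3 x \<Longrightarrow> c3 (- x)" "c3 (3 * x)" "c3 0"
  by (auto simp: c3_iff intro!: dvd_add dvd_diff)

lemma c3_sum: "(\<And>i. i \<in> A \<Longrightarrow> c3 (f i)) \<Longrightarrow> c3 (sum f A)"
  by (induction A rule: infinite_finite_induct) (auto simp: c3_closed)

lemma c3_rmul: "(\<And>i. i < 4 \<Longrightarrow> c3 (p i)) \<Longrightarrow> c3 (rmul M p j)"
  unfolding rmul_def by (rule c3_sum) (simp add: c3_closed)

definition qsum :: "quat \<Rightarrow> int" where "qsum x = qre x + qi x + qj x + qk x"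

text \<open>The pairs \<open>(x, y)\<close> with \<open>e8 x y\<close> are the integer vectors whose reduction modulo 2 lies in the
  extended Hamming code of length 8; divided by \<open>\<surd>2\<close> they form the lattice \<open>E\<^sub>8\<close>.\<close>

definition e8 :: "quat \<Rightarrow> quat \<Rightarrow> bool" where
  "e8 x y \<longleftrightarrow> even (qre y + qre x + qsum x) \<and> even (qi y + qi x + qsum x)
     \<and> even (qj y + qj x + qsum x) \<and> even (qk y + qk x + qsum x)"

text \<open>Block i of the second half joins \<open>z 1 i\<close> with \<open>z 3 (rho i)\<close>.
  As \<open>rho\<close> has no fixed point, the two components of an image block are fed by
  different columns of Q.\<close>

definition rho :: "nat \<Rightarrow> nat" where "rho i = [2, 3, 1, 0] ! i"

lemma e8_lin: "e8 x y \<Longrightarrow> e8 x' y' \<Longrightarrow> e8 (x + of_int a * x') (y + of_int a * y')"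
  by (auto simp: e8_def qsum_def algebra_simps)

lemma e8_norm: "e8 x y \<Longrightarrow> 4 dvd qnorm x + qnorm y"
proof -
  assume "e8 x y"
  then obtain a b c d where "qre y + qre x + qsum x = 2 * a" "qi y + qi x + qsum x = 2 * b"
    "qj y + qj x + qsum x = 2 * c" "qk y + qk x + qsum x = 2 * d"
    unfolding e8_def dvd_def by blast
  then have y: "qre y = 2 * a - qre x - qsum x" "qi y = 2 * b - qi x - qsum x"
    "qj y = 2 * c - qj x - qsum x" "qk y = 2 * d - qk x - qsum x" by linarith+
  have eq: "qnorm x + qnorm y = 2 * (qnorm x + qsum x * qsum x)
    + 4 * (qsum x * qsum x + (a * a - a * qre x - a * qsum x) + (b * b - b * qi x - b * qsum x)
      + (c * c - c * qj x - c * qsum x) + (d * d - d * qk x - d * qsum x))"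
    unfolding qdot_def[of y] y by (simp add: qdot_def qsum_def algebra_simps)
  have "even (qnorm x + qsum x * qsum x)"
    by (auto simp: qdot_def qsum_def)
  from mult_dvd_mono[OF dvd_refl[of 2] this] have "4 dvd 2 * (qnorm x + qsum x * qsum x)" by simp
  then show ?thesis unfolding eq by (rule dvd_add) simp
qed

text \<open>The index in the integer vectors is 6^32, namely 3^32 from the glue and 2^32 from the
  eight E8 blocks, as unimodularity after division by sqrt 6 requires. The opposite signs of the two
  glue conditions are the ones for which T vanishes modulo 3 on the lattice when a and c agree
  modulo 3.\<close>

definition LQ :: "(nat \<Rightarrow> nat \<Rightarrow> quat) \<Rightarrow> bool" where
  "LQ z \<longleftrightarrow> (\<forall>i<4. c3 (z 1 i + K (z 0) i) \<and> c3 (z 3 i - K (z 2) i)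
     \<and> e8 (z 0 i) (z 2 i) \<and> e8 (z 1 i) (z 3 (rho i)))"

lemma K_cong: "(\<And>i. i < 4 \<Longrightarrow> p i = q i) \<Longrightarrow> rmul M p j = rmul M q j"
  by (simp add: rmul_def)

lemma rho_less: "i < 4 \<Longrightarrow> rho i < 4"
  by (drule less_4_cases) (auto simp: rho_def)

lemma LQ_cong:
  assumes "LQ x" "\<And>s i. s < 4 \<Longrightarrow> i < 4 \<Longrightarrow> x s i = y s i"
  shows "LQ y"
proof -
  have "K (y s) i = K (x s) i" if "s < 4" for s i
    by (rule K_cong) (simp add: assms(2) that)
  then show ?thesis using assms(1) by (auto simp: LQ_def assms(2)[symmetric] rho_less)
qed

lemma LQ_lin: "LQ x \<Longrightarrow> LQ y \<Longrightarrow> LQ (\<lambda>s i. x s i + of_int a * y s i)"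
proof -
  assume x: "LQ x" and y: "LQ y"
  have eq: "(x 1 i + of_int a * y 1 i) + (K (x 0) i + of_int a * K (y 0) i)
      = (x 1 i + K (x 0) i) + of_int a * (y 1 i + K (y 0) i)"
    "(x 3 i + of_int a * y 3 i) - (K (x 2) i + of_int a * K (y 2) i)
      = (x 3 i - K (x 2) i) + of_int a * (y 3 i - K (y 2) i)" for i
    by (simp_all add: algebra_simps)
  show ?thesis unfolding LQ_def rmul_lin eq using x y by (auto simp: LQ_def c3_closed e8_lin)
qed

lemma ip_self_cong3:
  assumes "\<And>i. i < 4 \<Longrightarrow> c3 (p i - q i)"
  shows "3 dvd ip p p - ip q q"
proof -
  have "3 dvd qnorm (p i) - qnorm (q i)" if i: "i < 4" for i
  proof -
    obtain y where "p i - q i = 3 * y" using assms[OF i] by (auto simp: c3_def)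
    then have "p i = q i + 3 * y" by (simp add: algebra_simps)
    then show ?thesis by (simp add: qdot_commute[of y "q i"])
  qed
  then show ?thesis unfolding ip_def sum_subtractf[symmetric] by (intro dvd_sum) auto
qed

lemma ip_K_self: "ip (K p) (K p) = 11 * ip p p"
proof -
  have "ip (K p) (K p) = ip p (K' (K p))" by (rule ip_rmul)
  also have "\<dots> = 11 * ip p p" by (simp add: ip_def K_inverse sum_distrib_left)
  finally show ?thesis .
qed

text \<open>\<open>K\<close> multiplies norms by 11, so the total norm is 12 times that of
  (\<open>z 0\<close>, \<open>z 2\<close>) modulo 3; modulo 4 each E8 block contributes 0.\<close>

lemma LQ_norm: assumes "LQ z" shows "12 dvd D z z"
proof -
  have D: "D z z = ip (z 0) (z 0) + ip (z 1) (z 1) + (ip (z 2) (z 2) + ip (z 3) (z 3))"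
    by (simp add: D_def sum_4)
  have "3 dvd ip (z 1) (z 1) - ip (\<lambda>i. - K (z 0) i) (\<lambda>i. - K (z 0) i)"
    "3 dvd ip (z 3) (z 3) - ip (K (z 2)) (K (z 2))"
    by (rule ip_self_cong3; use assms in \<open>simp add: LQ_def\<close>)+
  moreover have "ip (\<lambda>i. - K (z 0) i) (\<lambda>i. - K (z 0) i) = ip (K (z 0)) (K (z 0))" by (simp add: ip_def)
  ultimately have "3 dvd (ip (z 1) (z 1) - 11 * ip (z 0) (z 0)) + (ip (z 3) (z 3) - 11 * ip (z 2) (z 2))
      + 3 * (4 * (ip (z 0) (z 0) + ip (z 2) (z 2)))"
    unfolding ip_K_self by (intro dvd_add) simp_all
  then have three: "3 dvd D z z" unfolding D by (simp add: algebra_simps)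
  have e: "4 dvd qnorm (z 0 i) + qnorm (z 2 i)" "4 dvd qnorm (z 1 i) + qnorm (z 3 (rho i))" if "i < 4" for i
    using assms that by (auto simp: LQ_def intro: e8_norm)
  have "D z z = (\<Sum>i<4. qnorm (z 0 i) + qnorm (z 2 i)) + (\<Sum>i<4. qnorm (z 1 i) + qnorm (z 3 (rho i)))"
    unfolding D by (simp add: ip_def sum_4 rho_def)
  also have "4 dvd \<dots>" by (intro dvd_add dvd_sum e) auto
  finally have four: "4 dvd D z z" .
  have "12 dvd n" if "3 dvd n" "4 dvd n" for n :: int using that by presburger
  then show ?thesis using three four .
qed

lemma e8_closed: "e8 (2 * x) (2 * y)" "e8 0 0" "e8 (3 * x) (3 * y) \<longleftrightarrow> e8 x y"
  by (simp_all add: e8_def qsum_def)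

text \<open>Applying \<open>K'\<close> to the glue gives K' z1 = -11 z0 and K' z3 = 11 z2 modulo 3,
  with 11 = -1. Every component of T z is therefore a - c times a component of z, up to sign and
  modulo 3.\<close>

lemma Fop_c3:
  assumes "LQ z" "3 dvd a - c" "s < 4" "i < 4"
  shows "c3 (Fop \<xi> b a c z s i)"
proof -
  have z: "c3 (z 1 j + K (z 0) j)" "c3 (z 3 j - K (z 2) j)" if "j < 4" for j
    using assms(1) that by (auto simp: LQ_def)
  have "c3 (K' (\<lambda>j. z 1 j + K (z 0) j) i)" "c3 (K' (\<lambda>j. z 3 j - K (z 2) j) i)"
    by (rule c3_rmul, rule z, assumption)+
  then have K': "c3 (K' (z 1) i + 11 * z 0 i)" "c3 (K' (z 3) i - 11 * z 2 i)"
    by (simp_all add: rmul_lin K_inverse assms(4))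
  obtain e where e: "a = c + 3 * e" using assms(2) by (auto elim!: dvdE simp: algebra_simps)
  have eq0: "of_int a * z 2 i + of_int c * K' (z 3) i
      = of_int c * (K' (z 3) i - 11 * z 2 i) + 3 * (of_int (e + 4 * c) * z 2 i)"
    by (simp add: e quat_eq_iff algebra_simps)
  have eq1: "of_int a * z 3 i - of_int c * K (z 2) i
      = of_int c * (z 3 i - K (z 2) i) + 3 * (of_int e * z 3 i)"
    by (simp add: e quat_eq_iff algebra_simps)
  have eq2: "of_int a * z 0 i - of_int c * K' (z 1) i
      = 3 * (of_int (e + 4 * c) * z 0 i) - of_int c * (K' (z 1) i + 11 * z 0 i)"
    by (simp add: e quat_eq_iff algebra_simps)
  have eq3: "of_int a * z 1 i + of_int c * K (z 0) i
      = of_int c * (z 1 i + K (z 0) i) + 3 * (of_int e * z 1 i)"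
    by (simp add: e quat_eq_iff algebra_simps)
  have "c3 (of_int a * z 2 i + of_int c * K' (z 3) i)" "c3 (of_int a * z 3 i - of_int c * K (z 2) i)"
    "c3 (of_int a * z 0 i - of_int c * K' (z 1) i)" "c3 (of_int a * z 1 i + of_int c * K (z 0) i)"
    unfolding eq0 eq1 eq2 eq3 by (simp_all add: c3_closed K' z assms(4) del: One_nat_def)
  then show ?thesis
    unfolding Fop_def by (simp add: c3_closed del: One_nat_def split: if_split)
qed

text \<open>The factor 2 settles the parity conditions, so only the glue remains, for an arbitrary
  integer vector u. Through the adjoint and the self-duality of the lattice this is the counterpart
  of \<open>Fop_c3\<close>.\<close>

lemma LQ_2_Fop:
  assumes "3 dvd a - c"
  shows "LQ (\<lambda>s i. 2 * Fop \<xi> b a c u s i)"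
proof -
  obtain e where e: "a = c + 3 * e" using assms by (auto elim!: dvdE simp: algebra_simps)
  have "q * (of_int n * x) = of_int n * (q * x)" "q * (3 * x) = 3 * (q * x)" for q x :: quat and n
    by (simp_all add: quat_eq_iff algebra_simps)
  note sc = this[where q = \<xi>] this[where q = "qcnj \<xi>"]
  have 1: "Fop \<xi> b a c u 1 i + K (Fop \<xi> b a c u 0) i =
      3 * (\<xi> * (u 1 i + K (u 0) i) - of_int (b * e) * (u 3 i + K (u 2) i) - of_int (4 * b * c) * u 3 i)"
    if "i < 4" for i
    by (simp add: Fop_def rmul_lin K_inverse that sc; simp add: quat_eq_iff e algebra_simps)
  have 2: "Fop \<xi> b a c u 3 i - K (Fop \<xi> b a c u 2) i =
      3 * (qcnj \<xi> * (u 3 i - K (u 2) i) + of_int (b * e) * (u 1 i - K (u 0) i) + of_int (4 * b * c) * u 1 i)"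
    if "i < 4" for i
    by (simp add: Fop_def rmul_lin K_inverse that sc; simp add: quat_eq_iff e algebra_simps)
  have eq: "2 * Fop \<xi> b a c u 1 i + 2 * K (Fop \<xi> b a c u 0) i = 2 * (Fop \<xi> b a c u 1 i + K (Fop \<xi> b a c u 0) i)"
    "2 * Fop \<xi> b a c u 3 i - 2 * K (Fop \<xi> b a c u 2) i = 2 * (Fop \<xi> b a c u 3 i - K (Fop \<xi> b a c u 2) i)" for i
    by (simp_all add: algebra_simps)
  have "c3 (Fop \<xi> b a c u 1 i + K (Fop \<xi> b a c u 0) i)" "c3 (Fop \<xi> b a c u 3 i - K (Fop \<xi> b a c u 2) i)"
    if "i < 4" for i
    unfolding 1[OF that] 2[OF that] by (rule c3_closed(6))+
  then show ?thesis
    unfolding LQ_def rmul_lin eq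
    by (simp add: c3_closed e8_closed del: distrib_left_numeral right_diff_distrib_numeral)
qed

definition single :: "nat \<Rightarrow> quat \<Rightarrow> nat \<Rightarrow> quat" where
  "single i q = (\<lambda>j. if j = i then q else 0)"

lemma ip_single: "i < 4 \<Longrightarrow> ip p (single i q) = qdot (p i) q"
  by (simp add: ip_def single_def if_distrib sum.delta cong: if_cong)

lemma ip_uminus: "ip p (\<lambda>i. - q i) = - ip p q"
  by (simp add: ip_def sum_negf)

lemma e8_even: "e8 (2 * x) (2 * y)" "e8 (2 * x) 0" "e8 0 (2 * y)" "e8 (- (2 * x)) 0" "e8 0 0"
  by (auto simp: e8_def qsum_def)

lemma unit_coord:
  "qdot x (Quat 1 0 0 0) = qre x" "qdot x (Quat 0 1 0 0) = qi x"
  "qdot x (Quat 0 0 1 0) = qj x" "qdot x (Quat 0 0 0 1) = qk x"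
  by (simp_all add: qdot_def)

definition parts :: "(nat \<Rightarrow> quat) \<Rightarrow> (nat \<Rightarrow> quat) \<Rightarrow> (nat \<Rightarrow> quat) \<Rightarrow> (nat \<Rightarrow> quat) \<Rightarrow> nat \<Rightarrow> nat \<Rightarrow> quat" where
  "parts p0 p1 p2 p3 s = [p0, p1, p2, p3] ! s"

lemma D_parts: "D z (parts p0 p1 p2 p3) = ip (z 0) p0 + ip (z 1) p1 + ip (z 2) p2 + ip (z 3) p3"
  by (simp add: D_def sum_4 parts_def)

lemma rho_inj: "i < 4 \<Longrightarrow> j < 4 \<Longrightarrow> rho i = rho j \<longleftrightarrow> i = j"
  by (drule less_4_cases, drule less_4_cases, elim disjE) (simp_all add: rho_def)

text \<open>The Hamming code is self-dual; testing against four generators already forces the parity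
  conditions.\<close>

lemma e8_dual:
  assumes "\<And>p q. e8 p q \<Longrightarrow> even (qdot x p + qdot y q)"
  shows "e8 x y"
proof -
  have "e8 (Quat 1 0 0 0) (Quat 0 1 1 1)" "e8 (Quat 0 1 0 0) (Quat 1 0 1 1)"
    "e8 (Quat 0 0 1 0) (Quat 1 1 0 1)" "e8 (Quat 0 0 0 1) (Quat 1 1 1 0)"
    by (simp_all add: e8_def qsum_def)
  from this[THEN assms] show ?thesis
    by (simp add: unit_coord) (simp add: qdot_def e8_def qsum_def; presburger)
qed

text \<open>Two families of lattice vectors serve as tests. A tripled E8 vector in a single block
  has trivial glue and detects parity; twice a glue vector (q, -Kq, 0, 0) or (0, 0, q, Kq) has
  trivial parity and detects the congruences modulo 3.\<close>

lemma LQ_dual: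
  assumes z: "\<And>y. LQ y \<Longrightarrow> 6 dvd D z y"
  shows "LQ z"
proof -
  have e: "e8 (z 0 i) (z 2 i)" "e8 (z 1 i) (z 3 (rho i))" if i: "i < 4" for i
  proof -
    show "e8 (z 0 i) (z 2 i)"
    proof (rule e8_dual)
      fix p q assume "e8 p q"
      then have "LQ (parts (single i (3 * p)) (\<lambda>j. 0) (single i (3 * q)) (\<lambda>j. 0))"
        by (auto simp: LQ_def parts_def single_def e8_closed intro!: c3_closed c3_rmul)
      from z[OF this] show "even (qdot (z 0 i) p + qdot (z 2 i) q)"
        using i by (simp add: D_parts ip_single) (simp add: ip_def; presburger)
    qed
    show "e8 (z 1 i) (z 3 (rho i))"
    proof (rule e8_dual)
      fix p q assume "e8 p q"
      then have "LQ (parts (\<lambda>j. 0) (single i (3 * p)) (\<lambda>j. 0) (single (rho i) (3 * q)))"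
        using i by (auto simp: LQ_def parts_def single_def e8_closed rho_inj rmul_lin intro!: c3_closed c3_rmul)
      from z[OF this] show "even (qdot (z 1 i) p + qdot (z 3 (rho i)) q)"
        using i by (simp add: D_parts ip_single rho_less) (simp add: ip_def; presburger)
    qed
  qed
  have half: "6 dvd 2 * m - 2 * n \<Longrightarrow> 3 dvd m - n" "6 dvd 2 * m + 2 * n \<Longrightarrow> 3 dvd m + n" for m n :: int
    by presburger+
  have c: "c3 (z 0 i - K' (z 1) i)" "c3 (z 2 i + K' (z 3) i)" if i: "i < 4" for i
  proof -
    have "3 dvd qdot (z 0 i - K' (z 1) i) q" for q
    proof -
      have "LQ (parts (\<lambda>j. 2 * single i q j) (\<lambda>j. - (2 * K (single i q) j)) (\<lambda>j. 0) (\<lambda>j. 0))"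
        by (simp add: LQ_def parts_def rmul_lin e8_even c3_closed)
      from z[OF this] show ?thesis
        using i by (simp add: D_parts ip_lin ip_uminus ip_rmul_adjm[symmetric] ip_single; simp add: ip_def half)
    qed
    then show "c3 (z 0 i - K' (z 1) i)" by (metis c3_iff unit_coord)
    have "3 dvd qdot (z 2 i + K' (z 3) i) q" for q
    proof -
      have "LQ (parts (\<lambda>j. 0) (\<lambda>j. 0) (\<lambda>j. 2 * single i q j) (\<lambda>j. 2 * K (single i q) j))"
        by (simp add: LQ_def parts_def rmul_lin e8_even c3_closed)
      from z[OF this] show ?thesis
        using i by (simp add: D_parts ip_lin ip_rmul_adjm[symmetric] ip_single; simp add: ip_def half)
    qed
    then show "c3 (z 2 i + K' (z 3) i)" by (metis c3_iff unit_coord)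
  qed
  \<comment> \<open>The tests yield the glue in terms of \<open>K'\<close>; applying
    \<open>K\<close> and using 11 = -1 modulo 3 brings it back to the defining form.\<close>
  have ck: "c3 (K (\<lambda>j. z 0 j - K' (z 1) j) i)" "c3 (K (\<lambda>j. z 2 j + K' (z 3) j) i)" for i
    by (simp_all only: c3_rmul c)
  have k: "c3 (K (z 0) i - 11 * z 1 i)" "c3 (K (z 2) i + 11 * z 3 i)" if "i < 4" for i
    using ck[of i] that by (simp_all add: rmul_lin K_inverse)
  have eq: "z 1 i + K (z 0) i = (K (z 0) i - 11 * z 1 i) + 3 * (4 * z 1 i)"
    "z 3 i - K (z 2) i = 3 * (4 * z 3 i) - (K (z 2) i + 11 * z 3 i)" for i
    by (simp_all add: quat_eq_iff)
  have "c3 (z 1 i + K (z 0) i)" "c3 (z 3 i - K (z 2) i)" if "i < 4" for i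
    unfolding eq by (rule c3_closed k that c3_closed(6))+
  then show ?thesis using e unfolding LQ_def by blast
qed

text \<open>Three times the E8 root (1, 0, 0, 0; 0, 1, 1, 1) in block 0: the factor 3 trivialises
  the glue, the norm is 9 * 4 = 36, and there are odd entries.\<close>

definition zmin :: "nat \<Rightarrow> nat \<Rightarrow> quat" where
  "zmin = parts (single 0 (Quat 3 0 0 0)) (\<lambda>j. 0) (single 0 (Quat 0 3 3 3)) (\<lambda>j. 0)"

lemma zmin: "LQ zmin" "D zmin zmin = 36"
proof -
  have "c3 (single 0 (Quat 3 0 0 0) j)" "c3 (single 0 (Quat 0 3 3 3) j)" for j
    by (auto simp: single_def c3_iff)
  then show "LQ zmin"
    by (auto simp: LQ_def zmin_def parts_def c3_closed c3_rmul) (auto simp: single_def e8_def qsum_def)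
  show "D zmin zmin = 36"
    by (simp add: zmin_def D_parts) (simp add: parts_def ip_def sum_4 single_def qdot_def)
qed

section \<open>The minimum norm\<close>

datatype tri = T0 | T1 | T2

text \<open>Arithmetic by exhaustive equations on constructors lets the finite checks run by ground
  rewriting, without reducing integers modulo 3.\<close>

fun add3 :: "tri \<Rightarrow> tri \<Rightarrow> tri" where
  "add3 T0 y = y" | "add3 T1 T0 = T1" | "add3 T1 T1 = T2" | "add3 T1 T2 = T0"
| "add3 T2 T0 = T2" | "add3 T2 T1 = T0" | "add3 T2 T2 = T1"

fun neg3 :: "tri \<Rightarrow> tri" where
  "neg3 T0 = T0" | "neg3 T1 = T2" | "neg3 T2 = T1"

fun mul3 :: "tri \<Rightarrow> tri \<Rightarrow> tri" where
  "mul3 T0 y = T0" | "mul3 T1 y = y" | "mul3 T2 y = neg3 y"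

datatype v4 = V tri tri tri tri

fun add4 :: "v4 \<Rightarrow> v4 \<Rightarrow> v4" where
  "add4 (V a b c d) (V e f g h) = V (add3 a e) (add3 b f) (add3 c g) (add3 d h)"

fun neg4 :: "v4 \<Rightarrow> v4" where
  "neg4 (V a b c d) = V (neg3 a) (neg3 b) (neg3 c) (neg3 d)"

fun mul4 :: "v4 \<Rightarrow> v4 \<Rightarrow> v4" where
  "mul4 (V a b c d) (V e f g h) = V
    (add3 (add3 (add3 (mul3 a e) (neg3 (mul3 b f))) (neg3 (mul3 c g))) (neg3 (mul3 d h)))
    (add3 (add3 (add3 (mul3 a f) (mul3 b e)) (mul3 c h)) (neg3 (mul3 d g)))
    (add3 (add3 (add3 (mul3 a g) (neg3 (mul3 b h))) (mul3 c e)) (mul3 d f))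
    (add3 (add3 (add3 (mul3 a h) (mul3 b g)) (neg3 (mul3 c f))) (mul3 d e))"

fun sq3 :: "tri \<Rightarrow> tri" where
  "sq3 T0 = T0" | "sq3 T1 = T1" | "sq3 T2 = T1"

fun nrm4 :: "v4 \<Rightarrow> tri" where
  "nrm4 (V a b c d) = add3 (add3 (add3 (sq3 a) (sq3 b)) (sq3 c)) (sq3 d)"

text \<open>The conjugate times the norm n. A nonzero n in the field with three elements is its own
  inverse, so the product replaces a division.\<close>

fun inv4 :: "v4 \<Rightarrow> v4" where
  "inv4 (V a b c d) = (let n = nrm4 (V a b c d)
     in V (mul3 n a) (neg3 (mul3 n b)) (neg3 (mul3 n c)) (neg3 (mul3 n d)))"

definition cls3 :: "int \<Rightarrow> tri" where
  "cls3 v = (if v mod 3 = 0 then T0 else if v mod 3 = 1 then T1 else T2)"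

definition cls :: "quat \<Rightarrow> v4" where
  "cls x = V (cls3 (qre x)) (cls3 (qi x)) (cls3 (qj x)) (cls3 (qk x))"

abbreviation "O4 \<equiv> V T0 T0 T0 T0"

lemma cls3_0 [simp]: "cls3 0 = T0" "cls3 1 = T1" "cls3 (- 1) = T2"
  by (simp_all add: cls3_def)

lemma mod_3_cases: "(v :: int) mod 3 = 0 \<or> v mod 3 = 1 \<or> v mod 3 = 2"
  by presburger

lemma cls3_eq_iff: "cls3 a = cls3 b \<longleftrightarrow> 3 dvd a - b"
  using mod_3_cases[of a] mod_3_cases[of b] by (auto simp: cls3_def mod_eq_dvd_iff[symmetric])

lemma cls3_hom:
  "cls3 (a + b) = add3 (cls3 a) (cls3 b)"
  "cls3 (- a) = neg3 (cls3 a)"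
  "cls3 (a * b) = mul3 (cls3 a) (cls3 b)"
proof -
  have a: "a mod 3 = 0 \<or> a mod 3 = 1 \<or> a mod 3 = 2" and b: "b mod 3 = 0 \<or> b mod 3 = 1 \<or> b mod 3 = 2"
    by (rule mod_3_cases)+
  show "cls3 (a + b) = add3 (cls3 a) (cls3 b)"
    using a b by (elim disjE; simp add: cls3_def mod_add_eq[of a 3 b, symmetric])
  show "cls3 (- a) = neg3 (cls3 a)"
    using a by (elim disjE; simp add: cls3_def mod_minus_eq[of a 3, symmetric])
  show "cls3 (a * b) = mul3 (cls3 a) (cls3 b)"
    using a b by (elim disjE; simp add: cls3_def mod_mult_eq[of a 3 b, symmetric])
qed

lemma cls3_diff: "cls3 (a - b) = add3 (cls3 a) (neg3 (cls3 b))"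
  using cls3_hom(1)[of a "- b"] by (simp add: cls3_hom)

lemma cls_hom:
  "cls (x + y) = add4 (cls x) (cls y)" "cls (- x) = neg4 (cls x)" "cls (x * y) = mul4 (cls x) (cls y)"
  by (simp_all add: cls_def cls3_hom cls3_diff)

lemma cls_eq_iff: "cls x = cls y \<longleftrightarrow> c3 (x - y)"
  by (simp add: cls_def cls3_eq_iff c3_iff)

lemma cls_0 [simp]: "cls 0 = O4"
  by (simp add: cls_def)

lemma cls_eq_O4: "cls x = O4 \<longleftrightarrow> c3 x"
  using cls_eq_iff[of x 0] by simp

lemma mul3_self: "mul3 a a = sq3 a"
  by (cases a) simp_all

lemma cls3_square: "cls3 (a * a) = sq3 (cls3 a)"
  by (simp add: cls3_hom mul3_self)

lemma cls3_qnorm: "cls3 (qnorm x) = nrm4 (cls x)"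
  by (simp add: qdot_def cls_def cls3_hom mul3_self)

lemma inv4_cls: "inv4 (cls q) = cls (of_int (qnorm q) * qcnj q)"
proof -
  have "inv4 (cls q) = (let n = cls3 (qnorm q) in V (mul3 n (cls3 (qre q))) (neg3 (mul3 n (cls3 (qi q))))
      (neg3 (mul3 n (cls3 (qj q)))) (neg3 (mul3 n (cls3 (qk q)))))"
    unfolding cls3_qnorm by (simp add: cls_def)
  then show ?thesis by (simp add: cls_def Let_def cls3_hom)
qed

lemma right_inverse_mod_3:
  assumes "\<not> 3 dvd qnorm q"
  shows "cls (x * q * (of_int (qnorm q) * qcnj q)) = cls x"
proof -
  have "x * q * (of_int (qnorm q) * qcnj q) = (x * q * of_int (qnorm q)) * qcnj q"
    by (simp only: mult.assoc)
  also have "\<dots> = of_int (qnorm q) * (x * (q * qcnj q))"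
    unfolding of_int_quat_commute[of "x * q"] by (simp only: mult.assoc)
  also have "\<dots> = of_int (qnorm q * qnorm q) * x"
    unfolding mult_qcnj of_int_quat_commute[of x] by (simp only: of_int_mult mult.assoc)
  finally have "x * q * (of_int (qnorm q) * qcnj q) - x = of_int (qnorm q * qnorm q - 1) * x"
    by (simp add: algebra_simps)
  moreover have "3 dvd qnorm q * qnorm q - 1"
  proof -
    have "cls3 (qnorm q) \<noteq> T0" using assms cls3_eq_iff[of "qnorm q" 0] by simp
    then have "cls3 (qnorm q * qnorm q) = cls3 1" by (cases "cls3 (qnorm q)") (simp_all add: cls3_square)
    then show ?thesis by (simp only: cls3_eq_iff)
  qed
  then have "c3 (of_int (qnorm q * qnorm q - 1) * x)" by (auto simp: c3_iff simp del: of_int_diff of_int_mult)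
  ultimately show ?thesis by (simp add: cls_eq_iff)
qed

lemma mul4_inv4: "\<not> 3 dvd qnorm q \<Longrightarrow> mul4 (cls (x * q)) (inv4 (cls q)) = cls x"
  by (simp add: inv4_cls cls_hom(3)[symmetric] right_inverse_mod_3)

section \<open>Root classes and lower bounds for norms\<close>

datatype s4 = Sp bool bool bool bool

fun nz :: "tri \<Rightarrow> bool" where
  "nz T0 = False" | "nz T1 = True" | "nz T2 = True"

fun sup4 :: "v4 \<Rightarrow> s4" where
  "sup4 (V a b c d) = Sp (nz a) (nz b) (nz c) (nz d)"

text \<open>Supports of the shortest E8 vectors: an entry 2 or -2 in one coordinate, or entries 1
  and -1 on one of the 14 words of weight 4 of the Hamming code. All signs occur and 2 is nonzero
  modulo 3, so the support decides.\<close>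

fun rt :: "s4 \<Rightarrow> s4 \<Rightarrow> bool" where
  "rt (Sp False False False False) y =
    (y = Sp True False False False \<or> y = Sp False True False False \<or> y = Sp False False True False
      \<or> y = Sp False False False True)"
| "rt (Sp True False False False) y = (y = Sp False True True True \<or> y = Sp False False False False)"
| "rt (Sp False True False False) y = (y = Sp True False True True \<or> y = Sp False False False False)"
| "rt (Sp False False True False) y = (y = Sp True True False True \<or> y = Sp False False False False)"
| "rt (Sp False False False True) y = (y = Sp True True True False \<or> y = Sp False False False False)"
| "rt (Sp True True False False) y = (y = Sp True True False False)"
| "rt (Sp True False True False) y = (y = Sp True False True False)"
| "rt (Sp True False False True) y = (y = Sp True False False True)"
| "rt (Sp False True True False) y = (y = Sp False True True False)"
| "rt (Sp False True False True) y = (y = Sp False True False True)"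
| "rt (Sp False False True True) y = (y = Sp False False True True)"
| "rt (Sp True True True False) y = (y = Sp False False False True)"
| "rt (Sp True True False True) y = (y = Sp False False True False)"
| "rt (Sp True False True True) y = (y = Sp False True False False)"
| "rt (Sp False True True True) y = (y = Sp True False False False)"
| "rt (Sp True True True True) y = False"

text \<open>The classes modulo 3 of the 240 roots of \<open>E\<^sub>8\<close>.\<close>

definition root :: "v4 \<Rightarrow> v4 \<Rightarrow> bool" where
  "root x y = rt (sup4 x) (sup4 y)"

definition sg :: "(tri \<Rightarrow> bool) \<Rightarrow> bool" where
  "sg P \<longleftrightarrow> P T1 \<and> P T2"

text \<open>Quantification over roots as 16 + 14 * 16 = 240 ground instances, grouped by support, so
  that unfolding leaves no bound variable.\<close>

definition allr :: "(v4 \<Rightarrow> v4 \<Rightarrow> bool) \<Rightarrow> bool" where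
  "allr P \<longleftrightarrow> sg (\<lambda>a. P (V a T0 T0 T0) O4 \<and> P (V T0 a T0 T0) O4 \<and> P (V T0 T0 a T0) O4 \<and> P (V T0 T0 T0 a) O4
    \<and> P O4 (V a T0 T0 T0) \<and> P O4 (V T0 a T0 T0) \<and> P O4 (V T0 T0 a T0) \<and> P O4 (V T0 T0 T0 a)
    \<and> sg (\<lambda>b. sg (\<lambda>c. sg (\<lambda>d.
      P (V a T0 T0 T0) (V T0 b c d) \<and> P (V T0 a T0 T0) (V b T0 c d)
      \<and> P (V T0 T0 a T0) (V b c T0 d) \<and> P (V T0 T0 T0 a) (V b c d T0)
      \<and> P (V a b T0 T0) (V c d T0 T0) \<and> P (V a T0 b T0) (V c T0 d T0) \<and> P (V a T0 T0 b) (V c T0 T0 d)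
      \<and> P (V T0 a b T0) (V T0 c d T0) \<and> P (V T0 a T0 b) (V T0 c T0 d) \<and> P (V T0 T0 a b) (V T0 T0 c d)
      \<and> P (V b c d T0) (V T0 T0 T0 a) \<and> P (V b c T0 d) (V T0 T0 a T0)
      \<and> P (V b T0 c d) (V T0 a T0 T0) \<and> P (V T0 b c d) (V a T0 T0 T0)))))"

lemma sgD: "sg P \<Longrightarrow> nz a \<Longrightarrow> P a"
  by (cases a) (simp_all add: sg_def)

lemma nz_iff: "nz a \<longleftrightarrow> a \<noteq> T0"
  by (cases a) simp_all

lemma allrD:
  assumes "allr P" "root x y"
  shows "P x y"
proof -
  obtain a b c d where x: "x = V a b c d" by (cases x)
  obtain e f g h where y: "y = V e f g h" by (cases y)
  note sgD[OF assms(1)[unfolded allr_def]]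
  then have *: "P (V p T0 T0 T0) O4" "P (V T0 p T0 T0) O4" "P (V T0 T0 p T0) O4" "P (V T0 T0 T0 p) O4"
    "P O4 (V p T0 T0 T0)" "P O4 (V T0 p T0 T0)" "P O4 (V T0 T0 p T0)" "P O4 (V T0 T0 T0 p)"
    "nz q \<Longrightarrow> nz r \<Longrightarrow> nz s \<Longrightarrow> P (V p T0 T0 T0) (V T0 q r s)"
    "nz q \<Longrightarrow> nz r \<Longrightarrow> nz s \<Longrightarrow> P (V T0 p T0 T0) (V q T0 r s)"
    "nz q \<Longrightarrow> nz r \<Longrightarrow> nz s \<Longrightarrow> P (V T0 T0 p T0) (V q r T0 s)"
    "nz q \<Longrightarrow> nz r \<Longrightarrow> nz s \<Longrightarrow> P (V T0 T0 T0 p) (V q r s T0)"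
    "nz q \<Longrightarrow> nz r \<Longrightarrow> nz s \<Longrightarrow> P (V p q T0 T0) (V r s T0 T0)"
    "nz q \<Longrightarrow> nz r \<Longrightarrow> nz s \<Longrightarrow> P (V p T0 q T0) (V r T0 s T0)"
    "nz q \<Longrightarrow> nz r \<Longrightarrow> nz s \<Longrightarrow> P (V p T0 T0 q) (V r T0 T0 s)"
    "nz q \<Longrightarrow> nz r \<Longrightarrow> nz s \<Longrightarrow> P (V T0 p q T0) (V T0 r s T0)"
    "nz q \<Longrightarrow> nz r \<Longrightarrow> nz s \<Longrightarrow> P (V T0 p T0 q) (V T0 r T0 s)"
    "nz q \<Longrightarrow> nz r \<Longrightarrow> nz s \<Longrightarrow> P (V T0 T0 p q) (V T0 T0 r s)"
    "nz q \<Longrightarrow> nz r \<Longrightarrow> nz s \<Longrightarrow> P (V q r s T0) (V T0 T0 T0 p)"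
    "nz q \<Longrightarrow> nz r \<Longrightarrow> nz s \<Longrightarrow> P (V q r T0 s) (V T0 T0 p T0)"
    "nz q \<Longrightarrow> nz r \<Longrightarrow> nz s \<Longrightarrow> P (V q T0 r s) (V T0 p T0 T0)"
    "nz q \<Longrightarrow> nz r \<Longrightarrow> nz s \<Longrightarrow> P (V T0 q r s) (V p T0 T0 T0)"
    if "nz p" for p q r s
    using that by (auto dest!: sgD)
  have "rt (Sp (a \<noteq> T0) (b \<noteq> T0) (c \<noteq> T0) (d \<noteq> T0)) (Sp (e \<noteq> T0) (f \<noteq> T0) (g \<noteq> T0) (h \<noteq> T0))"
    using assms(2) by (simp add: x y root_def nz_iff)
  then show ?thesis
    unfolding x y
    by (cases "a = T0"; cases "b = T0"; cases "c = T0"; cases "d = T0";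
        simp only: simp_thms rt.simps s4.inject; elim disjE conjE; simp add: *[unfolded nz_iff])
qed

text \<open>A lower bound for a quarter of the norm of an E8 vector with these classes. Since 4 = 1
  modulo 3, the quarter has the residue of the norm: residue 0 means 0 or at least 3, residue 1
  means 1 for a root and at least 4 otherwise, residue 2 means at least 2.\<close>

definition scr :: "v4 \<Rightarrow> v4 \<Rightarrow> nat" where
  "scr x y = (case add3 (nrm4 x) (nrm4 y) of
      T0 \<Rightarrow> if sup4 x = Sp False False False False \<and> sup4 y = Sp False False False False then 0 else 3
    | T1 \<Rightarrow> if root x y then 1 else 4
    | T2 \<Rightarrow> 2)"

lemma small_square: "(v :: int) * v \<le> 4 \<Longrightarrow> v = -2 \<or> v = -1 \<or> v = 0 \<or> v = 1 \<or> v = 2"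
proof -
  assume "v * v \<le> 4"
  then have "\<bar>v\<bar> \<le> 2" using abs_le_square_iff[of v 2] by (simp add: power2_eq_square)
  then show ?thesis by auto
qed

text \<open>Eight squares adding up to 4 are a single 4 or four ones; in the second case the parity
  conditions put the support into the Hamming code.\<close>

lemma root_cls_if_norm_4:
  assumes "e8 x y" "qnorm x + qnorm y = 4"
  shows "root (cls x) (cls y)"
proof -
  obtain a b c d where x: "x = Quat a b c d" by (cases x)
  obtain e f g h where y: "y = Quat e f g h" by (cases y)
  have sum: "a * a + b * b + c * c + d * d + (e * e + f * f + g * g + h * h) = 4"
    using assms(2) by (simp add: x y qdot_def)
  have nn: "0 \<le> v * v" for v :: int by simp
  note nns = nn[of a] nn[of b] nn[of c] nn[of d] nn[of e] nn[of f] nn[of g] nn[of h]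
  have nz: "nz (cls3 v) \<longleftrightarrow> v \<noteq> 0" if "v * v \<le> 4" for v :: int
    using small_square[OF that] by (auto simp: cls3_def)
  have supp: "nz (cls3 a) \<longleftrightarrow> a \<noteq> 0" "nz (cls3 b) \<longleftrightarrow> b \<noteq> 0" "nz (cls3 c) \<longleftrightarrow> c \<noteq> 0"
    "nz (cls3 d) \<longleftrightarrow> d \<noteq> 0" "nz (cls3 e) \<longleftrightarrow> e \<noteq> 0" "nz (cls3 f) \<longleftrightarrow> f \<noteq> 0"
    "nz (cls3 g) \<longleftrightarrow> g \<noteq> 0" "nz (cls3 h) \<longleftrightarrow> h \<noteq> 0"
    by (rule nz; use sum nns in linarith)+
  have sq: "v = 0 \<or> v * v = 1 \<and> odd v \<or> v * v = 4 \<and> even v" if "v * v \<le> 4" for v :: int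
    using small_square[OF that] by auto
  have cases8: "a = 0 \<or> a * a = 1 \<and> odd a \<or> a * a = 4 \<and> even a" "b = 0 \<or> b * b = 1 \<and> odd b \<or> b * b = 4 \<and> even b"
    "c = 0 \<or> c * c = 1 \<and> odd c \<or> c * c = 4 \<and> even c" "d = 0 \<or> d * d = 1 \<and> odd d \<or> d * d = 4 \<and> even d"
    "e = 0 \<or> e * e = 1 \<and> odd e \<or> e * e = 4 \<and> even e" "f = 0 \<or> f * f = 1 \<and> odd f \<or> f * f = 4 \<and> even f"
    "g = 0 \<or> g * g = 1 \<and> odd g \<or> g * g = 4 \<and> even g" "h = 0 \<or> h * h = 1 \<and> odd h \<or> h * h = 4 \<and> even h"
    by (rule sq; use sum nns in linarith)+
  have par: "even (e + a + (a + b + c + d))" "even (f + b + (a + b + c + d))"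
    "even (g + c + (a + b + c + d))" "even (h + d + (a + b + c + d))"
    using assms(1) by (simp_all add: e8_def x y qsum_def)
  \<comment> \<open>Only the squares 0, 1 and 4 can occur, so each is a function of vanishing and
    parity; this makes the sum linear in known values.\<close>
  define l where "l = (\<lambda>v :: int. if v = 0 then 0 else if odd v then 1 else (4 :: int))"
  have l: "v * v = l v" if "v = 0 \<or> v * v = 1 \<and> odd v \<or> v * v = 4 \<and> even v" for v :: int
    using that by (auto simp: l_def)
  have "l a + l b + l c + l d + (l e + l f + l g + l h) = 4"
    using sum by (simp add: cases8[THEN l])
  note sumL = this
  have l0: "l v = 0 \<longleftrightarrow> v = 0" and ln: "0 \<le> l v" and l3: "l v = 4 \<or> l v = (if odd v then 1 else 0) \<and> (v \<noteq> 0 \<longleftrightarrow> odd v)" for v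
    by (auto simp: l_def)
  note lns = ln[of a] ln[of b] ln[of c] ln[of d] ln[of e] ln[of f] ln[of g] ln[of h]
  show ?thesis
  proof (cases "l a = 4 \<or> l b = 4 \<or> l c = 4 \<or> l d = 4 \<or> l e = 4 \<or> l f = 4 \<or> l g = 4 \<or> l h = 4")
    case True
    then show ?thesis
    proof (elim disjE)
      assume A: "l a = 4"
      have "l b = 0" "l c = 0" "l d = 0" "l e = 0" "l f = 0" "l g = 0" "l h = 0" using A sumL lns by linarith+
      moreover have "a \<noteq> 0" using A l0[of a] by simp
      ultimately show ?thesis
        unfolding x y root_def cls_def quat.sel sup4.simps supp by (simp add: l0)
    next
      assume A: "l b = 4"
      have "l a = 0" "l c = 0" "l d = 0" "l e = 0" "l f = 0" "l g = 0" "l h = 0" using A sumL lns by linarith+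
      moreover have "b \<noteq> 0" using A l0[of b] by simp
      ultimately show ?thesis
        unfolding x y root_def cls_def quat.sel sup4.simps supp by (simp add: l0)
    next
      assume A: "l c = 4"
      have "l a = 0" "l b = 0" "l d = 0" "l e = 0" "l f = 0" "l g = 0" "l h = 0" using A sumL lns by linarith+
      moreover have "c \<noteq> 0" using A l0[of c] by simp
      ultimately show ?thesis
        unfolding x y root_def cls_def quat.sel sup4.simps supp by (simp add: l0)
    next
      assume A: "l d = 4"
      have "l a = 0" "l b = 0" "l c = 0" "l e = 0" "l f = 0" "l g = 0" "l h = 0" using A sumL lns by linarith+
      moreover have "d \<noteq> 0" using A l0[of d] by simp
      ultimately show ?thesis
        unfolding x y root_def cls_def quat.sel sup4.simps supp by (simp add: l0)
    next
      assume A: "l e = 4"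
      have "l a = 0" "l b = 0" "l c = 0" "l d = 0" "l f = 0" "l g = 0" "l h = 0" using A sumL lns by linarith+
      moreover have "e \<noteq> 0" using A l0[of e] by simp
      ultimately show ?thesis
        unfolding x y root_def cls_def quat.sel sup4.simps supp by (simp add: l0)
    next
      assume A: "l f = 4"
      have "l a = 0" "l b = 0" "l c = 0" "l d = 0" "l e = 0" "l g = 0" "l h = 0" using A sumL lns by linarith+
      moreover have "f \<noteq> 0" using A l0[of f] by simp
      ultimately show ?thesis
        unfolding x y root_def cls_def quat.sel sup4.simps supp by (simp add: l0)
    next
      assume A: "l g = 4"
      have "l a = 0" "l b = 0" "l c = 0" "l d = 0" "l e = 0" "l f = 0" "l h = 0" using A sumL lns by linarith+
      moreover have "g \<noteq> 0" using A l0[of g] by simp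
      ultimately show ?thesis
        unfolding x y root_def cls_def quat.sel sup4.simps supp by (simp add: l0)
    next
      assume A: "l h = 4"
      have "l a = 0" "l b = 0" "l c = 0" "l d = 0" "l e = 0" "l f = 0" "l g = 0" using A sumL lns by linarith+
      moreover have "h \<noteq> 0" using A l0[of h] by simp
      ultimately show ?thesis
        unfolding x y root_def cls_def quat.sel sup4.simps supp by (simp add: l0)
    qed
  next
    case False
    then have o: "l v = (if odd v then 1 else 0)" "v \<noteq> 0 \<longleftrightarrow> odd v" if "v \<in> {a, b, c, d, e, f, g, h}" for v
      using l3[of v] that by auto
    have "rt (Sp (odd a) (odd b) (odd c) (odd d)) (Sp (odd e) (odd f) (odd g) (odd h))"
      using par sumL
      by (simp only: o insertI1 insertI2; cases "odd a"; cases "odd b"; cases "odd c"; cases "odd d"; simp)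
    then show ?thesis
      unfolding x y root_def cls_def quat.sel sup4.simps supp by (simp only: o insertI1 insertI2)
  qed
qed

lemma scr_le:
  assumes "e8 x y"
  shows "4 * int (scr (cls x) (cls y)) \<le> qnorm x + qnorm y"
proof -
  define n where "n = qnorm x + qnorm y"
  have "4 dvd n" unfolding n_def by (rule e8_norm[OF assms])
  moreover have "0 \<le> n" by (simp add: n_def)
  ultimately obtain m where m: "n = 4 * m" "0 \<le> m" by (auto elim: dvdE)
  have cls_n: "cls3 m = add3 (nrm4 (cls x)) (nrm4 (cls y))"
  proof -
    have "cls3 m = cls3 n" unfolding cls3_eq_iff m(1) by simp
    then show ?thesis by (simp add: n_def cls3_hom cls3_qnorm)
  qed
  have mod: "m mod 3 = (case cls3 m of T0 \<Rightarrow> 0 | T1 \<Rightarrow> 1 | T2 \<Rightarrow> 2)"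
    using mod_3_cases[of m] by (auto simp: cls3_def)
  have "int (scr (cls x) (cls y)) \<le> m"
  proof (cases "cls3 m")
    case T0
    show ?thesis
    proof (cases "m = 0")
      case True
      then have "qnorm x = 0" "qnorm y = 0" using m qnorm_nonneg[of x] qnorm_nonneg[of y] unfolding n_def by linarith+
      then show ?thesis using True by (simp add: scr_def)
    next
      case False
      then have "3 \<le> m" using mod T0 m(2) by (simp) presburger
      then show ?thesis using T0 by (simp add: scr_def cls_n[symmetric])
    qed
  next
    case T1
    then have "m = 1 \<or> 4 \<le> m" using mod m(2) by simp presburger
    then show ?thesis
    proof
      assume "m = 1"
      then have "root (cls x) (cls y)" using m(1) by (intro root_cls_if_norm_4 assms) (simp add: n_def)
      then show ?thesis using T1 \<open>m = 1\<close> by (simp add: scr_def cls_n[symmetric])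
    qed (use T1 in \<open>simp add: scr_def cls_n[symmetric]\<close>)
  next
    case T2
    then have "2 \<le> m" using mod m(2) by simp presburger
    then show ?thesis using T2 by (simp add: scr_def cls_n[symmetric])
  qed
  then show ?thesis using m(1) by (simp add: n_def)
qed

lemma scr_simps:
  "scr x y = 0 \<longleftrightarrow> x = O4 \<and> y = O4"
  "scr x y = 1 \<Longrightarrow> root x y"
proof -
  obtain a b c d where x: "x = V a b c d" by (cases x)
  obtain e f g h where y: "y = V e f g h" by (cases y)
  show "scr x y = 0 \<longleftrightarrow> x = O4 \<and> y = O4"
    by (auto simp: x y scr_def nz_iff split: tri.splits)
  show "scr x y = 1 \<Longrightarrow> root x y"
    by (auto simp: scr_def split: tri.splits if_splits)
qed

text \<open>Representatives of the roots under left multiplication by \<open>1, i, j, k\<close> and sign changes of the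
  two components.\<close>

definition reps :: "(v4 \<times> v4) list" where
  "reps = [(V T0 T0 T0 T0, V T0 T0 T0 T1),
    (V T0 T0 T0 T1, V T0 T0 T0 T0),
    (V T0 T0 T0 T1, V T1 T1 T1 T0),
    (V T0 T0 T0 T1, V T1 T1 T2 T0),
    (V T0 T0 T0 T1, V T1 T2 T1 T0),
    (V T0 T0 T0 T1, V T1 T2 T2 T0),
    (V T0 T0 T1 T1, V T0 T0 T1 T1),
    (V T0 T0 T1 T1, V T0 T0 T1 T2),
    (V T0 T1 T0 T1, V T0 T1 T0 T1),
    (V T0 T1 T0 T1, V T0 T1 T0 T2),
    (V T0 T1 T1 T0, V T0 T1 T1 T0),
    (V T0 T1 T1 T0, V T0 T1 T2 T0),
    (V T0 T1 T1 T1, V T1 T0 T0 T0),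
    (V T0 T1 T1 T2, V T1 T0 T0 T0),
    (V T0 T1 T2 T1, V T1 T0 T0 T0),
    (V T0 T1 T2 T2, V T1 T0 T0 T0)]"

definition allrep :: "(v4 \<Rightarrow> v4 \<Rightarrow> bool) \<Rightarrow> bool" where
  "allrep P \<longleftrightarrow> list_all (\<lambda>(x, y). P x y) reps"

definition units :: "quat set" where
  "units = {Quat 1 0 0 0, Quat 0 1 0 0, Quat 0 0 1 0, Quat 0 0 0 1}"

lemma allrep_iff: "allrep P \<longleftrightarrow> (\<forall>(x, y) \<in> set reps. P x y)"
  by (simp add: allrep_def list_all_iff)

definition normable :: "v4 \<Rightarrow> v4 \<Rightarrow> bool" where
  "normable x y \<longleftrightarrow> (\<exists>u \<in> {V T1 T0 T0 T0, V T0 T1 T0 T0, V T0 T0 T1 T0, V T0 T0 T0 T1}.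
     \<exists>f \<in> {id, neg4}. \<exists>g \<in> {id, neg4}. (f (mul4 u x), g (mul4 u y)) \<in> set reps)"

lemma allr_normable: "allr normable"
  by (simp add: allr_def sg_def normable_def reps_def)

text \<open>Cuts the first root of a check from 240 candidates to 16. The signs are independent
  because the two components of a half are mapped by separate matrices and the parity conditions
  ignore signs.\<close>

lemma exists_normalising_unit:
  assumes "root (cls x) (cls y)"
  obtains u s t where "u \<in> units" "s \<in> {1, -1}" "t \<in> {1, -1 :: int}"
    "(cls (of_int s * (u * x)), cls (of_int t * (u * y))) \<in> set reps"
proof -
  have "normable (cls x) (cls y)" by (rule allrD[OF allr_normable assms])
  then obtain u f g where ufg: "u \<in> {V T1 T0 T0 T0, V T0 T1 T0 T0, V T0 T0 T1 T0, V T0 T0 T0 T1}"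
    "f \<in> {id, neg4}" "g \<in> {id, neg4}" "(f (mul4 u (cls x)), g (mul4 u (cls y))) \<in> set reps"
    unfolding normable_def by blast
  have "\<forall>u \<in> {V T1 T0 T0 T0, V T0 T1 T0 T0, V T0 T0 T1 T0, V T0 T0 T0 T1}. \<exists>w \<in> units. cls w = u"
    by (simp add: units_def cls_def)
  with ufg(1) obtain w where w: "w \<in> units" "cls w = u" by blast
  have sign: "\<exists>s \<in> {1, -1 :: int}. \<forall>q. cls (of_int s * q) = f (cls q)" if "f \<in> {id, neg4}" for f
  proof -
    from that have "f = id \<or> f = neg4" by simp
    then show ?thesis
    proof
      assume "f = id" then show ?thesis by (intro bexI[of _ 1]) simp_all
    next
      assume "f = neg4" then show ?thesis by (intro bexI[of _ "-1"]) (simp_all add: cls_hom(2))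
    qed
  qed
  from sign[OF ufg(2)] sign[OF ufg(3)] obtain s t where st: "s \<in> {1, -1 :: int}" "t \<in> {1, -1 :: int}"
    "\<And>q. cls (of_int s * q) = f (cls q)" "\<And>q. cls (of_int t * q) = g (cls q)" by blast
  show thesis
    by (rule that[OF w(1) st(1,2)]) (use ufg(4) in \<open>unfold st(3,4), unfold cls_hom(3) w(2)\<close>)
qed

section \<open>The finite checks\<close>

definition score1 where
  "score1 a b i ex ey = scr (mul4 ex (a i 0)) (mul4 ey (b i 0)) + scr (mul4 ex (a i 1)) (mul4 ey (b i 1))
    + scr (mul4 ex (a i 2)) (mul4 ey (b i 2)) + scr (mul4 ex (a i 3)) (mul4 ey (b i (3 :: nat)))"

definition comb2 where
  "comb2 a i k j ex fx = add4 (mul4 ex (a i j)) (mul4 fx (a k j))"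

definition score2 where
  "score2 a b i k ex ey fx fy =
    scr (comb2 a i k 0 ex fx) (comb2 b i k 0 ey fy) + scr (comb2 a i k 1 ex fx) (comb2 b i k 1 ey fy)
    + scr (comb2 a i k 2 ex fx) (comb2 b i k 2 ey fy) + scr (comb2 a i k 3 ex fx) (comb2 b i k (3 :: nat) ey fy)"

definition comb3 where
  "comb3 a i k l j ex fx gx = add4 (add4 (mul4 ex (a i j)) (mul4 fx (a k j))) (mul4 gx (a l j))"

definition score3 where
  "score3 a b i k l ex ey fx fy gx gy =
    scr (comb3 a i k l 0 ex fx gx) (comb3 b i k l 0 ey fy gy) + scr (comb3 a i k l 1 ex fx gx) (comb3 b i k l 1 ey fy gy)
    + scr (comb3 a i k l 2 ex fx gx) (comb3 b i k l 2 ey fy gy)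
    + scr (comb3 a i k l 3 ex fx gx) (comb3 b i k l (3 :: nat) ey fy gy)"

text \<open>Let the image of a half vector supported on block \<open>i\<close>, or on blocks \<open>i, k\<close>, or on
  \<open>i, k, l\<close>, be prescribed modulo 3 at position \<open>j\<close>: to a root class in \<open>chkA\<close>, to zero in
  \<open>chkB\<close> and \<open>chkD\<close>. Since the matrix entries are invertible modulo 3, the class at the last block is
  determined by the others, and the scores, which bound the norms divided by 4 from below, add up to
  too large a value. In \<open>chkC\<close> all four image classes would have to be roots.\<close>

definition chkA where
  "chkA a b i j \<longleftrightarrow> allrep (\<lambda>fx fy.
     9 \<le> scr (mul4 fx (inv4 (a i j))) (mul4 fy (inv4 (b i j)))
       + score1 a b i (mul4 fx (inv4 (a i j))) (mul4 fy (inv4 (b i j))))"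

definition solve2 where
  "solve2 a i k j ex = neg4 (mul4 ex (mul4 (a i j) (inv4 (a k j))))"

definition chkB where
  "chkB a b i k j \<longleftrightarrow> allrep (\<lambda>ex ey.
     9 \<le> scr ex ey + scr (solve2 a i k j ex) (solve2 b i k j ey)
       + score2 a b i k ex ey (solve2 a i k j ex) (solve2 b i k j ey))"

definition chkC where
  "chkC a b i k \<longleftrightarrow> allrep (\<lambda>ex ey. allr (\<lambda>fx fy.
     if root (comb2 a i k 0 ex fx) (comb2 b i k 0 ey fy) then
     if root (comb2 a i k 1 ex fx) (comb2 b i k 1 ey fy) then
     if root (comb2 a i k 2 ex fx) (comb2 b i k 2 ey fy) then
       \<not> root (comb2 a i k 3 ex fx) (comb2 b i k (3 :: nat) ey fy)
     else True else True else True))"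

definition solve3 where
  "solve3 a i k l j ex fx =
     neg4 (add4 (mul4 ex (mul4 (a i j) (inv4 (a l j)))) (mul4 fx (mul4 (a k j) (inv4 (a l j)))))"

definition chkD where
  "chkD a b i k l j \<longleftrightarrow> allrep (\<lambda>ex ey. allr (\<lambda>fx fy.
     if root (solve3 a i k l j ex fx) (solve3 b i k l j ey fy) then
       6 \<le> score3 a b i k l ex ey fx fy (solve3 a i k l j ex fx) (solve3 b i k l j ey fy)
     else True))"

text \<open>Column j produces \<open>z 3 (rho j)\<close>, the partner of \<open>z 1 j\<close>, so
  \<open>Qm\<close> and \<open>Bm\<close> together carry blocks of one half to blocks of the
  other.\<close>

definition Bm :: "nat \<Rightarrow> nat \<Rightarrow> quat" where
  "Bm i j = Qm i (rho j)"

text \<open>\<open>qa\<close> and \<open>qb\<close> belong to the passage from (\<open>z 0\<close>,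
  \<open>z 2\<close>) to the other half, \<open>qc\<close> and \<open>qd\<close> to the way back by
  the adjoint matrices.\<close>

definition qa :: "nat \<Rightarrow> nat \<Rightarrow> v4" where "qa i j = cls (Qm i j)"

lemma qa_simps:
  "qa 0 0 = V T1 T2 T2 T1"
  "qa 0 1 = V T2 T0 T0 T0"
  "qa 0 2 = V T2 T0 T1 T0"
  "qa 0 3 = V T1 T0 T0 T0"
  "qa 1 0 = V T1 T0 T0 T0"
  "qa 1 1 = V T1 T1 T2 T2"
  "qa 1 2 = V T1 T0 T0 T0"
  "qa 1 3 = V T1 T0 T2 T0"
  "qa 2 0 = V T1 T0 T0 T0"
  "qa 2 1 = V T0 T1 T1 T0"
  "qa 2 2 = V T1 T1 T2 T1"
  "qa 2 3 = V T1 T0 T0 T0"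
  "qa 3 0 = V T0 T1 T2 T0"
  "qa 3 1 = V T1 T0 T0 T0"
  "qa 3 2 = V T1 T0 T0 T0"
  "qa 3 3 = V T2 T1 T1 T1"
  by (simp_all add: qa_def Qm_def adjm_def cls_def cls3_def rho_def Bm_def)

definition qb :: "nat \<Rightarrow> nat \<Rightarrow> v4" where "qb i j = cls (Bm i j)"

lemma qb_simps:
  "qb 0 0 = V T2 T0 T1 T0"
  "qb 0 1 = V T1 T0 T0 T0"
  "qb 0 2 = V T2 T0 T0 T0"
  "qb 0 3 = V T1 T2 T2 T1"
  "qb 1 0 = V T1 T0 T0 T0"
  "qb 1 1 = V T1 T0 T2 T0"
  "qb 1 2 = V T1 T1 T2 T2"
  "qb 1 3 = V T1 T0 T0 T0"
  "qb 2 0 = V T1 T1 T2 T1"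
  "qb 2 1 = V T1 T0 T0 T0"
  "qb 2 2 = V T0 T1 T1 T0"
  "qb 2 3 = V T1 T0 T0 T0"
  "qb 3 0 = V T1 T0 T0 T0"
  "qb 3 1 = V T2 T1 T1 T1"
  "qb 3 2 = V T1 T0 T0 T0"
  "qb 3 3 = V T0 T1 T2 T0"
  by (simp_all add: qb_def Qm_def adjm_def cls_def cls3_def rho_def Bm_def)

definition qc :: "nat \<Rightarrow> nat \<Rightarrow> v4" where "qc i j = cls (adjm Qm i j)"

lemma qc_simps:
  "qc 0 0 = V T1 T1 T1 T2"
  "qc 0 1 = V T1 T0 T0 T0"
  "qc 0 2 = V T1 T0 T0 T0"
  "qc 0 3 = V T0 T2 T1 T0"
  "qc 1 0 = V T2 T0 T0 T0"
  "qc 1 1 = V T1 T2 T1 T1"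
  "qc 1 2 = V T0 T2 T2 T0"
  "qc 1 3 = V T1 T0 T0 T0"
  "qc 2 0 = V T2 T0 T2 T0"
  "qc 2 1 = V T1 T0 T0 T0"
  "qc 2 2 = V T1 T2 T1 T2"
  "qc 2 3 = V T1 T0 T0 T0"
  "qc 3 0 = V T1 T0 T0 T0"
  "qc 3 1 = V T1 T0 T1 T0"
  "qc 3 2 = V T1 T0 T0 T0"
  "qc 3 3 = V T2 T2 T2 T2"
  by (simp_all add: qc_def Qm_def adjm_def cls_def cls3_def rho_def Bm_def)

definition qd :: "nat \<Rightarrow> nat \<Rightarrow> v4" where "qd i j = cls (adjm Bm i j)"

lemma qd_simps:
  "qd 0 0 = V T2 T0 T2 T0"
  "qd 0 1 = V T1 T0 T0 T0"
  "qd 0 2 = V T1 T2 T1 T2"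
  "qd 0 3 = V T1 T0 T0 T0"
  "qd 1 0 = V T1 T0 T0 T0"
  "qd 1 1 = V T1 T0 T1 T0"
  "qd 1 2 = V T1 T0 T0 T0"
  "qd 1 3 = V T2 T2 T2 T2"
  "qd 2 0 = V T2 T0 T0 T0"
  "qd 2 1 = V T1 T2 T1 T1"
  "qd 2 2 = V T0 T2 T2 T0"
  "qd 2 3 = V T1 T0 T0 T0"
  "qd 3 0 = V T1 T1 T1 T2"
  "qd 3 1 = V T1 T0 T0 T0"
  "qd 3 2 = V T1 T0 T0 T0"
  "qd 3 3 = V T0 T2 T1 T0"
  by (simp_all add: qd_def Qm_def adjm_def cls_def cls3_def rho_def Bm_def)

lemmas tri_eval = add3.simps neg3.simps mul3.simps add4.simps neg4.simps mul4.simps sq3.simps nrm4.simps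
  inv4.simps Let_def nz.simps sup4.simps rt.simps root_def s4.inject simp_thms if_True if_False if_P if_not_P
  tri.case scr_def list.pred_inject case_prod_conv reps_def allrep_def allr_def sg_def
  score1_def score2_def score3_def comb2_def comb3_def solve2_def solve3_def
  qa_simps qb_simps qc_simps qd_simps

lemma chkA_qab: "\<forall>i\<in>{0, 1, 2, 3}. \<forall>j\<in>{0, 1, 2, 3}. chkA qa qb i j"
  \<comment> \<open>The weak congruence rule leaves the branches of a conditional alone until its
    condition is decided, which prunes the search.\<close>
  by (simp only: Set.ball_simps, simp only: chkA_def tri_eval cong: if_weak_cong, simp?)

lemma chkB_qab_0: "\<forall>k\<in>{1, 2, 3}. \<forall>j\<in>{0, 1, 2, 3}. chkB qa qb 0 k j"
  by (simp only: Set.ball_simps, simp only: chkB_def tri_eval cong: if_weak_cong, simp?)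

lemma chkB_qab_1: "\<forall>k\<in>{0, 2, 3}. \<forall>j\<in>{0, 1, 2, 3}. chkB qa qb 1 k j"
  by (simp only: Set.ball_simps, simp only: chkB_def tri_eval cong: if_weak_cong, simp?)

lemma chkB_qab_2: "\<forall>k\<in>{0, 1, 3}. \<forall>j\<in>{0, 1, 2, 3}. chkB qa qb 2 k j"
  by (simp only: Set.ball_simps, simp only: chkB_def tri_eval cong: if_weak_cong, simp?)

lemma chkB_qab_3: "\<forall>k\<in>{0, 1, 2}. \<forall>j\<in>{0, 1, 2, 3}. chkB qa qb 3 k j"
  by (simp only: Set.ball_simps, simp only: chkB_def tri_eval cong: if_weak_cong, simp?)

lemma chkC_qab_01: "chkC qa qb 0 1"
  by (simp only: chkC_def tri_eval cong: if_weak_cong, simp?)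

lemma chkC_qab_02: "chkC qa qb 0 2"
  by (simp only: chkC_def tri_eval cong: if_weak_cong, simp?)

lemma chkC_qab_03: "chkC qa qb 0 3"
  by (simp only: chkC_def tri_eval cong: if_weak_cong, simp?)

lemma chkC_qab_12: "chkC qa qb 1 2"
  by (simp only: chkC_def tri_eval cong: if_weak_cong, simp?)

lemma chkC_qab_13: "chkC qa qb 1 3"
  by (simp only: chkC_def tri_eval cong: if_weak_cong, simp?)

lemma chkC_qab_23: "chkC qa qb 2 3"
  by (simp only: chkC_def tri_eval cong: if_weak_cong, simp?)

lemma chkD_qab_012: "\<forall>j\<in>{0, 1, 2, 3}. chkD qa qb 0 1 2 j"
  by (simp only: Set.ball_simps, simp only: chkD_def tri_eval cong: if_weak_cong, simp?)

lemma chkD_qab_013: "\<forall>j\<in>{0, 1, 2, 3}. chkD qa qb 0 1 3 j"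
  by (simp only: Set.ball_simps, simp only: chkD_def tri_eval cong: if_weak_cong, simp?)

lemma chkD_qab_023: "\<forall>j\<in>{0, 1, 2, 3}. chkD qa qb 0 2 3 j"
  by (simp only: Set.ball_simps, simp only: chkD_def tri_eval cong: if_weak_cong, simp?)

lemma chkD_qab_123: "\<forall>j\<in>{0, 1, 2, 3}. chkD qa qb 1 2 3 j"
  by (simp only: Set.ball_simps, simp only: chkD_def tri_eval cong: if_weak_cong, simp?)

lemma chkA_qcd: "\<forall>i\<in>{0, 1, 2, 3}. \<forall>j\<in>{0, 1, 2, 3}. chkA qc qd i j"
  by (simp only: Set.ball_simps, simp only: chkA_def tri_eval cong: if_weak_cong, simp?)

lemma chkB_qcd_0: "\<forall>k\<in>{1, 2, 3}. \<forall>j\<in>{0, 1, 2, 3}. chkB qc qd 0 k j"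
  by (simp only: Set.ball_simps, simp only: chkB_def tri_eval cong: if_weak_cong, simp?)

lemma chkB_qcd_1: "\<forall>k\<in>{0, 2, 3}. \<forall>j\<in>{0, 1, 2, 3}. chkB qc qd 1 k j"
  by (simp only: Set.ball_simps, simp only: chkB_def tri_eval cong: if_weak_cong, simp?)

lemma chkB_qcd_2: "\<forall>k\<in>{0, 1, 3}. \<forall>j\<in>{0, 1, 2, 3}. chkB qc qd 2 k j"
  by (simp only: Set.ball_simps, simp only: chkB_def tri_eval cong: if_weak_cong, simp?)

lemma chkB_qcd_3: "\<forall>k\<in>{0, 1, 2}. \<forall>j\<in>{0, 1, 2, 3}. chkB qc qd 3 k j"
  by (simp only: Set.ball_simps, simp only: chkB_def tri_eval cong: if_weak_cong, simp?)

lemma chkC_qcd_01: "chkC qc qd 0 1"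
  by (simp only: chkC_def tri_eval cong: if_weak_cong, simp?)

lemma chkC_qcd_02: "chkC qc qd 0 2"
  by (simp only: chkC_def tri_eval cong: if_weak_cong, simp?)

lemma chkC_qcd_03: "chkC qc qd 0 3"
  by (simp only: chkC_def tri_eval cong: if_weak_cong, simp?)

lemma chkC_qcd_12: "chkC qc qd 1 2"
  by (simp only: chkC_def tri_eval cong: if_weak_cong, simp?)

lemma chkC_qcd_13: "chkC qc qd 1 3"
  by (simp only: chkC_def tri_eval cong: if_weak_cong, simp?)

lemma chkC_qcd_23: "chkC qc qd 2 3"
  by (simp only: chkC_def tri_eval cong: if_weak_cong, simp?)

lemma chkD_qcd_012: "\<forall>j\<in>{0, 1, 2, 3}. chkD qc qd 0 1 2 j"
  by (simp only: Set.ball_simps, simp only: chkD_def tri_eval cong: if_weak_cong, simp?)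

lemma chkD_qcd_013: "\<forall>j\<in>{0, 1, 2, 3}. chkD qc qd 0 1 3 j"
  by (simp only: Set.ball_simps, simp only: chkD_def tri_eval cong: if_weak_cong, simp?)

lemma chkD_qcd_023: "\<forall>j\<in>{0, 1, 2, 3}. chkD qc qd 0 2 3 j"
  by (simp only: Set.ball_simps, simp only: chkD_def tri_eval cong: if_weak_cong, simp?)

lemma chkD_qcd_123: "\<forall>j\<in>{0, 1, 2, 3}. chkD qc qd 1 2 3 j"
  by (simp only: Set.ball_simps, simp only: chkD_def tri_eval cong: if_weak_cong, simp?)

lemma less_4_iff: "i < 4 \<longleftrightarrow> i \<in> {0, 1, 2, 3 :: nat}"
  by auto

lemma less_less_4:
  "i < k \<Longrightarrow> k < 4 \<Longrightarrow> (i, k) \<in> {(0, 1), (0, 2), (0, 3), (1, 2), (1, 3), (2, 3 :: nat)}"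
  "i < k \<Longrightarrow> k < l \<Longrightarrow> l < 4 \<Longrightarrow> (i, k, l) \<in> {(0, 1, 2), (0, 1, 3), (0, 2, 3), (1, 2, 3 :: nat)}"
  by auto

lemma chk_qab:
  "i < 4 \<Longrightarrow> j < 4 \<Longrightarrow> chkA qa qb i j"
  "i < 4 \<Longrightarrow> k < 4 \<Longrightarrow> i \<noteq> k \<Longrightarrow> j < 4 \<Longrightarrow> chkB qa qb i k j"
  "i < k \<Longrightarrow> k < 4 \<Longrightarrow> chkC qa qb i k"
  "i < k \<Longrightarrow> k < l \<Longrightarrow> l < 4 \<Longrightarrow> j < 4 \<Longrightarrow> chkD qa qb i k l j"
proof -
  show "i < 4 \<Longrightarrow> j < 4 \<Longrightarrow> chkA qa qb i j"
    using chkA_qab unfolding less_4_iff by blast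
  show "i < 4 \<Longrightarrow> k < 4 \<Longrightarrow> i \<noteq> k \<Longrightarrow> j < 4 \<Longrightarrow> chkB qa qb i k j"
    using chkB_qab_0 chkB_qab_1 chkB_qab_2 chkB_qab_3 unfolding less_4_iff by blast
  show "i < k \<Longrightarrow> k < 4 \<Longrightarrow> chkC qa qb i k"
    using chkC_qab_01 chkC_qab_02 chkC_qab_03 chkC_qab_12 chkC_qab_13 chkC_qab_23 less_less_4(1) by blast
  show "i < k \<Longrightarrow> k < l \<Longrightarrow> l < 4 \<Longrightarrow> j < 4 \<Longrightarrow> chkD qa qb i k l j"
    using chkD_qab_012 chkD_qab_013 chkD_qab_023 chkD_qab_123 less_less_4(2) unfolding less_4_iff[of j] by blast
qed

lemma chk_qcd:
  "i < 4 \<Longrightarrow> j < 4 \<Longrightarrow> chkA qc qd i j"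
  "i < 4 \<Longrightarrow> k < 4 \<Longrightarrow> i \<noteq> k \<Longrightarrow> j < 4 \<Longrightarrow> chkB qc qd i k j"
  "i < k \<Longrightarrow> k < 4 \<Longrightarrow> chkC qc qd i k"
  "i < k \<Longrightarrow> k < l \<Longrightarrow> l < 4 \<Longrightarrow> j < 4 \<Longrightarrow> chkD qc qd i k l j"
proof -
  show "i < 4 \<Longrightarrow> j < 4 \<Longrightarrow> chkA qc qd i j"
    using chkA_qcd unfolding less_4_iff by blast
  show "i < 4 \<Longrightarrow> k < 4 \<Longrightarrow> i \<noteq> k \<Longrightarrow> j < 4 \<Longrightarrow> chkB qc qd i k j"
    using chkB_qcd_0 chkB_qcd_1 chkB_qcd_2 chkB_qcd_3 unfolding less_4_iff by blast
  show "i < k \<Longrightarrow> k < 4 \<Longrightarrow> chkC qc qd i k"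
    using chkC_qcd_01 chkC_qcd_02 chkC_qcd_03 chkC_qcd_12 chkC_qcd_13 chkC_qcd_23 less_less_4(1) by blast
  show "i < k \<Longrightarrow> k < l \<Longrightarrow> l < 4 \<Longrightarrow> j < 4 \<Longrightarrow> chkD qc qd i k l j"
    using chkD_qcd_012 chkD_qcd_013 chkD_qcd_023 chkD_qcd_123 less_less_4(2) unfolding less_4_iff[of j] by blast
qed

text \<open>In \<open>hyp\<close> the pair \<open>(x, y)\<close> is the half of smaller norm of a lattice vector of norm at most 24
  and \<open>(x', y')\<close> is the other half.\<close>

definition hyp :: "(nat \<Rightarrow> nat \<Rightarrow> quat) \<Rightarrow> (nat \<Rightarrow> nat \<Rightarrow> quat) \<Rightarrow> (nat \<Rightarrow> quat) \<Rightarrow> (nat \<Rightarrow> quat)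
    \<Rightarrow> (nat \<Rightarrow> quat) \<Rightarrow> (nat \<Rightarrow> quat) \<Rightarrow> bool" where
  "hyp A B x y x' y' \<longleftrightarrow>
    (\<forall>j<4. c3 (x' j - rmul A x j) \<and> c3 (y' j - rmul B y j) \<and> e8 (x j) (y j) \<and> e8 (x' j) (y' j))
    \<and> ip x x + ip y y \<le> 12 \<and> ip x x + ip y y + (ip x' x' + ip y' y') \<le> 24"

section \<open>Excluding halves with one, two or three nonzero blocks\<close>

definition act :: "int \<Rightarrow> quat \<Rightarrow> (nat \<Rightarrow> quat) \<Rightarrow> nat \<Rightarrow> quat" where
  "act s u x = (\<lambda>i. of_int s * (u * x i))"

text \<open>Left multiplication by i, j or k permutes the coordinates up to sign, in the same way in
  both components, and the parity conditions are symmetric in the coordinates.\<close>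

lemma e8_act:
  assumes "e8 x y" "u \<in> units" "s \<in> {1, -1}" "t \<in> {1, -1 :: int}"
  shows "e8 (of_int s * (u * x)) (of_int t * (u * y))"
proof -
  have "u = Quat 1 0 0 0 \<or> u = Quat 0 1 0 0 \<or> u = Quat 0 0 1 0 \<or> u = Quat 0 0 0 1"
    using assms(2) by (simp add: units_def)
  then have ux: "e8 (u * x) (u * y)" using assms(1)
    by (elim disjE; simp add: e8_def qsum_def; argo?)
  have "s = 1 \<or> s = - 1" "t = 1 \<or> t = - 1" using assms(3,4) by auto
  then have "e8 (of_int s * p) (of_int t * q)" if "e8 p q" for p q
    using that by (elim disjE; simp add: e8_def qsum_def; argo?)
  then show ?thesis using ux by blast
qed

lemma qnorm_act:
  assumes "u \<in> units" "s \<in> {1, -1}"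
  shows "qnorm (of_int s * (u * x)) = qnorm x"
proof -
  have "qnorm u = 1" using assms(1) by (auto simp: units_def qdot_def)
  then show ?thesis using assms(2) by (auto simp: qnorm_mult simp del: quat_mult_sel)
qed

lemma hyp_act:
  assumes h: "hyp A B x y x' y'" and u: "u \<in> units" and s: "s \<in> {1, -1}" and t: "t \<in> {1, -1 :: int}"
  shows "hyp A B (act s u x) (act t u y) (act s u x') (act t u y')"
proof -
  have ip: "ip (act r u p) (act r u p) = ip p p" if "r \<in> {1, -1}" for r p
    unfolding ip_def act_def by (simp only: qnorm_act[OF u that])
  have eq: "act r u p j - rmul M (act r u q) j = of_int r * (u * (p j - rmul M q j))" for r p M q j
    by (simp add: act_def rmul_lin right_diff_distrib del: quat_mult_sel)
  show ?thesis
    using h e8_act[OF _ u s t] unfolding hyp_def ip[OF s] ip[OF t] eq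
    by (auto simp: c3_closed act_def)
qed

lemma mul4_O4 [simp]: "mul4 O4 q = O4"
  by (cases q) simp

lemma cls_solve:
  assumes "c3 (P + p * q)" "\<not> 3 dvd qnorm q"
  shows "cls p = neg4 (mul4 (cls P) (inv4 (cls q)))"
proof -
  have "c3 (p * q - (- P))" using assms(1) by (simp add: add.commute)
  then have "cls (p * q) = cls (- P)" by (simp only: cls_eq_iff)
  moreover have "cls p = mul4 (cls (p * q)) (inv4 (cls q))" by (rule mul4_inv4[OF assms(2), symmetric])
  moreover have "mul4 (cls (- P)) (inv4 (cls q)) = neg4 (mul4 (cls P) (inv4 (cls q)))"
    unfolding inv4_cls by (simp only: cls_hom(3)[symmetric] cls_hom(2)[symmetric] mult_minus_left)
  ultimately show ?thesis by simp
qed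

text \<open>Either half of a vector may be the smaller one, so the argument is run for Q and for its
  adjoint; the locale holds what the two runs share.\<close>

locale half =
  fixes A B :: "nat \<Rightarrow> nat \<Rightarrow> quat" and a b :: "nat \<Rightarrow> nat \<Rightarrow> v4"
  assumes a: "\<And>i j. a i j = cls (A i j)" and b: "\<And>i j. b i j = cls (B i j)"
    and invA: "\<And>i j. i < 4 \<Longrightarrow> j < 4 \<Longrightarrow> \<not> 3 dvd qnorm (A i j)"
    and invB: "\<And>i j. i < 4 \<Longrightarrow> j < 4 \<Longrightarrow> \<not> 3 dvd qnorm (B i j)"
    and A: "\<And>i j. i < 4 \<Longrightarrow> j < 4 \<Longrightarrow> chkA a b i j"
    and B: "\<And>i j k. i < 4 \<Longrightarrow> k < 4 \<Longrightarrow> i \<noteq> k \<Longrightarrow> j < 4 \<Longrightarrow> chkB a b i k j"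
    and C: "\<And>i k. i < k \<Longrightarrow> k < 4 \<Longrightarrow> chkC a b i k"
    and D: "\<And>i k l j. i < k \<Longrightarrow> k < l \<Longrightarrow> l < 4 \<Longrightarrow> j < 4 \<Longrightarrow> chkD a b i k l j"
begin

definition sc :: "(nat \<Rightarrow> quat) \<Rightarrow> (nat \<Rightarrow> quat) \<Rightarrow> nat \<Rightarrow> nat" where
  "sc x y i = scr (cls (x i)) (cls (y i))"

lemma ip_add: "ip x x + ip y y = (\<Sum>i<4. qnorm (x i) + qnorm (y i))"
  by (simp add: ip_def sum.distrib)

lemma sc_le_ip:
  assumes "\<And>i. i < 4 \<Longrightarrow> e8 (x i) (y i)"
  shows "4 * int (\<Sum>i<4. sc x y i) \<le> ip x x + ip y y"
  unfolding ip_add of_nat_sum sum_distrib_left sc_def by (intro sum_mono scr_le assms) simp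

lemma sc_bound:
  assumes "hyp A B x y x' y'"
  shows "(\<Sum>i<4. sc x y i) + (\<Sum>j<4. sc x' y' j) \<le> 6"
    "4 * int (\<Sum>j<4. sc x' y' j) \<le> 24 - (ip x x + ip y y)"
proof -
  have "4 * int (\<Sum>i<4. sc x y i) \<le> ip x x + ip y y" "4 * int (\<Sum>i<4. sc x' y' i) \<le> ip x' x' + ip y' y'"
    by (rule sc_le_ip; use assms in \<open>simp add: hyp_def\<close>)+
  moreover have "ip x x + ip y y + (ip x' x' + ip y' y') \<le> 24" using assms by (simp add: hyp_def)
  ultimately show "(\<Sum>i<4. sc x y i) + (\<Sum>j<4. sc x' y' j) \<le> 6"
    "4 * int (\<Sum>j<4. sc x' y' j) \<le> 24 - (ip x x + ip y y)" by linarith+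
qed

lemma rmul_support:
  assumes "S \<subseteq> {..<4}" "\<And>m. m < 4 \<Longrightarrow> m \<notin> S \<Longrightarrow> x m = 0"
  shows "rmul M x j = (\<Sum>i\<in>S. x i * M i j)"
  unfolding rmul_def by (rule sum.mono_neutral_right) (use assms in auto)

lemma image:
  assumes "hyp A B x y x' y'" "S \<subseteq> {..<4}" "\<And>m. m < 4 \<Longrightarrow> m \<notin> S \<Longrightarrow> x m = 0 \<and> y m = 0" "j < 4"
  shows "cls (x' j) = cls (\<Sum>i\<in>S. x i * A i j)" "cls (y' j) = cls (\<Sum>i\<in>S. y i * B i j)"
proof -
  have "rmul A x j = (\<Sum>i\<in>S. x i * A i j)" "rmul B y j = (\<Sum>i\<in>S. y i * B i j)"
    by (rule rmul_support[OF assms(2)]; use assms(3) in blast)+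
  moreover have "c3 (x' j - rmul A x j)" "c3 (y' j - rmul B y j)"
    using assms(1,4) by (simp_all add: hyp_def)
  ultimately show "cls (x' j) = cls (\<Sum>i\<in>S. x i * A i j)" "cls (y' j) = cls (\<Sum>i\<in>S. y i * B i j)"
    by (simp_all only: cls_eq_iff)
qed

lemma act_zero: "x m = 0 \<Longrightarrow> act s u x m = 0"
  by (simp add: act_def)

text \<open>The block is nonzero modulo 3, since nonzero vectors of 3 E8 have norm at least 36.
  Invertible entries make all four image blocks nonzero, and four scores of at least 2 would exceed
  6, so some image block is a root. Normalising that root and solving backwards leaves the cases of
  \<open>chkA\<close>.\<close>

lemma no_single:
  assumes h: "hyp A B x y x' y'" and i: "i < 4" "x i \<noteq> 0 \<or> y i \<noteq> 0"
    and zero: "\<And>m. m < 4 \<Longrightarrow> m \<notin> {i} \<Longrightarrow> x m = 0 \<and> y m = 0"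
  shows False
proof -
  have img: "cls (x' j) = cls (x i * A i j)" "cls (y' j) = cls (y i * B i j)" if "j < 4" for j
    using image[where S = "{i}", OF h _ zero that] i(1) by simp_all
  have "\<not> (c3 (x i) \<and> c3 (y i))"
  proof
    assume "c3 (x i) \<and> c3 (y i)"
    then obtain p q where pq: "x i = 3 * p" "y i = 3 * q" by (auto simp: c3_def)
    have "e8 (x i) (y i)" using h i(1) by (simp add: hyp_def)
    then have "4 dvd qnorm p + qnorm q" using e8_norm[of p q] by (simp add: pq e8_closed)
    then obtain m where m: "qnorm p + qnorm q = 4 * m" by blast
    have "qnorm (x i) + qnorm (y i) \<le> ip x x + ip y y"
      unfolding ip_add by (rule member_le_sum) (use i in auto)
    also have "\<dots> \<le> 12" using h by (simp add: hyp_def)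
    finally have "9 * (4 * m) \<le> 12" using m by (simp add: pq)
    then have "m \<le> 0" by simp
    then have "qnorm p + qnorm q \<le> 0" using m by simp
    then have "qnorm p = 0 \<and> qnorm q = 0" using qnorm_nonneg[of p] qnorm_nonneg[of q] by linarith
    then show False using i(2) pq by simp
  qed
  then have "\<not> (cls (x i) = O4 \<and> cls (y i) = O4)" by (simp add: cls_eq_O4)
  have pos: "sc x' y' j \<noteq> 0" if "j < 4" for j
  proof
    assume "sc x' y' j = 0"
    then have e: "cls (x i * A i j) = O4" "cls (y i * B i j) = O4"
      using img[OF that] by (simp_all add: sc_def scr_simps)
    have "cls (x i) = O4"
      using mul4_inv4[OF invA[OF i(1) that], of "x i"] by (metis e mul4_O4)
    moreover have "cls (y i) = O4"
      using mul4_inv4[OF invB[OF i(1) that], of "y i"] by (metis e mul4_O4)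
    ultimately have "cls (x i) = O4 \<and> cls (y i) = O4" by (rule conjI)
    then show False using \<open>\<not> (cls (x i) = O4 \<and> cls (y i) = O4)\<close> by blast
  qed
  have "\<exists>j<4. sc x' y' j = 1"
  proof (rule ccontr)
    assume "\<not> (\<exists>j<4. sc x' y' j = 1)"
    then have "2 \<le> sc x' y' j" if "j < 4" for j
      using pos[OF that] that by (metis One_nat_def Suc_1 Suc_leI le_neq_implies_less less_one not_less)
    then have "(\<Sum>j<4::nat. 2) \<le> (\<Sum>j<4. sc x' y' j)" by (intro sum_mono) simp
    then show False using sc_bound(1)[OF h] by simp
  qed
  then obtain j where j: "j < 4" "root (cls (x' j)) (cls (y' j))" using scr_simps(2) unfolding sc_def by blast
  obtain u s t where u: "u \<in> units" "s \<in> {1, -1}" "t \<in> {1, -1 :: int}"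
    and rep: "(cls (act s u x' j), cls (act t u y' j)) \<in> set reps"
    using exists_normalising_unit[OF j(2)] unfolding act_def by metis
  define X Y X' Y' where "X = act s u x" "Y = act t u y" "X' = act s u x'" "Y' = act t u y'"
  note defs = this
  have H: "hyp A B X Y X' Y'" unfolding defs by (rule hyp_act[OF h u])
  have Z: "X m = 0 \<and> Y m = 0" if "m < 4" "m \<notin> {i}" for m
    using zero[OF that] by (simp add: defs act_zero)
  have img: "cls (X' j) = cls (X i * A i j)" "cls (Y' j) = cls (Y i * B i j)" if "j < 4" for j
    using image[where S = "{i}", OF H _ Z that] i(1) by simp_all
  have X: "cls (X i) = mul4 (cls (X' j)) (inv4 (a i j))" "cls (Y i) = mul4 (cls (Y' j)) (inv4 (b i j))"
    unfolding a b img[OF j(1)] by (simp_all add: mul4_inv4 invA invB i(1) j(1))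
  \<comment> \<open>The contradiction needs a total above 6. Scores agree modulo 3 with norms, and
    the image has minus the norm of the source, so the total is a multiple of 3 and the next value
    is 9; likewise for pairs.\<close>
  have "9 \<le> sc X Y i + score1 a b i (cls (X i)) (cls (Y i))"
    using A[OF i(1) j(1)] rep unfolding chkA_def allrep_iff X[unfolded defs] sc_def defs by auto
  also have "score1 a b i (cls (X i)) (cls (Y i)) = (\<Sum>j<4. sc X' Y' j)"
    by (simp add: score1_def sum_4 sc_def img a b cls_hom)
  finally show False
    using sc_bound(1)[OF H] member_le_sum[of i "{..<4}" "sc X Y"] i(1) by simp
qed

text \<open>A vanishing image block gives a linear relation modulo 3 between the two blocks, so the
  normalised root in block i determines block k.\<close>

lemma no_pair_with_zero:
  assumes h: "hyp A B x y x' y'" and ik: "i < 4" "k < 4" "i \<noteq> k" "qnorm (x i) + qnorm (y i) = 4"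
    and zero: "\<And>m. m < 4 \<Longrightarrow> m \<notin> {i, k} \<Longrightarrow> x m = 0 \<and> y m = 0"
    and j: "j < 4" "sc x' y' j = 0"
  shows False
proof -
  have "root (cls (x i)) (cls (y i))" by (rule root_cls_if_norm_4) (use h ik in \<open>simp_all add: hyp_def\<close>)
  then obtain u s t where u: "u \<in> units" "s \<in> {1, -1}" "t \<in> {1, -1 :: int}"
    and rep: "(cls (act s u x i), cls (act t u y i)) \<in> set reps"
    using exists_normalising_unit unfolding act_def by metis
  define X Y X' Y' where "X = act s u x" "Y = act t u y" "X' = act s u x'" "Y' = act t u y'"
  note defs = this
  have H: "hyp A B X Y X' Y'" unfolding defs by (rule hyp_act[OF h u])
  have Z: "X m = 0 \<and> Y m = 0" if "m < 4" "m \<notin> {i, k}" for m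
    using zero[OF that] by (simp add: defs act_zero)
  have img: "cls (X' j) = cls (X i * A i j + X k * A k j)" "cls (Y' j) = cls (Y i * B i j + Y k * B k j)"
    if "j < 4" for j
    using image[where S = "{i, k}", OF H _ Z that] ik by simp_all
  have "c3 (X' j)" "c3 (Y' j)"
    using j(2) by (simp_all add: sc_def scr_simps cls_eq_O4 defs act_def c3_closed)
  then have "c3 (X i * A i j + X k * A k j)" "c3 (Y i * B i j + Y k * B k j)"
    using img[OF j(1)] by (simp_all add: cls_eq_O4[symmetric])
  from this[THEN cls_solve] have k: "cls (X k) = solve2 a i k j (cls (X i))" "cls (Y k) = solve2 b i k j (cls (Y i))"
    unfolding solve2_def a b inv4_cls cls_hom(3)[symmetric] mult.assoc[symmetric]
    by (simp_all only: invA invB ik j(1) not_False_eq_True simp_thms)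
  have "9 \<le> sc X Y i + sc X Y k + score2 a b i k (cls (X i)) (cls (Y i)) (cls (X k)) (cls (Y k))"
    using B[OF ik(1,2,3) j(1)] rep unfolding chkB_def allrep_iff k sc_def by (auto simp: defs)
  also have "score2 a b i k (cls (X i)) (cls (Y i)) (cls (X k)) (cls (Y k)) = (\<Sum>j<4. sc X' Y' j)"
    by (simp add: score2_def comb2_def sum_4 sc_def img a b cls_hom)
  finally have "9 \<le> (\<Sum>m\<in>{i, k}. sc X Y m) + (\<Sum>j<4. sc X' Y' j)" using ik(3) by simp
  moreover have "(\<Sum>m\<in>{i, k}. sc X Y m) \<le> (\<Sum>m<4. sc X Y m)" by (rule sum_mono2) (use ik in auto)
  ultimately show False using sc_bound(1)[OF H] by simp
qed

text \<open>All four image classes are roots, contrary to \<open>chkC\<close>. After normalisation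
  this is recovered by counting: the action preserves nonvanishing modulo 3, and two roots of total
  norm 8 leave 16 for four nonzero image blocks, hence score 1 for each.\<close>

lemma no_pair_without_zero:
  assumes h: "hyp A B x y x' y'" and ik: "i < k" "k < 4" "qnorm (x i) + qnorm (y i) = 4" "qnorm (x k) + qnorm (y k) = 4"
    and zero: "\<And>m. m < 4 \<Longrightarrow> m \<notin> {i, k} \<Longrightarrow> x m = 0 \<and> y m = 0"
    and j: "\<And>j. j < 4 \<Longrightarrow> sc x' y' j = 1"
  shows False
proof -
  have i: "i < 4" "i \<noteq> k" using ik by auto
  have "root (cls (x i)) (cls (y i))" by (rule root_cls_if_norm_4) (use h ik in \<open>simp_all add: hyp_def\<close>)
  then obtain u s t where u: "u \<in> units" "s \<in> {1, -1}" "t \<in> {1, -1 :: int}"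
    and rep: "(cls (act s u x i), cls (act t u y i)) \<in> set reps"
    using exists_normalising_unit unfolding act_def by metis
  define X Y X' Y' where "X = act s u x" "Y = act t u y" "X' = act s u x'" "Y' = act t u y'"
  note defs = this
  have H: "hyp A B X Y X' Y'" unfolding defs by (rule hyp_act[OF h u])
  have Z: "X m = 0 \<and> Y m = 0" if "m < 4" "m \<notin> {i, k}" for m
    using zero[OF that] by (simp add: defs act_zero)
  have img: "cls (X' j) = cls (X i * A i j + X k * A k j)" "cls (Y' j) = cls (Y i * B i j + Y k * B k j)"
    if "j < 4" for j
    using image[where S = "{i, k}", OF H _ Z that] ik i by simp_all
  have norm4: "qnorm (X k) + qnorm (Y k) = 4"
    unfolding defs act_def by (simp only: qnorm_act[OF u(1,2)] qnorm_act[OF u(1,3)] ik(4))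
  have rk: "root (cls (X k)) (cls (Y k))"
    by (rule root_cls_if_norm_4) (use H ik norm4 in \<open>simp_all add: hyp_def\<close>)
  have pos: "1 \<le> sc X' Y' j" if "j < 4" for j
  proof -
    have "\<not> (c3 (x' j) \<and> c3 (y' j))" using j[OF that] scr_simps(1)[of "cls (x' j)" "cls (y' j)"] by (auto simp: sc_def cls_eq_O4)
    moreover have "c3 p" if "c3 (of_int r * (u * p))" "r \<in> {1, -1 :: int}" for p r
    proof -
      have "qcnj u * (of_int r * (of_int r * (u * p))) = p"
        using that(2) u(1) by (auto simp: units_def quat_eq_iff)
      then show ?thesis using c3_closed(3)[OF c3_closed(3)[OF that(1)]] by metis
    qed
    ultimately have "\<not> (c3 (X' j) \<and> c3 (Y' j))" using u by (auto simp: defs act_def)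
    then have "sc X' Y' j \<noteq> 0" by (auto simp: sc_def scr_simps cls_eq_O4)
    then show ?thesis by simp
  qed
  have "8 \<le> ip X X + ip Y Y"
  proof -
    have "qnorm (X i) + qnorm (Y i) = 4"
      unfolding defs act_def by (simp only: qnorm_act[OF u(1,2)] qnorm_act[OF u(1,3)] ik(3))
    then have "8 = (\<Sum>m\<in>{i, k}. qnorm (X m) + qnorm (Y m))" using norm4 i by simp
    also have "\<dots> \<le> ip X X + ip Y Y" unfolding ip_add by (rule sum_mono2) (use ik in auto)
    finally show ?thesis .
  qed
  then have le: "(\<Sum>j<4. sc X' Y' j) \<le> 4" using sc_bound(2)[OF H] by linarith
  have all: "sc X' Y' j = 1" if "j < 4" for j
    using le pos[of 0] pos[of 1] pos[of 2] pos[of 3] less_4_cases[OF that] unfolding sum_4 by auto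
  then have "root (cls (X' j)) (cls (Y' j))" if "j < 4" for j
    using that scr_simps(2) by (auto simp: sc_def)
  then have "root (comb2 a i k j (cls (X i)) (cls (X k))) (comb2 b i k j (cls (Y i)) (cls (Y k)))" if "j < 4" for j
    using that by (simp add: img a b cls_hom comb2_def)
  from this[of 0] this[of 1] this[of 2] this[of 3] show False
    using C[OF ik(1,2)] rep unfolding chkC_def allrep_iff defs[symmetric] by (fastforce dest: allrD[OF _ rk])
qed

text \<open>Three roots use up norm 12, so the image has total score at most 3 and one of its four
  blocks vanishes modulo 3. This determines block l from blocks i and k.\<close>

lemma no_triple:
  assumes h: "hyp A B x y x' y'" and ikl: "i < k" "k < l" "l < 4"
    and n: "qnorm (x i) + qnorm (y i) = 4" "qnorm (x k) + qnorm (y k) = 4" "qnorm (x l) + qnorm (y l) = 4"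
    and zero: "\<And>m. m < 4 \<Longrightarrow> m \<notin> {i, k, l} \<Longrightarrow> x m = 0 \<and> y m = 0"
  shows False
proof -
  have i: "i < 4" "k < 4" "i \<noteq> k" "i \<noteq> l" "k \<noteq> l" using ikl by auto
  have "root (cls (x i)) (cls (y i))" by (rule root_cls_if_norm_4) (use h i n in \<open>simp_all add: hyp_def\<close>)
  then obtain u s t where u: "u \<in> units" "s \<in> {1, -1}" "t \<in> {1, -1 :: int}"
    and rep: "(cls (act s u x i), cls (act t u y i)) \<in> set reps"
    using exists_normalising_unit unfolding act_def by metis
  define X Y X' Y' where "X = act s u x" "Y = act t u y" "X' = act s u x'" "Y' = act t u y'"
  note defs = this
  have H: "hyp A B X Y X' Y'" unfolding defs by (rule hyp_act[OF h u])
  have Z: "X m = 0 \<and> Y m = 0" if "m < 4" "m \<notin> {i, k, l}" for m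
    using zero[OF that] by (simp add: defs act_zero)
  have img: "cls (X' j) = cls (X i * A i j + X k * A k j + X l * A l j)"
    "cls (Y' j) = cls (Y i * B i j + Y k * B k j + Y l * B l j)" if "j < 4" for j
    using image[where S = "{i, k, l}", OF H _ Z that] ikl i by (simp_all add: add.assoc)
  have norm4: "qnorm (X m) + qnorm (Y m) = 4" if "m \<in> {i, k, l}" for m
  proof -
    have "qnorm (X m) + qnorm (Y m) = qnorm (x m) + qnorm (y m)"
      unfolding defs act_def by (simp only: qnorm_act[OF u(1,2)] qnorm_act[OF u(1,3)])
    then show ?thesis using that n by auto
  qed
  have rt: "root (cls (X m)) (cls (Y m))" if "m \<in> {i, k, l}" for m
    by (rule root_cls_if_norm_4) (use H i ikl norm4[OF that] that in \<open>auto simp: hyp_def\<close>)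
  have "12 = (\<Sum>m\<in>{i, k, l}. qnorm (X m) + qnorm (Y m))" using i by (simp add: norm4)
  also have "\<dots> \<le> ip X X + ip Y Y" unfolding ip_add by (rule sum_mono2) (use ikl in auto)
  finally have le: "(\<Sum>j<4. sc X' Y' j) \<le> 3" using sc_bound(2)[OF H] by linarith
  have "\<exists>j<4. sc X' Y' j = 0"
  proof (rule ccontr)
    assume "\<not> (\<exists>j<4. sc X' Y' j = 0)"
    then have "(\<Sum>j<4::nat. 1) \<le> (\<Sum>j<4. sc X' Y' j)" by (intro sum_mono) (simp add: Suc_leI)
    then show False using le by simp
  qed
  then obtain j where j: "j < 4" "sc X' Y' j = 0" by blast
  then have "c3 (X' j)" "c3 (Y' j)" by (simp_all add: sc_def scr_simps cls_eq_O4)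
  then have "c3 ((X i * A i j + X k * A k j) + X l * A l j)" "c3 ((Y i * B i j + Y k * B k j) + Y l * B l j)"
    using img[OF j(1)] by (simp_all add: cls_eq_O4[symmetric])
  from this[THEN cls_solve] have l:
    "cls (X l) = solve3 a i k l j (cls (X i)) (cls (X k))" "cls (Y l) = solve3 b i k l j (cls (Y i)) (cls (Y k))"
    unfolding solve3_def a b inv4_cls cls_hom(3)[symmetric] cls_hom(1)[symmetric] mult.assoc[symmetric] distrib_right[symmetric]
    by (simp_all only: invA invB ikl(3) j(1) not_False_eq_True simp_thms)
  have "root (solve3 a i k l j (cls (X i)) (cls (X k))) (solve3 b i k l j (cls (Y i)) (cls (Y k)))"
    using rt[of l] unfolding l by simp
  moreover have "allr (\<lambda>fx fy. if root (solve3 a i k l j (cls (X i)) fx) (solve3 b i k l j (cls (Y i)) fy) then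
       6 \<le> score3 a b i k l (cls (X i)) (cls (Y i)) fx fy (solve3 a i k l j (cls (X i)) fx) (solve3 b i k l j (cls (Y i)) fy)
     else True)"
    using D[OF ikl j(1)] rep unfolding chkD_def allrep_iff defs[symmetric] by blast
  \<comment> \<open>The image scores add up to a multiple of 3, as the three roots do, so exceeding
    3 means reaching 6.\<close>
  ultimately have "6 \<le> score3 a b i k l (cls (X i)) (cls (Y i)) (cls (X k)) (cls (Y k)) (cls (X l)) (cls (Y l))"
    using allrD[OF _ rt[of k]] l by fastforce
  also have "\<dots> = (\<Sum>j<4. sc X' Y' j)"
    by (simp add: score3_def comb3_def sum_4 sc_def img a b cls_hom)
  finally show False using le by simp
qed

theorem half_zero:
  assumes h: "hyp A B x y x' y'" and i: "i < 4"
  shows "x i = 0 \<and> y i = 0"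
proof (rule ccontr)
  assume nz: "\<not> (x i = 0 \<and> y i = 0)"
  define n where "n = (\<lambda>m. qnorm (x m) + qnorm (y m))"
  define S where "S = {m. m < 4 \<and> n m \<noteq> 0}"
  have n0: "0 \<le> n m" for m by (simp add: n_def)
  have zero_iff: "n m = 0 \<longleftrightarrow> x m = 0 \<and> y m = 0" for m
    using qnorm_nonneg[of "x m"] qnorm_nonneg[of "y m"] unfolding n_def
    by (metis add_nonneg_eq_0_iff qnorm_eq_0_iff)
  have zero: "x m = 0 \<and> y m = 0" if "m < 4" "m \<notin> S" for m
    using that by (auto simp: S_def zero_iff)
  have fin: "finite S" "S \<subseteq> {..<4}" by (auto simp: S_def)
  have n4: "4 dvd n m" if "m < 4" for m
    unfolding n_def by (rule e8_norm) (use h that in \<open>simp add: hyp_def\<close>)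
  have n_ge: "4 \<le> n m" if "m \<in> S" for m
    using that n4[of m] n0[of m] by (auto simp: S_def dest: zdvd_imp_le)
  have sumS: "(\<Sum>m\<in>S. n m) = ip x x + ip y y"
    unfolding ip_add n_def[symmetric] by (rule sum.mono_neutral_left) (auto simp: S_def)
  have le12: "(\<Sum>m\<in>S. n m) \<le> 12" using h sumS by (simp add: hyp_def)
  have "(\<Sum>m\<in>S. 4) \<le> (\<Sum>m\<in>S. n m)" by (intro sum_mono n_ge)
  then have "int (card S) * 4 \<le> 12" using le12 by simp
  then have "card S \<le> 3" by simp
  moreover have "S \<noteq> {}" using nz i by (auto simp: S_def zero_iff)
  then have "card S \<noteq> 0" using fin by simp
  ultimately consider "card S = 1" | "card S = 2" | "card S = 3" by linarith
  then show False
  proof cases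
    case 1
    then obtain m where m: "S = {m}" by (auto simp: card_1_singleton_iff)
    then have "m < 4" "n m \<noteq> 0" using fin by (auto simp: S_def)
    then show False using no_single[OF h _ _ zero[unfolded m]] zero_iff by blast
  next
    case 2
    then obtain p q where pq0: "S = {p, q}" "p \<noteq> q" by (auto simp: card_2_iff)
    then obtain p q where pq: "S = {p, q}" "p < q" by (metis insert_commute linorder_neqE_nat)
    have lt: "p < 4" "q < 4" using fin pq by auto
    have n: "4 \<le> n p" "4 \<le> n q" "n p + n q \<le> 12" "4 dvd n p" "4 dvd n q"
      using n_ge le12 pq n4 lt by auto
    have z: "x m = 0 \<and> y m = 0" if "m < 4" "m \<notin> {p, q}" for m using zero that pq by auto
    have z': "x m = 0 \<and> y m = 0" if "m < 4" "m \<notin> {q, p}" for m using zero that pq by auto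
    \<comment> \<open>Two positive multiples of 4 with sum at most 12: one is 4, and its block is
      the root to be normalised.\<close>
    have four: "n p = 4 \<or> n q = 4" using n by presburger
    have pos: "sc x' y' j \<noteq> 0" if "j < 4" for j
      using four no_pair_with_zero[OF h lt(1,2) _ _ z that] no_pair_with_zero[OF h lt(2,1) _ _ z' that] pq(2)
      by (auto simp: n_def)
    have ips: "ip x x + ip y y = n p + n q" using sumS pq by simp
    have ge4: "4 \<le> (\<Sum>j<4. sc x' y' j)"
    proof -
      have "(\<Sum>j<4::nat. 1) \<le> (\<Sum>j<4. sc x' y' j)" by (intro sum_mono) (use pos in \<open>simp add: Suc_leI\<close>)
      then show ?thesis by simp
    qed
    \<comment> \<open>Four nonzero image blocks cost at least 16 of the available 24, which leaves
      exactly two roots.\<close>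
    then have "16 \<le> 24 - (n p + n q)" using sc_bound(2)[OF h] ips by linarith
    then have n8: "n p = 4" "n q = 4" using n by linarith+
    then have le4: "(\<Sum>j<4. sc x' y' j) \<le> 4" using sc_bound(2)[OF h] ips by linarith
    have "sc x' y' j = 1" if "j < 4" for j
      using le4 pos[of 0] pos[of 1] pos[of 2] pos[of 3] less_4_cases[OF that] unfolding sum_4 by auto
    then show False using no_pair_without_zero[OF h pq(2) lt(2) _ _ z] n8 by (auto simp: n_def)
  next
    case 3
    then obtain p q r where S: "S = {p, q, r}" "p \<noteq> q" "q \<noteq> r" "p \<noteq> r" by (auto simp: card_3_iff)
    have "\<exists>p q r. S = {p, q, r} \<and> p < q \<and> q < r"
    proof -
      have "p < q \<and> q < r \<or> p < r \<and> r < q \<or> q < p \<and> p < r \<or> q < r \<and> r < p \<or> r < p \<and> p < q \<or> r < q \<and> q < p"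
        using S by linarith
      then show ?thesis
        using S(1) by (elim disjE) (metis insert_commute)+
    qed
    then obtain p q r where pqr: "S = {p, q, r}" "p < q" "q < r" by blast
    have lt: "r < 4" using fin pqr by auto
    have "n p + n q + n r \<le> 12" using le12 pqr by simp
    then have "n p = 4" "n q = 4" "n r = 4" using n_ge[of p] n_ge[of q] n_ge[of r] pqr(1) by auto
    then show False using no_triple[OF h pqr(2,3) lt _ _ _ zero[unfolded pqr(1)]] by (auto simp: n_def)
  qed
qed

end

interpretation first: half Qm Bm qa qb
proof
  show "\<not> 3 dvd qnorm (Qm i j)" if "i < 4" "j < 4" for i j
    using that by (auto dest!: less_4_cases simp: Qm_def qdot_def)
  show "\<not> 3 dvd qnorm (Bm i j)" if "i < 4" "j < 4" for i j
    using that by (auto dest!: less_4_cases simp: Qm_def Bm_def rho_def qdot_def)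
qed (rule qa_def qb_def chk_qab; assumption?)+

interpretation second: half "adjm Qm" "adjm Bm" qc qd
proof
  show "\<not> 3 dvd qnorm (adjm Qm i j)" if "i < 4" "j < 4" for i j
    using that by (auto dest!: less_4_cases simp: Qm_def adjm_def qdot_def)
  show "\<not> 3 dvd qnorm (adjm Bm i j)" if "i < 4" "j < 4" for i j
    using that by (auto dest!: less_4_cases simp: Qm_def Bm_def rho_def adjm_def qdot_def)
qed (rule qc_def qd_def chk_qcd; assumption?)+

text \<open>The glue read from the second half to the first: apply \<open>K'\<close> and use 11 = -1
  modulo 3.\<close>

lemma LQ_c3_adjoint:
  assumes "LQ z" "i < 4"
  shows "c3 (z 0 i - K' (z 1) i)" "c3 (- z 2 i - K' (z 3) i)"
proof -
  have z: "c3 (z 1 j + K (z 0) j)" "c3 (z 3 j - K (z 2) j)" if "j < 4" for j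
    using assms(1) that by (auto simp: LQ_def)
  have "c3 (K' (\<lambda>j. z 1 j + K (z 0) j) i)" "c3 (K' (\<lambda>j. z 3 j - K (z 2) j) i)"
    by (rule c3_rmul, rule z, assumption)+
  then have "c3 (K' (z 1) i + 11 * z 0 i)" "c3 (K' (z 3) i - 11 * z 2 i)"
    by (simp_all add: rmul_lin K_inverse assms(2))
  moreover have "z 0 i - K' (z 1) i = 3 * (4 * z 0 i) - (K' (z 1) i + 11 * z 0 i)"
    "- z 2 i - K' (z 3) i = 3 * (- 4 * z 2 i) - (K' (z 3) i - 11 * z 2 i)"
    by (simp_all add: quat_eq_iff)
  ultimately show "c3 (z 0 i - K' (z 1) i)" "c3 (- z 2 i - K' (z 3) i)"
    by (simp_all only: c3_closed(2) c3_closed(6))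
qed

lemma e8_uminus: "e8 (- x) y \<longleftrightarrow> e8 x y" "e8 x (- y) \<longleftrightarrow> e8 x y"
  by (simp_all add: e8_def qsum_def) (argo | presburger)+

text \<open>Such a vector is three times an E8 vector, so its norm is a multiple of 36.\<close>

lemma zero_if_c3:
  assumes "e8 x y" "c3 x" "c3 y" "qnorm x + qnorm y < 36"
  shows "x = 0 \<and> y = 0"
proof -
  obtain p q where pq: "x = 3 * p" "y = 3 * q" using assms(2,3) by (auto simp: c3_def)
  have "4 dvd qnorm p + qnorm q" using assms(1) e8_norm[of p q] by (simp add: pq e8_closed)
  then obtain m where m: "qnorm p + qnorm q = 4 * m" by blast
  have "9 * (4 * m) < 36" using assms(4) m by (simp add: pq)
  then have "qnorm p + qnorm q \<le> 0" using m by simp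
  then have "qnorm p = 0 \<and> qnorm q = 0" using qnorm_nonneg[of p] qnorm_nonneg[of q] by linarith
  then show ?thesis by (simp add: pq)
qed

lemma rho_surj: "i < 4 \<Longrightarrow> \<exists>j<4. i = rho j"
  by (drule less_4_cases) (auto simp: rho_def intro: exI[of _ 0] exI[of _ 1] exI[of _ 2] exI[of _ 3])

lemma rmul_zero: "(\<And>i. i < 4 \<Longrightarrow> p i = 0) \<Longrightarrow> rmul M p j = 0"
  by (simp add: rmul_def)

lemma LQ_min:
  assumes z: "LQ z" and D: "D z z < 36" and s: "s < 4" and i: "i < 4"
  shows "z s i = 0"
proof -
  have e: "e8 (z 0 i) (z 2 i)" "e8 (z 1 i) (z 3 (rho i))"
    and c: "c3 (z 1 i + K (z 0) i)" "c3 (z 3 i - K (z 2) i)" if "i < 4" for i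
    using z that by (auto simp: LQ_def)
  define n n' where "n = ip (z 0) (z 0) + ip (z 2) (z 2)" and "n' = ip (z 1) (z 1) + ip (z 3) (z 3)"
  have Dn: "D z z = n + n'" by (simp add: D_def sum_4 n_def n'_def)
  obtain m where "D z z = 12 * m" using LQ_norm[OF z] by blast
  then have le: "n + n' \<le> 24" using D Dn by simp
  have nn: "0 \<le> qnorm (z t i)" for t i by simp
  have ns: "n = (\<Sum>i<4. qnorm (z 0 i) + qnorm (z 2 i))" "n' = (\<Sum>i<4. qnorm (z 1 i) + qnorm (z 3 (rho i)))"
    by (simp_all add: n_def n'_def ip_def sum_4 rho_def)
  have n_ge: "qnorm (z 0 i) + qnorm (z 2 i) \<le> n" "qnorm (z 1 i) + qnorm (z 3 (rho i)) \<le> n'" if "i < 4" for i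
    unfolding ns by (rule member_le_sum; use that nn in auto)+
  have n0: "0 \<le> n" "0 \<le> n'" unfolding ns by (intro sum_nonneg add_nonneg_nonneg nn)+
  have rhos: "ip (\<lambda>j. z 3 (rho j)) (\<lambda>j. z 3 (rho j)) = ip (z 3) (z 3)"
    by (simp add: ip_def sum_4 rho_def)
  have negs: "ip (\<lambda>j. - p j) (\<lambda>j. - p j) = ip p p" for p by (simp add: ip_def)
  have "(\<forall>i<4. z 0 i = 0 \<and> z 2 i = 0) \<or> (\<forall>i<4. z 1 i = 0 \<and> z 3 (rho i) = 0)"
  proof (cases "n \<le> 12")
    case True
    \<comment> \<open>The glue says that \<open>z 1\<close> is minus the image of
      \<open>z 0\<close>, hence the sign.\<close>
    have "hyp Qm Bm (z 0) (z 2) (\<lambda>j. - z 1 j) (\<lambda>j. z 3 (rho j))"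
      unfolding hyp_def rhos negs
    proof (intro conjI allI impI)
      fix j :: nat assume j: "j < 4"
      show "c3 (- z 1 j - K (z 0) j)" using c3_closed(5)[OF c(1)[OF j]] by simp
      have "rmul Bm (z 2) j = K (z 2) (rho j)" by (simp add: rmul_def Bm_def)
      then show "c3 (z 3 (rho j) - rmul Bm (z 2) j)" using c(2)[OF rho_less[OF j]] by simp
    qed (use e True le in \<open>simp_all add: e8_uminus n_def n'_def\<close>)
    from first.half_zero[OF this] show ?thesis by blast
  next
    case False
    have "hyp (adjm Qm) (adjm Bm) (z 1) (\<lambda>j. z 3 (rho j)) (z 0) (\<lambda>i. - z 2 i)"
      unfolding hyp_def rhos negs
    proof (intro conjI allI impI)
      fix j :: nat assume j: "j < 4"
      show "c3 (z 0 j - K' (z 1) j)" by (rule LQ_c3_adjoint[OF z j])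
      have "rmul (adjm Bm) (\<lambda>j. z 3 (rho j)) j = K' (z 3) j"
        by (simp add: rmul_def sum_4 adjm_def Bm_def rho_def)
      then show "c3 (- z 2 j - rmul (adjm Bm) (\<lambda>j. z 3 (rho j)) j)"
        by (simp only: LQ_c3_adjoint[OF z j])
    qed (use e False le in \<open>simp_all add: e8_uminus n_def n'_def\<close>)
    from second.half_zero[OF this] show ?thesis by blast
  qed
  \<comment> \<open>A vanishing half makes the other half divisible by 3, and its blocks have norm
    at most 24 < 36.\<close>
  then have "(\<forall>i<4. z 0 i = 0 \<and> z 2 i = 0) \<and> (\<forall>i<4. z 1 i = 0 \<and> z 3 (rho i) = 0)"
  proof
    assume zero: "\<forall>i<4. z 0 i = 0 \<and> z 2 i = 0"
    then have "c3 (z 1 i)" "c3 (z 3 i)" if "i < 4" for i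
      using c[OF that] by (simp_all add: rmul_zero)
    note c1 = this
    have "z 1 i = 0 \<and> z 3 (rho i) = 0" if "i < 4" for i
      by (rule zero_if_c3[OF e(2)[OF that] c1(1)[OF that] c1(2)[OF rho_less[OF that]]])
        (use n_ge(2)[OF that] le n0 in linarith)
    then show ?thesis using zero by blast
  next
    assume zero: "\<forall>i<4. z 1 i = 0 \<and> z 3 (rho i) = 0"
    then have "z 3 i = 0" if "i < 4" for i using rho_surj[OF that] by auto
    then have "c3 (z 0 i)" "c3 (z 2 i)" if "i < 4" for i
      using LQ_c3_adjoint[OF z that] zero c3_closed(5)[of "- z 2 i"] by (simp_all add: rmul_zero)
    note c0 = this
    have "z 0 i = 0 \<and> z 2 i = 0" if "i < 4" for i
      by (rule zero_if_c3[OF e(1)[OF that] c0(1)[OF that] c0(2)[OF that]])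
        (use n_ge(1)[OF that] le n0 in linarith)
    then show ?thesis using zero by blast
  qed
  then show ?thesis using less_4_cases[OF s] rho_surj[OF i] i by (elim disjE) auto
qed

section \<open>Transfer of the lattice and its similarities to integer vectors\<close>

lemma Fop_cong:
  assumes "\<And>s i. s < 4 \<Longrightarrow> i < 4 \<Longrightarrow> x s i = y s i" "i < 4"
  shows "Fop \<xi> b a c x s i = Fop \<xi> b a c y s i"
proof -
  have "rmul M (x t) i = rmul M (y t) i" if "t < 4" for M t by (rule K_cong) (rule assms(1)[OF that])
  then show ?thesis by (simp add: Fop_def assms)
qed

lemma Fop_lin:
  "Fop \<xi> b a c (\<lambda>s i. x s i + of_int r * y s i) s i = Fop \<xi> b a c x s i + of_int r * Fop \<xi> b a c y s i"
  by (simp add: Fop_def rmul_lin; simp add: quat_eq_iff algebra_simps)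

lemma blk_lin: "blk (\<lambda>i. u i + r * v i) s i = blk u s i + of_int r * blk v s i"
  by (simp add: blk_def Let_def quat_eq_iff)

lemma div_4_cases: "(n :: nat) mod 4 = 0 \<or> n mod 4 = 1 \<or> n mod 4 = 2 \<or> n mod 4 = 3"
  by (rule less_4_cases) simp

lemma flat_lin: "flat (\<lambda>s i. x s i + of_int r * y s i) n = flat x n + r * flat y n"
  using div_4_cases[of n] by (auto simp: flat_def Let_def)

lemma flat_zero: "flat (\<lambda>s i. 0) n = 0"
  using div_4_cases[of n] by (auto simp: flat_def Let_def)

lemma flat_cong: "(\<And>s i. s < 4 \<Longrightarrow> i < 4 \<Longrightarrow> x s i = y s i) \<Longrightarrow> flat x n = flat y n"
  by (simp add: flat_def Let_def less_mult_imp_div_less)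

lemma blk_cong: "(\<And>i. i < 64 \<Longrightarrow> u i = v i) \<Longrightarrow> s < 4 \<Longrightarrow> i < 4 \<Longrightarrow> blk u s i = blk v s i"
  by (drule less_4_cases, drule less_4_cases, elim disjE) (simp_all add: blk_def)

lemma flat_Fop_lin:
  "flat (Fop \<xi> b a c (blk (\<lambda>i. u i + r * v i))) n = flat (Fop \<xi> b a c (blk u)) n + r * flat (Fop \<xi> b a c (blk v)) n"
proof -
  have "blk (\<lambda>i. u i + r * v i) = (\<lambda>s i. blk u s i + of_int r * blk v s i)"
    by (intro ext) (rule blk_lin)
  moreover have "Fop \<xi> b a c (\<lambda>s i. blk u s i + of_int r * blk v s i)
      = (\<lambda>s i. Fop \<xi> b a c (blk u) s i + of_int r * Fop \<xi> b a c (blk v) s i)"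
    by (intro ext) (rule Fop_lin)
  ultimately show ?thesis by (simp only: flat_lin)
qed

lemma flat_Fop_inverse:
  assumes "n < 64"
  shows "flat (Fop (qcnj \<xi>) (- b) a c (blk (flat (Fop \<xi> b a c (blk u))))) n
    = (9 * qnorm \<xi> + (a\<^sup>2 + 11 * c\<^sup>2) * b\<^sup>2) * u n" (is "_ = ?N * _")
proof -
  have "flat (Fop (qcnj \<xi>) (- b) a c (blk (flat (Fop \<xi> b a c (blk u))))) n
      = flat (\<lambda>s i. 0 + of_int ?N * blk u s i) n"
  proof (rule flat_cong)
    fix s i :: nat assume si: "s < 4" "i < 4"
    have "Fop (qcnj \<xi>) (- b) a c (blk (flat (Fop \<xi> b a c (blk u)))) s i
        = Fop (qcnj \<xi>) (- b) a c (Fop \<xi> b a c (blk u)) s i"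
      by (rule Fop_cong[OF blk_flat si(2)])
    then show "Fop (qcnj \<xi>) (- b) a c (blk (flat (Fop \<xi> b a c (blk u)))) s i = 0 + of_int ?N * blk u s i"
      unfolding Fop_inverse[OF si] by simp
  qed
  also have "\<dots> = flat (\<lambda>s i. 0) n + ?N * flat (blk u) n" by (rule flat_lin)
  finally show ?thesis by (simp add: flat_zero flat_blk[OF assms])
qed

lemma three_dvd_flat: "(\<And>s i. s < 4 \<Longrightarrow> i < 4 \<Longrightarrow> c3 (x s i)) \<Longrightarrow> 3 dvd flat x n"
  using div_4_cases[of n] by (auto simp: flat_def Let_def c3_iff less_mult_imp_div_less)

lemma zmin_flat: "odd (flat zmin 0)"
  by (simp add: flat_def zmin_def parts_def single_def)

lemma extremal_typeII_if_norm:
  assumes N: "9 * qnorm \<xi> + (a\<^sup>2 + 11 * c\<^sup>2) * b\<^sup>2 = 3 * int k" and ac: "3 dvd a - c" and k: "0 < k"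
  shows "\<exists>C. extremal_typeII k 64 C"
proof (rule extremal_typeII_if_frame[where \<Lambda> = "\<lambda>u. LQ (blk u)" and ?i0.0 = 0 and ?z0.0 = "flat zmin"
      and F = "\<lambda>u. flat (Fop \<xi> b a c (blk u))" and G = "\<lambda>u. flat (Fop (qcnj \<xi>) (- b) a c (blk u))", OF k])
  have zz: "blk (flat z) s i = z s i" if "s < 4" "i < 4" for z s i by (rule blk_flat[OF that])
  show "LQ (blk v)" if "LQ (blk u)" "\<And>i. i < 64 \<Longrightarrow> u i = v i" for u v
    by (rule LQ_cong[OF that(1)]) (rule blk_cong[OF that(2)])
  show "LQ (blk (\<lambda>i. u i + r * v i))" if "LQ (blk u)" "LQ (blk v)" for u v r
    by (rule LQ_cong[OF LQ_lin[OF that]]) (rule blk_lin[symmetric])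
  show "12 dvd dot u u" if "LQ (blk u)" for u
    unfolding dot_eq_D by (rule LQ_norm[OF that])
  show "u i = 0" if "LQ (blk u)" "dot u u < 36" "i < 64" for u i
  proof -
    have "flat (blk u) i = flat (\<lambda>s i. 0) i"
      by (rule flat_cong) (rule LQ_min[OF that(1) that(2)[unfolded dot_eq_D]])
    then show ?thesis by (simp only: flat_zero flat_blk[OF that(3)])
  qed
  show "LQ (blk u)" if "\<And>v. LQ (blk v) \<Longrightarrow> 6 dvd dot u v" for u
  proof (rule LQ_dual)
    fix y assume "LQ y"
    then have "LQ (blk (flat y))" by (rule LQ_cong) (simp add: zz)
    from that[OF this] show "6 dvd D (blk u) y" by (simp add: dot_flat)
  qed
  show "LQ (blk (flat zmin))" by (rule LQ_cong[OF zmin(1)]) (simp add: zz)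
  show "dot (flat zmin) (flat zmin) = 36"
    unfolding dot_flat zmin(2)[symmetric] by (rule D_cong) (simp_all add: zz)
  show "(0 :: nat) < 64" by simp
  show "odd (flat zmin 0)" by (rule zmin_flat)
  show "flat (Fop \<xi> b a c (blk u)) i = flat (Fop \<xi> b a c (blk v)) i"
    if "\<And>i. i < 64 \<Longrightarrow> u i = v i" for u v i
    by (intro flat_cong Fop_cong blk_cong that)
  show "flat (Fop (qcnj \<xi>) (- b) a c (blk u)) i = flat (Fop (qcnj \<xi>) (- b) a c (blk v)) i"
    if "\<And>i. i < 64 \<Longrightarrow> u i = v i" for u v i
    by (intro flat_cong Fop_cong blk_cong that)
  show "dot (flat (Fop \<xi> b a c (blk u))) v = dot u (flat (Fop (qcnj \<xi>) (- b) a c (blk v)))" for u v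
    unfolding dot_flat by (rule Fop_adjoint)
  show "flat (Fop (qcnj \<xi>) (- b) a c (blk (flat (Fop \<xi> b a c (blk u))))) i = 3 * int k * u i"
    if "i < 64" for u i by (simp only: flat_Fop_inverse[OF that] N)
  show "flat (Fop \<xi> b a c (blk (flat (Fop (qcnj \<xi>) (- b) a c (blk u))))) i = 3 * int k * u i"
    if "i < 64" for u i
    using flat_Fop_inverse[OF that, of "qcnj \<xi>" "- b" a c u] N by simp
  show "3 dvd flat (Fop (qcnj \<xi>) (- b) a c (blk u)) i" if "LQ (blk u)" for u i
    by (rule three_dvd_flat) (rule Fop_c3[OF that ac])
  show "LQ (blk (\<lambda>i. 2 * flat (Fop \<xi> b a c (blk u)) i))" for u
  proof (rule LQ_cong[OF LQ_2_Fop[OF ac, of \<xi> b "blk u"]])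
    fix s i :: nat assume si: "s < 4" "i < 4"
    have "blk (\<lambda>i. 2 * flat (Fop \<xi> b a c (blk u)) i) s i = 2 * blk (flat (Fop \<xi> b a c (blk u))) s i"
      by (simp add: blk_def Let_def quat_eq_iff)
    then show "2 * Fop \<xi> b a c (blk u) s i = blk (\<lambda>i. 2 * flat (Fop \<xi> b a c (blk u)) i) s i"
      by (simp only: zz si)
  qed
qed (rule flat_Fop_lin)+

lemma extremal_typeII_if_ge_3:
  assumes "3 \<le> k"
  shows "\<exists>C. extremal_typeII k 64 C"
proof -
  \<comment> \<open>With N the norm of \<xi> the three shapes come from 9N, 9N + 12 and 9N + 15
    after division by 3; k >= 3 is what makes N nonnegative.\<close>
  have "\<exists>N. k = 3 * N \<or> k = 3 * N + 4 \<or> k = 3 * N + 5" using assms by presburger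
  then obtain N where N: "k = 3 * N \<or> k = 3 * N + 4 \<or> k = 3 * N + 5" by blast
  obtain \<xi> where "qnorm \<xi> = int N" using exists_qnorm_eq by blast
  then show ?thesis
    using N assms extremal_typeII_if_norm[of \<xi> 1 1 0 k] extremal_typeII_if_norm[of \<xi> 1 1 1 k]
      extremal_typeII_if_norm[of \<xi> 2 "- 1" 1 k] by auto
qed

section \<open>Codes built from BCH codes\<close>

text \<open>The recursions below are written for evaluation by the simplifier on literal bit lists.\<close>

fun xorl :: "bool list \<Rightarrow> bool list \<Rightarrow> bool list" where
  "xorl (True # xs) (True # ys) = False # xorl xs ys"
| "xorl (True # xs) (False # ys) = True # xorl xs ys"
| "xorl (False # xs) (y # ys) = y # xorl xs ys"
| "xorl [] ys = []"
| "xorl xs [] = []"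

fun wtge :: "nat \<Rightarrow> bool list \<Rightarrow> bool" where
  "wtge 0 xs = True"
| "wtge (Suc n) (True # xs) = wtge n xs"
| "wtge (Suc n) (False # xs) = wtge (Suc n) xs"
| "wtge (Suc n) [] = False"

fun nob :: "bool list \<Rightarrow> bool" where
  "nob [] = True"
| "nob (True # xs) = False"
| "nob (False # xs) = nob xs"

text \<open>Depth-first over all subset sums, with partial sums shared between branches: the 2^11 or
  2^13 words cost about one addition each.\<close>

fun minwt :: "nat \<Rightarrow> bool list list \<Rightarrow> bool list \<Rightarrow> bool" where
  "minwt t [] acc = (if nob acc then True else wtge t acc)"
| "minwt t (g # gs) acc = (minwt t gs acc \<and> minwt t gs (xorl acc g))"

text \<open>Applied to the columns of a generator matrix; distinct sums yield dual distance 6 in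
  \<open>orth_weight\<close>.\<close>

fun pair_sums :: "bool list list \<Rightarrow> bool list list" where
  "pair_sums [] = []"
| "pair_sums (x # xs) = map (xorl x) xs @ pair_sums xs"

fun tails :: "bool \<Rightarrow> bool list list \<Rightarrow> bool list list" where
  "tails b [] = []"
| "tails True ((True # x) # xs) = x # tails True xs"
| "tails True ((False # x) # xs) = tails True xs"
| "tails False ((True # x) # xs) = tails False xs"
| "tails False ((False # x) # xs) = x # tails False xs"
| "tails b ([] # xs) = tails b xs"

text \<open>Splitting by successive bits avoids comparing all pairs among the 2016 column sums of
  length 64. The counter is the number of bits left; entries that agree in all bits meet at
  0.\<close>

fun radix_distinct :: "nat \<Rightarrow> bool list list \<Rightarrow> bool" where
  "radix_distinct d [] = True"
| "radix_distinct d [x] = True"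
| "radix_distinct 0 (x # y # xs) = False"
| "radix_distinct (Suc d) (x # y # xs) =
    (radix_distinct d (tails True (x # y # xs)) \<and> radix_distinct d (tails False (x # y # xs)))"

lemma xorl_nth:
  "length x = length y \<Longrightarrow> length (xorl x y) = length y"
  "length x = length y \<Longrightarrow> j < length y \<Longrightarrow> xorl x y ! j = (x ! j \<noteq> y ! j)"
proof -
  show "length x = length y \<Longrightarrow> length (xorl x y) = length y" by (induction x y rule: xorl.induct) auto
  show "length x = length y \<Longrightarrow> j < length y \<Longrightarrow> xorl x y ! j = (x ! j \<noteq> y ! j)"
    by (induction x y arbitrary: j rule: xorl.induct) (auto simp: nth_Cons split: nat.splits)
qed

lemma xorl_eq_map: "length x = n \<Longrightarrow> length y = n \<Longrightarrow> xorl x y = map (\<lambda>j. x ! j \<noteq> y ! j) [0..<n]"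
  by (rule nth_equalityI) (simp_all add: xorl_nth)

lemma nob_iff: "nob w \<longleftrightarrow> (\<forall>x \<in> set w. \<not> x)"
  by (induction w rule: nob.induct) auto

lemma wtge_iff: "wtge t w \<longleftrightarrow> t \<le> length (filter (\<lambda>x. x) w)"
  by (induction t w rule: wtge.induct) auto

lemma wtge_map: "wtge t (map f [0..<n]) \<longleftrightarrow> t \<le> card {j. j < n \<and> f j}"
proof -
  have "{i. i < length (map f [0..<n]) \<and> map f [0..<n] ! i} = {j. j < n \<and> f j}" by auto
  then show ?thesis by (simp add: wtge_iff length_filter_conv_card)
qed

lemma tails_iff: "x \<in> set (tails b xs) \<longleftrightarrow> b # x \<in> set xs"
  by (induction b xs rule: tails.induct) auto

lemma distinct_if_tails:
  assumes "distinct (tails True xs)" "distinct (tails False xs)" "[] \<notin> set xs"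
  shows "distinct xs"
  using assms
proof (induction xs)
  case (Cons y ys)
  then obtain b z where y: "y = b # z" by (cases y) auto
  show ?case using Cons tails_iff[of z b ys] by (cases b) (auto simp: y)
qed simp

lemma distinct_if_radix_distinct:
  "radix_distinct d xs \<Longrightarrow> (\<And>x. x \<in> set xs \<Longrightarrow> length x = d) \<Longrightarrow> distinct xs"
proof (induction d xs rule: radix_distinct.induct)
  case (4 d x y xs)
  have len: "length z = d" if "z \<in> set (tails b (x # y # xs))" for z b
    using 4(4)[of "b # z"] that unfolding tails_iff by simp
  have "radix_distinct d (tails True (x # y # xs))" "radix_distinct d (tails False (x # y # xs))"
    using 4(3) by simp_all
  then have "distinct (tails True (x # y # xs))" "distinct (tails False (x # y # xs))"
    using 4(1,2) len by blast+
  moreover have "[] \<notin> set (x # y # xs)" using 4(4)[of "[]"] by auto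
  ultimately show ?case by (rule distinct_if_tails)
qed auto

lemma pair_sums_iff: "w \<in> set (pair_sums xs) \<longleftrightarrow> (\<exists>j<length xs. \<exists>i<j. w = xorl (xs ! i) (xs ! j))"
proof (induction xs)
  case (Cons x xs)
  have "w \<in> set (pair_sums (x # xs)) \<longleftrightarrow> (\<exists>j<length xs. w = xorl x (xs ! j)) \<or>
      (\<exists>j<length xs. \<exists>i<j. w = xorl (xs ! i) (xs ! j))"
  proof -
    have "(\<exists>z\<in>set xs. w = xorl x z) \<longleftrightarrow> (\<exists>j<length xs. w = xorl x (xs ! j))"
      by (metis in_set_conv_nth)
    then show ?thesis by (simp add: image_iff Cons)
  qed
  also have "\<dots> \<longleftrightarrow> (\<exists>j<length (x # xs). \<exists>i<j. w = xorl ((x # xs) ! i) ((x # xs) ! j))"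
    (is "?L \<longleftrightarrow> ?R")
  proof
    show ?L if ?R
    proof -
      obtain j i where ij: "j < length (x # xs)" "i < j" "w = xorl ((x # xs) ! i) ((x # xs) ! j)"
        using \<open>?R\<close> by blast
      then obtain j' where "j = Suc j'" by (cases j) auto
      then show ?L using ij by (cases i) auto
    qed
    show ?R if ?L
      using that
    proof (elim disjE exE conjE)
      fix j assume "j < length xs" "w = xorl x (xs ! j)"
      then show ?R by (intro exI[of _ "Suc j"] conjI exI[of _ 0]) simp_all
    next
      fix j i assume "j < length xs" "i < j" "w = xorl (xs ! i) (xs ! j)"
      then show ?R by (intro exI[of _ "Suc j"] conjI exI[of _ "Suc i"]) simp_all
    qed
  qed
  finally show ?case .
qed simp

lemma pair_sums_inj:
  assumes "distinct (pair_sums xs)" "i < j" "j < length xs" "k < l" "l < length xs"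
    "xorl (xs ! i) (xs ! j) = xorl (xs ! k) (xs ! l)"
  shows "i = k \<and> j = l"
  using assms
proof (induction xs arbitrary: i j k l)
  case (Cons x xs)
  have d: "distinct (map (xorl x) xs)" "distinct (pair_sums xs)"
    "set (map (xorl x) xs) \<inter> set (pair_sums xs) = {}" using Cons.prems(1) by auto
  obtain j' l' where jl: "j = Suc j'" "l = Suc l'" using Cons.prems by (cases j; cases l) auto
  have lt: "j' < length xs" "l' < length xs" using Cons.prems jl by auto
  have mem: "xorl (xs ! m) (xs ! m') \<in> set (pair_sums xs)" if "m < m'" "m' < length xs" for m m'
    using that by (auto simp: pair_sums_iff)
  have mem0: "xorl x (xs ! m) \<in> set (map (xorl x) xs)" if "m < length xs" for m using that by simp
  show ?case
  proof (cases i; cases k)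
    assume "i = 0" "k = 0"
    then show ?thesis
      using nth_eq_iff_index_eq[OF d(1), of j' l'] Cons.prems(6) lt by (simp add: jl)
  next
    fix k' assume ik: "i = 0" "k = Suc k'"
    then have "k' < l'" "xorl x (xs ! j') = xorl (xs ! k') (xs ! l')" using Cons.prems by (simp_all add: jl)
    then show ?thesis using mem[of k' l'] mem0[of j'] d(3) lt by (metis disjoint_iff)
  next
    fix i' assume ik: "i = Suc i'" "k = 0"
    then have "i' < j'" "xorl (xs ! i') (xs ! j') = xorl x (xs ! l')" using Cons.prems by (simp_all add: jl)
    then show ?thesis using mem[of i' j'] mem0[of l'] d(3) lt by (metis disjoint_iff)
  next
    fix i' k' assume "i = Suc i'" "k = Suc k'"
    then show ?thesis using Cons.IH[OF d(2), of i' j' k' l'] Cons.prems lt by (simp add: jl)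
  qed
qed simp

section \<open>Binary codes with an integral generator matrix\<close>

lemma mult_if: "x * (if b then y else 0) = (if b then x * y else (0 :: int))"
  by simp

text \<open>Entries are integers because the locale also serves a lift to \<int>/4; the assumptions
  see only their parity. The information positions \<open>p\<close> allow the coefficients of a
  codeword to be read off from its entries.\<close>

locale systematic_code =
  fixes R :: "int list list" and n :: nat and p :: "nat list"
  assumes len: "\<And>a. a < length R \<Longrightarrow> length (R ! a) = n"
    and p: "\<And>a. a < length R \<Longrightarrow> p ! a < n"
    and sys: "\<And>a b. a < length R \<Longrightarrow> b < length R \<Longrightarrow> odd (R ! a ! (p ! b)) \<longleftrightarrow> a = b"
    and ones: "\<And>j. j < n \<Longrightarrow> odd (\<Sum>a<length R. R ! a ! j)"
begin

definition ds :: "(nat \<Rightarrow> int) \<Rightarrow> (nat \<Rightarrow> int) \<Rightarrow> int" where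
  "ds u v = (\<Sum>j<n. u j * v j)"

definition cw :: "(nat \<Rightarrow> int) \<Rightarrow> nat \<Rightarrow> int" where
  "cw \<alpha> j = (\<Sum>a<length R. \<alpha> a * R ! a ! j)"

abbreviation g :: "nat \<Rightarrow> nat \<Rightarrow> int" where "g a \<equiv> (!) (R ! a)"

text \<open>Membership of u modulo 2 in the row space, with the coefficients taken from the
  information positions instead of an existential quantifier.\<close>

definition mem :: "(nat \<Rightarrow> int) \<Rightarrow> bool" where
  "mem u \<longleftrightarrow> (\<forall>j<n. even (u j - cw (\<lambda>a. u (p ! a)) j))"

definition orth :: "(nat \<Rightarrow> int) \<Rightarrow> bool" where
  "orth v \<longleftrightarrow> (\<forall>a<length R. even (ds (g a) v))"

lemma ds_lin:
  "ds (\<lambda>i. u i + a * v i) w = ds u w + a * ds v w" "ds w (\<lambda>i. u i + a * v i) = ds w u + a * ds w v"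
  by (simp_all add: ds_def algebra_simps sum.distrib sum_distrib_left)

lemma ds_commute: "ds u v = ds v u"
  by (simp add: ds_def mult.commute)

lemma ds_cong: "(\<And>j. j < n \<Longrightarrow> u j = u' j) \<Longrightarrow> (\<And>j. j < n \<Longrightarrow> v j = v' j) \<Longrightarrow> ds u v = ds u' v'"
  by (simp add: ds_def)

lemma ds_cw: "ds (cw \<alpha>) v = (\<Sum>a<length R. \<alpha> a * ds (g a) v)"
proof -
  have "ds (cw \<alpha>) v = (\<Sum>j<n. \<Sum>a<length R. \<alpha> a * (R ! a ! j * v j))"
    by (simp add: ds_def cw_def sum_distrib_right mult.assoc)
  also have "\<dots> = (\<Sum>a<length R. \<alpha> a * ds (g a) v)"
    by (subst sum.swap) (simp add: ds_def sum_distrib_left)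
  finally show ?thesis .
qed

lemma cw_lin: "cw (\<lambda>a. \<alpha> a + c * \<beta> a) j = cw \<alpha> j + c * cw \<beta> j"
  by (simp add: cw_def algebra_simps sum.distrib sum_distrib_left)

lemma mem_lin: "mem u \<Longrightarrow> mem v \<Longrightarrow> mem (\<lambda>j. u j + c * v j)"
proof -
  assume uv: "mem u" "mem v"
  have eq: "(u j + c * v j) - (cw \<alpha> j + c * cw \<beta> j) = (u j - cw \<alpha> j) + c * (v j - cw \<beta> j)" for j \<alpha> \<beta>
    by (simp add: algebra_simps)
  show ?thesis
    using uv unfolding mem_def cw_lin eq by (auto intro: dvd_add dvd_mult)
qed

lemma mem_cong: "mem u \<Longrightarrow> (\<And>j. j < n \<Longrightarrow> u j = v j) \<Longrightarrow> mem v"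
  by (auto simp: mem_def cw_def p)

lemma mem_even: "(\<And>j. j < n \<Longrightarrow> even (u j)) \<Longrightarrow> mem u"
  by (auto simp: mem_def cw_def p intro!: dvd_sum)

lemma mem_g: assumes "a < length R" shows "mem (g a)"
  unfolding mem_def
proof (intro allI impI)
  fix j assume "j < n"
  have "even (g b j * (if a = b then 1 else 0) - g a (p ! b) * g b j)" if "b < length R" for b
    using sys[OF assms that] by (cases "a = b") auto
  then have "even (\<Sum>b<length R. g b j * (if a = b then 1 else 0) - g a (p ! b) * g b j)"
    by (intro dvd_sum) auto
  also have "(\<Sum>b<length R. g b j * (if a = b then 1 else 0) - g a (p ! b) * g b j)
      = g a j - cw (\<lambda>b. g a (p ! b)) j"
    using assms by (simp add: sum_subtractf cw_def mult_if)
  finally show "even (g a j - cw (\<lambda>b. g a (p ! b)) j)" .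
qed

lemma mem_decomposition:
  assumes "mem u"
  shows "\<exists>\<alpha> s. \<forall>j<n. u j = cw \<alpha> j + 2 * s j"
proof (intro exI allI impI)
  fix j assume "j < n"
  then have "even (u j - cw (\<lambda>a. u (p ! a)) j)" using assms by (simp add: mem_def)
  then show "u j = cw (\<lambda>a. u (p ! a)) j + 2 * ((u j - cw (\<lambda>a. u (p ! a)) j) div 2)" by simp
qed

lemma even_ds_if_mem: assumes "mem u" "orth v" shows "even (ds u v)"
proof -
  obtain \<alpha> s where "\<forall>j<n. u j = cw \<alpha> j + 2 * s j" using mem_decomposition[OF assms(1)] by blast
  then have "ds u v = ds (cw \<alpha>) v + 2 * ds s v" unfolding ds_lin(1)[symmetric] by (intro ds_cong) simp_all
  moreover have "even (ds (cw \<alpha>) v)" unfolding ds_cw using assms(2) by (intro dvd_sum) (simp add: orth_def)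
  ultimately show ?thesis by simp
qed

lemma mem_if_dual:
  assumes "\<And>v. orth v \<Longrightarrow> even (ds u v)"
  shows "mem u"
  unfolding mem_def
proof (intro allI impI)
  fix j assume j: "j < n"
  \<comment> \<open>The parity check at position j: modulo 2, pairing with v compares entry j with
    the value predicted by the information positions.\<close>
  define v where "v = (\<lambda>m. (if m = j then 1 else 0) + (\<Sum>b<length R. if m = p ! b then g b j else 0))"
  have ds: "ds w v = w j + (\<Sum>b<length R. g b j * w (p ! b))" for w
  proof -
    have "(\<Sum>m<n. \<Sum>b<length R. w m * (if m = p ! b then g b j else 0))
        = (\<Sum>b<length R. \<Sum>m<n. if m = p ! b then w m * g b j else 0)"
      by (subst sum.swap) (simp add: mult_if)
    also have "\<dots> = (\<Sum>b<length R. g b j * w (p ! b))" by (rule sum.cong) (simp_all add: p)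
    finally show ?thesis
      using j by (simp only: ds_def v_def distrib_left sum.distrib sum_distrib_left) (simp add: mult_if)
  qed
  have "orth v" unfolding orth_def
  proof (intro allI impI)
    fix a assume a: "a < length R"
    have "even (g b j * (if a = b then 1 else 0) + g b j * g a (p ! b))" if "b < length R" for b
      using sys[OF a that] by (cases "a = b") auto
    then have "even (\<Sum>b<length R. g b j * (if a = b then 1 else 0) + g b j * g a (p ! b))"
      by (intro dvd_sum) auto
    then show "even (ds (g a) v)"
      using a by (simp add: ds sum.distrib mult_if)
  qed
  then have "even (u j + (\<Sum>b<length R. g b j * u (p ! b)))" using assms[of v] by (simp add: ds)
  then show "even (u j - cw (\<lambda>a. u (p ! a)) j)" by (simp add: cw_def mult.commute)
qed

lemma card_odd_le: "int (card {j. j < n \<and> odd (u j)}) \<le> ds u u"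
proof -
  have "int (card {j. j < n \<and> odd (u j)}) = (\<Sum>j<n. if odd (u j) then 1 else 0)"
    by (simp add: sum.If_cases Int_def)
  also have "\<dots> \<le> ds u u"
    unfolding ds_def
  proof (rule sum_mono)
    fix j
    have "0 < u j * u j" if "odd (u j)"
      using that zero_less_power2[of "u j"] by (auto simp: power2_eq_square)
    then show "(if odd (u j) then 1 else 0) \<le> u j * u j" by auto
  qed
  finally show ?thesis .
qed

text \<open>Generalised over the accumulator for the induction; the parity of the first coefficient
  selects the branch of \<open>minwt\<close>.\<close>

lemma minwt_combination:
  assumes "minwt t (map (map odd) G) acc" "length acc = n" "\<And>x. x \<in> set G \<Longrightarrow> length x = n"
  shows "(\<forall>j<n. acc ! j \<longleftrightarrow> odd (\<Sum>a<length G. \<alpha> a * G ! a ! j))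
    \<or> t \<le> card {j. j < n \<and> (acc ! j \<noteq> odd (\<Sum>a<length G. \<alpha> a * G ! a ! j))}"
  using assms
proof (induction G arbitrary: acc \<alpha>)
  case Nil
  have "acc = map (\<lambda>j. acc ! j) [0..<n]" using Nil(2) map_nth[of acc] by simp
  then have "wtge t acc \<longleftrightarrow> t \<le> card {j. j < n \<and> acc ! j}" using wtge_map[of t "(!) acc" n] by simp
  then show ?case using Nil by (auto simp: nob_iff in_set_conv_nth split: if_splits)
next
  case (Cons x G)
  define acc' where "acc' = (if odd (\<alpha> 0) then xorl acc (map odd x) else acc)"
  have x: "length x = n" using Cons.prems by simp
  have nth: "acc' ! j = (acc ! j \<noteq> odd (\<alpha> 0 * x ! j))" if "j < n" for j
    using that x Cons.prems(2) by (simp add: acc'_def xorl_nth)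
  have "minwt t (map (map odd) G) acc'" "length acc' = n"
    using Cons.prems x by (simp_all add: acc'_def xorl_nth)
  note IH = Cons.IH[OF this, of "\<lambda>a. \<alpha> (Suc a)"]
  have eq: "(acc ! j \<noteq> odd (\<Sum>a<length (x # G). \<alpha> a * (x # G) ! a ! j))
      = (acc' ! j \<noteq> odd (\<Sum>a<length G. \<alpha> (Suc a) * G ! a ! j))" if "j < n" for j
    unfolding nth[OF that] length_Cons sum.lessThan_Suc_shift nth_Cons_0 nth_Cons_Suc even_add by blast
  have "{j. j < n \<and> (acc ! j \<noteq> odd (\<Sum>a<length (x # G). \<alpha> a * (x # G) ! a ! j))}
      = {j. j < n \<and> (acc' ! j \<noteq> odd (\<Sum>a<length G. \<alpha> (Suc a) * G ! a ! j))}"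
    using eq by blast
  then show ?case using IH eq Cons.prems(3) by auto
qed

lemma mem_weight:
  assumes "minwt t (map (map odd) R) (replicate n False)" "mem u" "j < n" "odd (u j)"
  shows "t \<le> card {j. j < n \<and> odd (u j)}"
proof -
  have "odd (u j) \<longleftrightarrow> odd (\<Sum>a<length R. u (p ! a) * R ! a ! j)" if "j < n" for j
    using assms(2) that by (simp add: mem_def cw_def)
  then have odd: "odd (u j) \<longleftrightarrow> (replicate n False ! j \<noteq> odd (\<Sum>a<length R. u (p ! a) * R ! a ! j))" if "j < n" for j
    using that by simp
  have len': "length x = n" if "x \<in> set R" for x using that len by (auto simp: in_set_conv_nth)
  have "{j. j < n \<and> (replicate n False ! j \<noteq> odd (\<Sum>a<length R. u (p ! a) * R ! a ! j))} = {j. j < n \<and> odd (u j)}"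
    using odd by blast
  with minwt_combination[OF assms(1) _ len', of "\<lambda>a. u (p ! a)"] show ?thesis
    using odd[OF assms(3)] assms(3,4) by auto
qed

lemma even_sum_if_orth: assumes "orth v" shows "even (\<Sum>j<n. v j)"
proof -
  have "even (ds (cw (\<lambda>a. 1)) v)" unfolding ds_cw using assms by (intro dvd_sum) (simp add: orth_def)
  moreover have "even (cw (\<lambda>a. 1) j * v j - v j)" if "j < n" for j
    using ones[OF that] by (simp add: cw_def)
  then have "even (ds (cw (\<lambda>a. 1)) v - (\<Sum>j<n. v j))"
    unfolding ds_def sum_subtractf[symmetric] by (intro dvd_sum) auto
  ultimately show ?thesis by simp
qed

lemma even_ds_self: assumes "orth v" shows "even (ds v v)"
proof -
  have "even (v j * v j - v j)" for j by simp
  then have "even (ds v v - (\<Sum>j<n. v j))"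
    unfolding ds_def sum_subtractf[symmetric] by (intro dvd_sum) auto
  then show ?thesis using even_sum_if_orth[OF assms] by simp
qed

text \<open>When rows are added one at a time, cross terms come with a factor 2, so orthogonality
  modulo 2m suffices. The uses are m = 1 over \<int>/2 and m = 2 over \<int>/4.\<close>

lemma ds_cw_self:
  assumes "\<And>a b. a < length R \<Longrightarrow> b < length R \<Longrightarrow> 2 * m dvd ds (g a) (g b)"
    "\<And>a. a < length R \<Longrightarrow> 4 * m dvd ds (g a) (g a)"
  shows "4 * m dvd ds (cw \<alpha>) (cw \<alpha>)"
proof -
  define c where "c = (\<lambda>r j. \<Sum>a<r. \<alpha> a * R ! a ! j)"
  have "r \<le> length R \<Longrightarrow> 4 * m dvd ds (c r) (c r)
      \<and> (\<forall>b<length R. 2 * m dvd ds (c r) (g b))" for r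
  proof (induction r)
    case 0
    show ?case by (simp add: c_def ds_def)
  next
    case (Suc r)
    have c: "c (Suc r) = (\<lambda>j. c r j + \<alpha> r * g r j)" by (simp add: c_def)
    have sq: "ds (c (Suc r)) (c (Suc r)) = ds (c r) (c r) + \<alpha> r * (2 * ds (c r) (g r)) + \<alpha> r * \<alpha> r * ds (g r) (g r)"
      unfolding c ds_lin by (simp add: ds_commute[of "g r" "c r"] algebra_simps)
    have "2 * m dvd ds (c r) (g r)" using Suc by simp
    then have "4 * m dvd 2 * ds (c r) (g r)" using mult_dvd_mono[OF dvd_refl[of 2]] by fastforce
    then have "4 * m dvd \<alpha> r * (2 * ds (c r) (g r))" by (rule dvd_mult)
    moreover have "4 * m dvd ds (c r) (c r)" "4 * m dvd \<alpha> r * \<alpha> r * ds (g r) (g r)"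
      using Suc assms(2)[of r] by simp_all
    ultimately have "4 * m dvd ds (c (Suc r)) (c (Suc r))" unfolding sq by (intro dvd_add)
    moreover have "2 * m dvd ds (c (Suc r)) (g b)" if "b < length R" for b
      unfolding c ds_lin by (intro dvd_add dvd_mult) (use Suc that assms(1)[of r b] in simp_all)
    ultimately show ?case by blast
  qed
  moreover have "cw \<alpha> = c (length R)" by (simp add: cw_def c_def fun_eq_iff)
  ultimately show ?thesis by simp
qed

text \<open>The all-ones word makes dual words even, so only weights 2 and 4 must be excluded.
  Weight 4 means four columns with sum zero, hence two pairs of columns with equal sums. Weight 2
  means two equal columns, and adding a third column to both again gives two such pairs.\<close>

lemma orth_weight:
  assumes col: "\<And>j a. j < n \<Longrightarrow> a < length R \<Longrightarrow> cols ! j ! a \<longleftrightarrow> odd (g a j)"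
    and cols: "length cols = n" "\<And>j. j < n \<Longrightarrow> length (cols ! j) = length R"
    and dist: "radix_distinct (length R) (pair_sums cols)"
    and v: "orth v" "i0 < n" "odd (v i0)" and n: "4 \<le> n"
  shows "6 \<le> card {j. j < n \<and> odd (v j)}"
proof (rule ccontr)
  assume less: "\<not> 6 \<le> card {j. j < n \<and> odd (v j)}"
  define S where "S = {j. j < n \<and> odd (v j)}"
  have S: "finite S" "S \<noteq> {}" using v by (auto simp: S_def)
  have sumS: "even (\<Sum>j<n. f j * v j) \<longleftrightarrow> even (\<Sum>j\<in>S. f j)" for f
  proof -
    have "(\<Sum>j<n. f j * v j) = (\<Sum>j\<in>S. f j * v j) + (\<Sum>j\<in>{..<n} - S. f j * v j)"
      by (subst add.commute, rule sum.subset_diff) (auto simp: S_def)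
    moreover have "even (\<Sum>j\<in>{..<n} - S. f j * v j)" by (rule dvd_sum) (auto simp: S_def)
    moreover have "even (\<Sum>j\<in>S. f j * v j - f j)" by (rule dvd_sum) (auto simp: S_def)
    ultimately show ?thesis by (simp add: sum_subtractf)
  qed
  have "even (\<Sum>j<n. 1 * v j)" using even_sum_if_orth[OF v(1)] by simp
  then have "even (card S)" unfolding sumS by simp
  moreover have "card S \<noteq> 0" "card S < 6" using S less by (simp_all add: S_def)
  ultimately have card: "card S = 2 \<or> card S = 4" by presburger
  have rows: "even (\<Sum>j\<in>S. g a j)" if "a < length R" for a
    using v(1) that unfolding sumS[symmetric] by (simp add: orth_def ds_def)
  have d: "distinct (pair_sums cols)"
    by (rule distinct_if_radix_distinct[OF dist]) (auto simp: pair_sums_iff xorl_nth cols)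
  have comm: "xorl (cols ! i) (cols ! j) = xorl (cols ! j) (cols ! i)" if "i < n" "j < n" for i j
    using that by (auto simp: xorl_eq_map[of _ "length R"] cols)
  have inj: "{i, j} = {k, l}" if "i < n" "j < n" "k < n" "l < n" "i \<noteq> j" "k \<noteq> l"
      "xorl (cols ! i) (cols ! j) = xorl (cols ! k) (cols ! l)" for i j k l
    using that(5,6) pair_sums_inj[OF d, of i j k l] pair_sums_inj[OF d, of j i k l]
      pair_sums_inj[OF d, of i j l k] pair_sums_inj[OF d, of j i l k]
      that comm[of i j] comm[of k l] unfolding cols(1) nat_neq_iff by (elim disjE) auto
  from card show False
  proof
    assume "card S = 2"
    then obtain i j where ij: "S = {i, j}" "i \<noteq> j" by (auto simp: card_2_iff)
    then have lt: "i < n" "j < n" by (auto simp: S_def)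
    have "cols ! i = cols ! j"
    proof (rule nth_equalityI)
      fix a assume "a < length (cols ! i)"
      then have "a < length R" by (simp add: cols lt)
      then show "cols ! i ! a = cols ! j ! a" using rows[of a] ij lt by (simp add: col)
    qed (simp add: cols lt)
    moreover have "\<exists>k<4. k \<noteq> i \<and> k \<noteq> j"
      by (rule ccontr) (use ij in \<open>auto simp: All_less_Suc2 eval_nat_numeral\<close>)
    then obtain k where "k < n" "k \<noteq> i" "k \<noteq> j" using n less_le_trans by blast
    ultimately show False using inj[of i k j k] lt ij(2) by auto
  next
    assume "card S = 4"
    then obtain i j k l where ij: "S = {i, j, k, l}" "i \<noteq> j" "i \<noteq> k" "i \<noteq> l" "j \<noteq> k" "j \<noteq> l" "k \<noteq> l"
      by (auto simp: eval_nat_numeral card_Suc_eq)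
    then have lt: "i < n" "j < n" "k < n" "l < n" by (auto simp: S_def)
    have "even (g a i + (g a j + (g a k + g a l)))" if "a < length R" for a
      using rows[OF that] ij by simp
    then have "xorl (cols ! i) (cols ! j) = xorl (cols ! k) (cols ! l)"
      using lt by (auto simp: xorl_eq_map[of _ "length R"] cols col)
    then show False using inj[of i j k l] lt ij by (auto simp: doubleton_eq_iff)
  qed
qed

end

section \<open>The generator matrices of length 32 and 64\<close>

fun dotl :: "int list \<Rightarrow> int list \<Rightarrow> int" where
  "dotl (x # xs) (y # ys) = x * y + dotl xs ys"
| "dotl xs ys = 0"

fun addl :: "int list \<Rightarrow> int list \<Rightarrow> int list" where
  "addl (x # xs) (y # ys) = (x + y) # addl xs ys"
| "addl xs ys = []"

fun zipc :: "bool list \<Rightarrow> bool list list \<Rightarrow> bool list list" where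
  "zipc (x # xs) (y # ys) = (x # y) # zipc xs ys"
| "zipc xs ys = []"

lemma dotl_eq: "length x = length y \<Longrightarrow> dotl x y = (\<Sum>j<length x. x ! j * y ! j)"
  by (induction x y rule: dotl.induct) (simp_all add: sum.lessThan_Suc_shift del: sum.lessThan_Suc)

lemma addl_nth:
  "length x = length y \<Longrightarrow> length (addl x y) = length y"
  "length x = length y \<Longrightarrow> j < length y \<Longrightarrow> addl x y ! j = x ! j + y ! j"
proof -
  show "length x = length y \<Longrightarrow> length (addl x y) = length y" by (induction x y rule: addl.induct) auto
  show "length x = length y \<Longrightarrow> j < length y \<Longrightarrow> addl x y ! j = x ! j + y ! j"
    by (induction x y arbitrary: j rule: addl.induct) (auto simp: nth_Cons split: nat.splits)
qed

lemma zipc_nth: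
  "length x = length y \<Longrightarrow> length (zipc x y) = length y"
  "length x = length y \<Longrightarrow> j < length y \<Longrightarrow> zipc x y ! j = x ! j # y ! j"
proof -
  show "length x = length y \<Longrightarrow> length (zipc x y) = length y" by (induction x y rule: zipc.induct) auto
  show "length x = length y \<Longrightarrow> j < length y \<Longrightarrow> zipc x y ! j = x ! j # y ! j"
    by (induction x y arbitrary: j rule: zipc.induct) (auto simp: nth_Cons split: nat.splits)
qed

lemma foldr_addl_nth:
  assumes "\<And>x. x \<in> set R \<Longrightarrow> length x = n"
  shows "length (foldr addl R (replicate n 0)) = n
    \<and> (\<forall>j<n. foldr addl R (replicate n 0) ! j = (\<Sum>a<length R. R ! a ! j))"
  using assms by (induction R) (simp_all add: addl_nth sum.lessThan_Suc_shift del: sum.lessThan_Suc)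

lemma foldr_zipc_nth:
  assumes "\<And>x. x \<in> set B \<Longrightarrow> length x = n"
  shows "length (foldr zipc B (replicate n [])) = n
    \<and> (\<forall>j<n. foldr zipc B (replicate n []) ! j = map (\<lambda>x. x ! j) B)"
  using assms by (induction B) (simp_all add: zipc_nth)

text \<open>Turns the locale assumptions into closed statements about lists that the simplifier can
  evaluate.\<close>

lemma systematic_codeI:
  assumes len: "list_all (\<lambda>x. length x = n) R" and p: "list_all (\<lambda>i. i < n) p" "length p = length R"
    and sys: "map (\<lambda>x. map (\<lambda>i. odd (x ! i)) p) R = map (\<lambda>a. map (\<lambda>b. a = b) [0..<length R]) [0..<length R]"
    and ones: "list_all odd (foldr addl R (replicate n 0))"
  shows "systematic_code R n p"
proof
  show "length (R ! a) = n" if "a < length R" for a using len that by (simp add: list_all_length)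
  show "p ! a < n" if "a < length R" for a using p that by (simp add: list_all_length)
  show "odd (R ! a ! (p ! b)) \<longleftrightarrow> a = b" if ab: "a < length R" "b < length R" for a b
  proof -
    have "map (\<lambda>x. map (\<lambda>i. odd (x ! i)) p) R ! a ! b = (a = b)" unfolding sys using ab by simp
    then show ?thesis using ab p(2) by simp
  qed
  have "length x = n" if "x \<in> set R" for x using len that by (simp add: list_all_iff)
  from foldr_addl_nth[of R n, OF this] show "odd (\<Sum>a<length R. R ! a ! j)" if "j < n" for j
    using ones that by (auto simp: list_all_length)
qed

lemma odd_literals: "odd (0 :: int) = False" "odd (1 :: int) = True" "odd (2 :: int) = False"
  by simp_all

context systematic_code
begin

lemma ds_dotl: "a < length R \<Longrightarrow> b < length R \<Longrightarrow> ds (g a) (g b) = dotl (R ! a) (R ! b)"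
  by (simp add: ds_def dotl_eq len)

lemma orth_weight_columns:
  assumes dist: "radix_distinct (length R) (pair_sums (foldr zipc (map (map odd) R) (replicate n [])))"
    and v: "orth v" "i0 < n" "odd (v i0)" and n: "4 \<le> n"
  shows "6 \<le> card {j. j < n \<and> odd (v j)}"
proof -
  define cols where "cols = foldr zipc (map (map odd) R) (replicate n [])"
  have "length x = n" if "x \<in> set (map (map odd) R)" for x
    using that len by (auto simp: in_set_conv_nth)
  from foldr_zipc_nth[of "map (map odd) R" n, OF this]
  have "length cols = n" "\<And>j. j < n \<Longrightarrow> cols ! j = map (\<lambda>x. x ! j) (map (map odd) R)"
    by (simp_all add: cols_def)
  then show ?thesis
    by (intro orth_weight[where cols = cols and ?i0.0 = i0] v n) (simp_all add: len dist[folded cols_def])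
qed

end

definition R32 :: "int list list" where
  "R32 = [
    [1, 0, 0, 0, 0, 0, 0, 1, 0, 0, 0, 1, 0, 1, 1, 1, 0, 0, 0, 1, 0, 1, 1, 1, 1, 0, 0, 0, 0, 0, 0, 1],
    [0, 1, 0, 0, 0, 0, 0, 1, 0, 0, 0, 1, 0, 1, 0, 0, 0, 1, 1, 1, 1, 1, 0, 1, 0, 0, 1, 0, 1, 0, 0, 0],
    [0, 0, 1, 0, 0, 0, 0, 1, 0, 0, 1, 0, 0, 0, 0, 1, 0, 1, 0, 0, 0, 1, 1, 1, 0, 1, 0, 0, 0, 1, 1, 1],
    [0, 0, 0, 1, 0, 0, 0, 1, 0, 0, 1, 0, 0, 0, 1, 0, 0, 1, 1, 1, 1, 0, 0, 0, 0, 1, 0, 0, 1, 0, 1, 1],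
    [0, 0, 0, 0, 1, 0, 0, 1, 0, 0, 1, 1, 0, 1, 0, 1, 0, 1, 1, 0, 0, 0, 0, 0, 1, 0, 1, 0, 0, 0, 1, 1],
    [0, 0, 0, 0, 0, 1, 0, 1, 0, 0, 0, 0, 0, 1, 0, 1, 0, 0, 1, 1, 1, 0, 0, 1, 1, 1, 0, 0, 0, 1, 1, 0],
    [0, 0, 0, 0, 0, 0, 1, 1, 0, 0, 1, 1, 0, 0, 0, 0, 0, 0, 0, 0, 1, 1, 0, 0, 0, 0, 1, 1, 1, 1, 1, 1],
    [0, 0, 0, 0, 0, 0, 0, 0, 1, 0, 0, 1, 0, 1, 1, 0, 0, 0, 1, 1, 0, 0, 1, 1, 0, 1, 0, 1, 1, 0, 1, 0],
    [0, 0, 0, 0, 0, 0, 0, 0, 0, 1, 1, 0, 0, 1, 1, 0, 0, 1, 1, 0, 1, 0, 0, 1, 1, 1, 1, 1, 0, 0, 0, 0],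
    [0, 0, 0, 0, 0, 0, 0, 0, 0, 0, 0, 0, 1, 1, 1, 1, 0, 1, 0, 1, 1, 0, 1, 0, 0, 1, 0, 1, 0, 1, 0, 1],
    [0, 0, 0, 0, 0, 0, 0, 0, 0, 0, 0, 0, 0, 0, 0, 0, 1, 1, 1, 1, 1, 1, 1, 1, 1, 1, 1, 1, 1, 1, 1, 1]]"

definition p32 :: "nat list" where
  "p32 = [0, 1, 2, 3, 4, 5, 6, 8, 9, 12, 16]"

lemma replicate_32: "replicate 32 x =
  [x, x, x, x, x, x, x, x, x, x, x, x, x, x, x, x, x, x, x, x, x, x, x, x, x, x, x, x, x, x, x, x]"
  by (simp add: eval_nat_numeral)

lemma length_R32: "length R32 = 11"
  by (simp add: R32_def)

interpretation c32: systematic_code R32 32 p32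
proof (rule systematic_codeI)
  show "list_all (\<lambda>x. length x = 32) R32" by (simp add: R32_def)
  show "list_all (\<lambda>i. i < 32) p32" "length p32 = length R32" by (simp_all add: R32_def p32_def)
  show "map (\<lambda>x. map (\<lambda>i. odd (x ! i)) p32) R32 = map (\<lambda>a. map (\<lambda>b. a = b) [0..<length R32]) [0..<length R32]"
    unfolding length_R32 unfolding R32_def p32_def by (simp add: upt_rec)
  show "list_all odd (foldr addl R32 (replicate 32 0))"
    unfolding replicate_32 R32_def by simp
qed

lemma minwt32: "minwt 12 (map (map odd) R32) (replicate 32 False)"
proof -
  \<comment> \<open>The unary form is the one on which \<open>wtge\<close> recurses.\<close>
  have "12 = (Suc (Suc (Suc (Suc (Suc (Suc (Suc (Suc (Suc (Suc (Suc (Suc 0))))))))))))" by simp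
  then show ?thesis
    unfolding R32_def replicate_32
    by (simp only: list.map odd_literals minwt.simps xorl.simps wtge.simps nob.simps simp_thms if_True if_False cong: if_weak_cong)
qed

lemma columns32: "radix_distinct (length R32) (pair_sums (foldr zipc (map (map odd) R32) (replicate 32 [])))"
proof -
  have "length R32 = (Suc (Suc (Suc (Suc (Suc (Suc (Suc (Suc (Suc (Suc (Suc 0)))))))))))" by (simp add: length_R32)
  show ?thesis
    unfolding \<open>length R32 = (Suc (Suc (Suc (Suc (Suc (Suc (Suc (Suc (Suc (Suc (Suc 0)))))))))))\<close> unfolding R32_def replicate_32
    by (simp only: odd_literals foldr.simps comp_apply id_apply zipc.simps pair_sums.simps list.map append.simps xorl.simps
        tails.simps radix_distinct.simps simp_thms)
qed

lemma dotl32: "list_all (\<lambda>x. list_all (\<lambda>y. 2 dvd dotl x y) R32) R32" "list_all (\<lambda>x. 4 dvd dotl x x) R32"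
  unfolding R32_def by (simp_all only: list.pred_inject dotl.simps) simp_all

lemma ds32: "a < length R32 \<Longrightarrow> b < length R32 \<Longrightarrow> 2 dvd c32.ds (c32.g a) (c32.g b)"
  "a < length R32 \<Longrightarrow> 4 dvd c32.ds (c32.g a) (c32.g a)"
  using dotl32 by (simp_all add: list_all_length c32.ds_dotl)

definition R64 :: "int list list" where
  "R64 = [
    [1, 0, 0, 0, 0, 0, 0, 1, 0, 0, 0, 1, 0, 1, 1, 1, 0, 0, 1, 0, 0, 1, 0, 0, 1, 0, 1, 1, 0, 0, 1, 0, 0, 0, 1, 0, 0, 1,
     0, 0, 1, 0, 1, 1, 0, 0, 1, 0, 1, 0, 0, 0, 0, 0, 0, 1, 0, 0, 0, 1, 0, 1, 1, 1],
    [2, 1, 0, 0, 0, 0, 2, 1, 0, 0, 0, 1, 0, 1, 0, 0, 0, 1, 0, 0, 1, 1, 1, 0, 1, 1, 1, 0, 0, 1, 0, 0, 0, 0, 0, 1, 1, 0,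
     1, 1, 1, 0, 1, 1, 0, 0, 0, 1, 1, 1, 1, 0, 1, 0, 1, 1, 1, 0, 1, 1, 1, 1, 1, 0],
    [2, 0, 1, 0, 0, 0, 0, 1, 0, 0, 0, 1, 0, 0, 1, 0, 0, 0, 0, 1, 0, 0, 1, 0, 1, 1, 0, 1, 1, 1, 1, 0, 0, 1, 0, 0, 0, 1,
     1, 1, 0, 1, 1, 1, 0, 1, 0, 0, 0, 1, 1, 1, 0, 1, 0, 0, 1, 0, 1, 1, 1, 0, 0, 0],
    [2, 0, 0, 1, 0, 0, 0, 1, 0, 0, 0, 1, 0, 0, 0, 1, 0, 0, 1, 0, 1, 1, 0, 1, 1, 1, 0, 1, 0, 0, 1, 0, 0, 1, 0, 0, 0, 1,
     0, 0, 1, 0, 1, 1, 1, 0, 1, 1, 0, 1, 1, 1, 1, 0, 0, 0, 0, 1, 1, 1, 1, 0, 0, 0],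
    [0, 2, 2, 2, 1, 0, 0, 1, 0, 0, 0, 0, 0, 1, 1, 0, 0, 0, 1, 1, 1, 0, 1, 0, 0, 0, 1, 1, 0, 1, 0, 1, 0, 1, 1, 0, 0, 0,
     0, 0, 0, 1, 1, 0, 1, 1, 1, 1, 0, 1, 0, 1, 0, 0, 1, 1, 0, 1, 0, 1, 1, 1, 0, 0],
    [2, 0, 0, 0, 0, 1, 0, 1, 0, 0, 0, 0, 0, 1, 0, 1, 0, 0, 0, 0, 0, 1, 0, 1, 1, 1, 1, 1, 1, 0, 1, 0, 0, 0, 1, 1, 0, 1,
     1, 0, 1, 1, 0, 0, 1, 0, 0, 1, 1, 1, 0, 0, 1, 0, 0, 1, 1, 1, 0, 0, 1, 0, 0, 1],
    [0, 0, 2, 2, 0, 2, 1, 1, 0, 0, 0, 0, 0, 0, 1, 1, 0, 1, 1, 0, 1, 0, 1, 0, 0, 1, 1, 0, 1, 0, 1, 0, 0, 1, 1, 0, 1, 0,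
     1, 0, 1, 0, 0, 1, 0, 1, 0, 1, 0, 0, 0, 0, 0, 0, 1, 1, 1, 1, 1, 1, 1, 1, 0, 0],
    [0, 0, 0, 2, 2, 2, 0, 0, 1, 0, 0, 1, 0, 1, 1, 0, 0, 0, 0, 0, 1, 1, 1, 1, 1, 0, 0, 1, 1, 0, 0, 1, 0, 1, 0, 1, 0, 1,
     0, 1, 0, 0, 1, 1, 1, 1, 0, 0, 1, 0, 1, 0, 0, 1, 0, 1, 1, 1, 0, 0, 1, 1, 0, 0],
    [2, 2, 0, 2, 2, 2, 2, 0, 0, 1, 0, 1, 2, 1, 0, 1, 0, 0, 1, 1, 0, 0, 1, 1, 1, 0, 0, 1, 1, 0, 0, 1, 0, 0, 1, 1, 1, 1,
     0, 0, 1, 0, 0, 1, 0, 1, 1, 0, 0, 0, 0, 0, 1, 1, 1, 1, 0, 1, 0, 1, 1, 0, 1, 0],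
    [2, 0, 2, 2, 2, 0, 0, 0, 2, 0, 1, 1, 0, 0, 1, 1, 0, 1, 1, 0, 0, 1, 1, 0, 0, 1, 0, 1, 0, 1, 0, 1, 0, 1, 0, 1, 1, 0,
     1, 0, 0, 1, 1, 0, 1, 0, 0, 1, 0, 0, 1, 1, 1, 1, 0, 0, 0, 0, 0, 0, 1, 1, 1, 1],
    [0, 0, 2, 2, 2, 0, 0, 0, 0, 0, 0, 0, 1, 1, 1, 1, 0, 1, 0, 1, 1, 0, 1, 0, 1, 0, 1, 0, 1, 0, 1, 0, 0, 0, 1, 1, 0, 0,
     1, 1, 0, 0, 1, 1, 1, 1, 0, 0, 1, 0, 0, 1, 0, 1, 1, 0, 0, 1, 1, 0, 0, 1, 1, 0],
    [0, 0, 0, 0, 0, 0, 0, 0, 0, 0, 0, 0, 0, 0, 0, 0, 1, 1, 1, 1, 1, 1, 1, 1, 1, 1, 1, 1, 1, 1, 1, 1, 0, 0, 0, 0, 0, 0,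
     0, 0, 0, 0, 0, 0, 0, 0, 0, 0, 1, 1, 1, 1, 1, 1, 1, 1, 1, 1, 1, 1, 1, 1, 1, 1],
    [0, 0, 0, 0, 0, 0, 0, 0, 0, 0, 0, 0, 0, 0, 0, 0, 0, 0, 0, 0, 0, 0, 0, 0, 0, 0, 0, 0, 0, 0, 0, 0, 1, 1, 1, 1, 1, 1,
     1, 1, 1, 1, 1, 1, 1, 1, 1, 1, 1, 1, 1, 1, 1, 1, 1, 1, 1, 1, 1, 1, 1, 1, 1, 1]]"

definition p64 :: "nat list" where
  "p64 = [0, 1, 2, 3, 4, 5, 6, 8, 9, 10, 12, 16, 32]"

lemma replicate_64: "replicate 64 x =
  [x, x, x, x, x, x, x, x, x, x, x, x, x, x, x, x, x, x, x, x, x, x, x, x, x, x, x, x, x, x, x, x, x, x, x, x, x, x,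
   x, x, x, x, x, x, x, x, x, x, x, x, x, x, x, x, x, x, x, x, x, x, x, x, x, x]"
  by (simp add: eval_nat_numeral)

lemma length_R64: "length R64 = 13"
  by (simp add: R64_def)

interpretation c64: systematic_code R64 64 p64
proof (rule systematic_codeI)
  show "list_all (\<lambda>x. length x = 64) R64" by (simp add: R64_def)
  show "list_all (\<lambda>i. i < 64) p64" "length p64 = length R64" by (simp_all add: R64_def p64_def)
  show "map (\<lambda>x. map (\<lambda>i. odd (x ! i)) p64) R64 = map (\<lambda>a. map (\<lambda>b. a = b) [0..<length R64]) [0..<length R64]"
    unfolding length_R64 unfolding R64_def p64_def by (simp add: upt_rec)
  show "list_all odd (foldr addl R64 (replicate 64 0))"
    unfolding replicate_64 R64_def by simp
qed

lemma minwt64: "minwt 24 (map (map odd) R64) (replicate 64 False)"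
proof -
  have "24 = (Suc (Suc (Suc (Suc (Suc (Suc (Suc (Suc (Suc (Suc (Suc (Suc (Suc (Suc (Suc (Suc (Suc (Suc (Suc (Suc (Suc (Suc (Suc (Suc 0))))))))))))))))))))))))" by simp
  then show ?thesis
    unfolding R64_def replicate_64
    by (simp only: list.map odd_literals minwt.simps xorl.simps wtge.simps nob.simps simp_thms if_True if_False cong: if_weak_cong)
qed

lemma columns64: "radix_distinct (length R64) (pair_sums (foldr zipc (map (map odd) R64) (replicate 64 [])))"
proof -
  have "length R64 = (Suc (Suc (Suc (Suc (Suc (Suc (Suc (Suc (Suc (Suc (Suc (Suc (Suc 0)))))))))))))" by (simp add: length_R64)
  show ?thesis
    unfolding \<open>length R64 = (Suc (Suc (Suc (Suc (Suc (Suc (Suc (Suc (Suc (Suc (Suc (Suc (Suc 0)))))))))))))\<close> unfolding R64_def replicate_64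
    by (simp only: odd_literals foldr.simps comp_apply id_apply zipc.simps pair_sums.simps list.map append.simps xorl.simps
        tails.simps radix_distinct.simps simp_thms)
qed

lemma dotl64: "list_all (\<lambda>x. list_all (\<lambda>y. 4 dvd dotl x y) R64) R64" "list_all (\<lambda>x. 8 dvd dotl x x) R64"
  unfolding R64_def by (simp_all only: list.pred_inject dotl.simps) simp_all

lemma ds64: "a < length R64 \<Longrightarrow> b < length R64 \<Longrightarrow> 4 dvd c64.ds (c64.g a) (c64.g b)"
  "a < length R64 \<Longrightarrow> 8 dvd c64.ds (c64.g a) (c64.g a)"
  using dotl64 by (simp_all add: list_all_length c64.ds_dotl)

context systematic_code
begin

lemma ds_scale: "ds (\<lambda>i. a * u i) w = a * ds u w" "ds w (\<lambda>i. a * u i) = a * ds w u"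
  by (simp_all add: ds_def algebra_simps sum_distrib_left)

lemma orth_g_if_mem:
  assumes "mem u" "\<And>a b. a < length R \<Longrightarrow> b < length R \<Longrightarrow> even (ds (g a) (g b))"
  shows "orth u"
  unfolding orth_def
proof (intro allI impI)
  fix a assume "a < length R"
  then have "orth (g a)" using assms(2) by (simp add: orth_def)
  then show "even (ds (g a) u)" using even_ds_if_mem[OF assms(1), of "g a"] by (simp add: ds_commute[of u])
qed

end

text \<open>For a doubly even code \<open>D\<close> of length 32 containing the all-ones word, the words \<open>(x, y)\<close> with
  \<open>x + y \<in> D\<close> and \<open>x \<in> D\<^sup>\<bottom>\<close> form a doubly even self-dual code of length 64. Its minimum weight is at
  least the minimum weight of \<open>D\<close> and twice that of \<open>D\<^sup>\<bottom>\<close>. Here \<open>D\<close> is the extended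
  dual BCH code \<open>[32,11,12]\<close>.\<close>

lemma dot_split: "dot u v = c32.ds u v + c32.ds (\<lambda>j. u (32 + j)) (\<lambda>j. v (32 + j))"
proof -
  have "(\<Sum>i<n + m. f i) = (\<Sum>i<n. f i) + (\<Sum>j<m. f (n + j))" for n m and f :: "nat \<Rightarrow> int"
    by (induction m) (simp_all add: add.assoc)
  from this[of "\<lambda>i. u i * v i" 32 32] show ?thesis by (simp add: dot_def c32.ds_def)
qed

lemma extremal_typeII_1: "\<exists>C. extremal_typeII 1 64 C"
proof -
  \<comment> \<open>The factor 1 makes \<open>S u\<close> an instance of the left-hand side in
    \<open>c32.ds_lin\<close>.\<close>
  define S where "S = (\<lambda>(u :: nat \<Rightarrow> int) (j :: nat). u j + 1 * u (32 + j))"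
  define I where "I = (\<lambda>u. c32.mem (S u) \<and> c32.orth u)"
  have ds_even: "even (c32.ds (c32.g a) (c32.g b))" if "a < length R32" "b < length R32" for a b
    using ds32(1)[OF that] .
  \<comment> \<open>Substitutes y = S u - x for the second half, so that only x and S u occur, the
    data in which \<open>I\<close> is phrased.\<close>
  have dot: "dot u v = 2 * c32.ds u v + c32.ds (S u) (S v) - c32.ds (S u) v - c32.ds u (S v)" for u v
    unfolding dot_split S_def c32.ds_lin by (simp add: c32.ds_commute)
  have IS: "c32.orth (S u)" if "I u" for u
    using c32.orth_g_if_mem[OF _ ds_even] that by (simp add: I_def)
  have S_lin: "S (\<lambda>i. u i + a * v i) = (\<lambda>j. S u j + a * S v j)" for u v a
    by (simp add: S_def fun_eq_iff algebra_simps)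
  have weight: "int (card {j. j < 32 \<and> P j}) \<le> dot u u"
    if "\<And>j. j < 32 \<Longrightarrow> P j \<Longrightarrow> odd (S u j)" for P u
  proof -
    have "{j. j < 32 \<and> P j} \<subseteq> {j. j < 32 \<and> odd (u j)} \<union> {j. j < 32 \<and> odd (u (32 + j))}"
      using that by (auto simp: S_def)
    then have "card {j. j < 32 \<and> P j} \<le> card ({j. j < 32 \<and> odd (u j)} \<union> {j. j < 32 \<and> odd (u (32 + j))})"
      by (intro card_mono) auto
    also have "\<dots> \<le> card {j. j < 32 \<and> odd (u j)} + card {j. j < 32 \<and> odd (u (32 + j))}"
      by (rule card_Un_le)
    finally show ?thesis
      using c32.card_odd_le[of u] c32.card_odd_le[of "\<lambda>j. u (32 + j)"] unfolding dot_split by linarith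
  qed
  \<comment> \<open>The word (g, 0) with g the first row, of weight 12; it is a codeword because the
    code spanned by the rows is self-orthogonal.\<close>
  define u0 where "u0 = (\<lambda>i. if i < 32 then c32.g 0 i else 0)"
  show ?thesis
  proof (rule extremal_typeII_if_representatives[where I = I and ?u0.0 = u0 and ?i0.0 = 0])
    show "(0 :: nat) < 1" by simp
    show "I v" if "I u" "\<And>i. i < 64 \<Longrightarrow> u i = v i" for u v
    proof -
      have "c32.ds w u = c32.ds w v" for w by (rule c32.ds_cong) (simp_all add: that(2))
      moreover have "c32.mem (S v)"
        by (rule c32.mem_cong[of "S u"]) (use that in \<open>simp_all add: I_def S_def\<close>)
      ultimately show ?thesis using that(1) by (simp add: I_def c32.orth_def)
    qed
    show "I (\<lambda>i. u i + a * v i)" if "I u" "I v" for u v a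
      using that by (auto simp: I_def S_lin c32.orth_def c32.ds_lin intro: c32.mem_lin)
    show "I (\<lambda>i. 2 * int 1 * t i)" for t
      by (auto simp: I_def S_def c32.orth_def c32.ds_scale intro!: c32.mem_even)
    show "2 * int 1 dvd dot u v" if uv: "I u" "I v" for u v
    proof -
      have "even (c32.ds (S u) (S v))" "even (c32.ds (S u) v)" "even (c32.ds (S v) u)"
        by (rule c32.even_ds_if_mem; use uv IS in \<open>simp add: I_def\<close>)+
      then show ?thesis unfolding dot by (simp add: c32.ds_commute[of u "S v"])
    qed
    show "4 * int 1 dvd dot u u" if u: "I u" for u
    proof -
      obtain \<alpha> s where s: "\<forall>j<32. S u j = c32.cw \<alpha> j + 2 * s j"
        using c32.mem_decomposition[of "S u"] u by (auto simp: I_def)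
      have "c32.ds (S u) (S u) = c32.ds (\<lambda>j. c32.cw \<alpha> j + 2 * s j) (\<lambda>j. c32.cw \<alpha> j + 2 * s j)"
        by (rule c32.ds_cong) (simp_all add: s)
      also have "\<dots> = c32.ds (c32.cw \<alpha>) (c32.cw \<alpha>) + 4 * (c32.ds s (c32.cw \<alpha>) + c32.ds s s)"
        unfolding c32.ds_lin by (simp add: c32.ds_commute[of "c32.cw \<alpha>" s])
      finally have "4 dvd c32.ds (S u) (S u)"
        using c32.ds_cw_self[of 1 \<alpha>] ds32 by simp
      moreover have "even (c32.ds (S u) u)" by (rule c32.even_ds_if_mem) (use u in \<open>simp_all add: I_def\<close>)
      moreover have "even (c32.ds u u)" by (rule c32.even_ds_self) (use u in \<open>simp add: I_def\<close>)
      moreover have "dot u u = 2 * c32.ds u u + c32.ds (S u) (S u) - 2 * c32.ds (S u) u"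
        unfolding dot by (simp add: c32.ds_commute[of u "S u"])
      ultimately show ?thesis by presburger
    qed
    show "I u" if u: "\<And>v. I v \<Longrightarrow> 2 * int 1 dvd dot u v" for u
    proof -
      have mem: "c32.mem (S u)"
      proof (rule c32.mem_if_dual)
        fix v assume v: "c32.orth v"
        \<comment> \<open>The words (v, v) with v in the dual of D are codewords; testing against
          them puts S u into D.\<close>
        define w where "w = (\<lambda>i. v (i mod 32))"
        have w: "c32.ds x w = c32.ds x v" "c32.ds x (\<lambda>j. w (32 + j)) = c32.ds x v" for x
          by (rule c32.ds_cong; simp add: w_def)+
        have "I w"
          unfolding I_def c32.orth_def w(1)
          using v by (auto simp: c32.orth_def S_def w_def intro!: c32.mem_even)
        from u[OF this] show "even (c32.ds (S u) v)" by (simp add: dot_split w S_def c32.ds_lin[where a = 1, simplified])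
      qed
      have "even (c32.ds (c32.g a) u)" if a: "a < length R32" for a
      proof -
        \<comment> \<open>The words (0, g) with g a row make the second half orthogonal to D; the
          first half follows since S u is.\<close>
        define w where "w = (\<lambda>i. if i < 32 then 0 else c32.g a (i - 32))"
        have w: "c32.ds x w = 0" "c32.ds x (\<lambda>j. w (32 + j)) = c32.ds x (c32.g a)" for x
          by (simp_all add: c32.ds_def w_def)
        have "c32.mem (S w)" by (rule c32.mem_cong[OF c32.mem_g[OF a]]) (simp add: S_def w_def)
        then have "I w" by (simp add: I_def c32.orth_def w)
        from u[OF this] have "even (c32.ds (\<lambda>j. u (32 + j)) (c32.g a))" by (simp add: dot_split w)
        moreover have "even (c32.ds (S u) (c32.g a))"
          by (rule c32.even_ds_if_mem[OF mem]) (simp add: c32.orth_def ds_even a)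
        ultimately show ?thesis
          unfolding S_def c32.ds_lin by (simp add: c32.ds_commute)
      qed
      then show ?thesis using mem by (simp add: I_def c32.orth_def)
    qed
    show "2 * int 1 dvd u i" if u: "I u" "dot u u < 12 * int 1" "i < 64" for u i
    proof -
      have S_even: "even (S u j)" if j: "j < 32" for j
      proof (rule ccontr)
        assume "odd (S u j)"
        then have "12 \<le> card {j. j < 32 \<and> odd (S u j)}"
          using u(1) c32.mem_weight[OF minwt32, of "S u" j] j by (simp add: I_def)
        then show False using weight[of "\<lambda>j. odd (S u j)" u] u(2) by simp
      qed
      then have y: "even (u (32 + j)) \<longleftrightarrow> even (u j)" if "j < 32" for j
        using that by (simp add: S_def)
      \<comment> \<open>The halves now have equal parity, so odd entries occur in pairs and the dual
        distance counts twice: 2 * 6 = 12.\<close>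
      have x_even: "even (u j)" if j: "j < 32" for j
      proof (rule ccontr)
        assume "odd (u j)"
        then have "6 \<le> card {j. j < 32 \<and> odd (u j)}"
          using u(1) c32.orth_weight_columns[OF columns32, of u j] j by (simp add: I_def)
        moreover have "{j. j < 32 \<and> odd (u (32 + j))} = {j. j < 32 \<and> odd (u j)}" using y by blast
        ultimately show False
          using c32.card_odd_le[of u] c32.card_odd_le[of "\<lambda>j. u (32 + j)"] u(2) unfolding dot_split by simp
      qed
      show ?thesis
      proof (cases "i < 32")
        case False
        then show ?thesis using x_even[of "i - 32"] y[of "i - 32"] u(3) by simp
      qed (simp add: x_even)
    qed
    have R0: "0 < length R32" by (simp add: length_R32)
    have "c32.ds w u0 = c32.ds w (c32.g 0)" for w by (rule c32.ds_cong) (simp_all add: u0_def)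
    moreover have "c32.mem (S u0)" by (rule c32.mem_cong[OF c32.mem_g[OF R0]]) (simp add: S_def u0_def)
    ultimately show "I u0" using ds_even R0 by (simp add: I_def c32.orth_def)
    have "c32.ds u0 u0 = c32.ds (c32.g 0) (c32.g 0)" by (rule c32.ds_cong) (simp_all add: u0_def)
    also have "\<dots> = 12" unfolding c32.ds_dotl[OF R0 R0] by (simp add: R32_def)
    also have "c32.ds u0 u0 = dot u0 u0" unfolding dot_split by (simp add: u0_def c32.ds_def)
    finally show "dot u0 u0 = 12 * int 1" by simp
    show "(0 :: nat) < 64" "\<not> 2 * int 1 dvd u0 0" by (simp_all add: u0_def R32_def)
  qed
qed

text \<open>The residue code of the following \<open>\<int>/4\<close>-code is the extended dual BCH code \<open>[64,13,24]\<close>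
  and its torsion code is the dual \<open>[64,51,6]\<close>; the rows of \<open>R64\<close> lift a basis of the residue
  code so that they are orthogonal modulo 4 with norms divisible by 8.\<close>

lemma dot_eq_ds: "dot u v = c64.ds u v"
  by (simp add: dot_def c64.ds_def)

lemma extremal_typeII_2: "\<exists>C. extremal_typeII 2 64 C"
proof -
  \<comment> \<open>For u = c + 2s with c a combination of rows, the second condition says exactly
    that s is orthogonal to the residue code modulo 2.\<close>
  define I where "I = (\<lambda>u. c64.mem u \<and> (\<forall>a<length R64. 4 dvd c64.ds (c64.g a) u))"
  have decomposition: "\<exists>\<alpha> s. (\<forall>j<64. u j = c64.cw \<alpha> j + 2 * s j) \<and> c64.orth s" if u: "I u" for u
  proof -
    obtain \<alpha> s where s: "\<forall>j<64. u j = c64.cw \<alpha> j + 2 * s j"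
      using c64.mem_decomposition[of u] u by (auto simp: I_def)
    have "even (c64.ds (c64.g a) s)" if a: "a < length R64" for a
    proof -
      have "c64.ds (c64.g a) u = c64.ds (c64.g a) (\<lambda>j. c64.cw \<alpha> j + 2 * s j)"
        by (rule c64.ds_cong) (simp_all add: s)
      also have "\<dots> = c64.ds (c64.cw \<alpha>) (c64.g a) + 2 * c64.ds (c64.g a) s"
        unfolding c64.ds_lin by (simp add: c64.ds_commute[of _ "c64.cw \<alpha>"])
      finally have "c64.ds (c64.g a) u = c64.ds (c64.cw \<alpha>) (c64.g a) + 2 * c64.ds (c64.g a) s" .
      moreover have "4 dvd c64.ds (c64.g a) u" using u a by (simp add: I_def)
      moreover have "4 dvd c64.ds (c64.cw \<alpha>) (c64.g a)"
        unfolding c64.ds_cw by (intro dvd_sum dvd_mult) (use ds64 a in auto)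
      ultimately have "4 dvd 2 * c64.ds (c64.g a) s" by (simp add: dvd_add_right_iff)
      then show ?thesis by presburger
    qed
    then show ?thesis using s by (auto simp: c64.orth_def)
  qed
  \<comment> \<open>The support of a word of weight 6 in the torsion code; the doubled word has norm
    4 * 6 = 24.\<close>
  define T :: "nat set" where "T = {0, 1, 2, 5, 42, 44}"
  define u0 where "u0 = (\<lambda>i. if i \<in> T then 2 else 0 :: int)"
  have u0: "c64.ds w u0 = 2 * (w 0 + w 1 + w 2 + w 5 + w 42 + w 44)" for w
  proof -
    have "c64.ds w u0 = (\<Sum>j\<in>T. 2 * w j)"
      unfolding c64.ds_def u0_def by (rule sum.mono_neutral_cong_right) (auto simp: T_def)
    then show ?thesis by (simp add: T_def)
  qed
  show ?thesis
  proof (rule extremal_typeII_if_representatives[where I = I and ?u0.0 = u0 and ?i0.0 = 0])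
    show "(0 :: nat) < 2" by simp
    show "I v" if "I u" "\<And>i. i < 64 \<Longrightarrow> u i = v i" for u v
    proof -
      have "c64.ds w u = c64.ds w v" for w by (rule c64.ds_cong) (simp_all add: that(2))
      moreover have "c64.mem v" by (rule c64.mem_cong[OF _ that(2)]) (use that(1) in \<open>simp_all add: I_def\<close>)
      ultimately show ?thesis using that(1) by (simp add: I_def)
    qed
    show "I (\<lambda>i. u i + a * v i)" if "I u" "I v" for u v a
      using that by (auto simp: I_def c64.ds_lin intro: c64.mem_lin)
    show "I (\<lambda>i. 2 * int 2 * t i)" for t
      by (auto simp: I_def c64.ds_scale intro!: c64.mem_even)
    show "2 * int 2 dvd dot u v" if uv: "I u" "I v" for u v
    proof -
      obtain \<alpha> s where s: "\<forall>j<64. u j = c64.cw \<alpha> j + 2 * s j" "c64.orth s"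
        using decomposition[OF uv(1)] by blast
      have "dot u v = c64.ds (\<lambda>j. c64.cw \<alpha> j + 2 * s j) v"
        unfolding dot_eq_ds by (rule c64.ds_cong) (simp_all add: s)
      also have "\<dots> = c64.ds (c64.cw \<alpha>) v + 2 * c64.ds v s"
        unfolding c64.ds_lin by (simp add: c64.ds_commute[of s v])
      finally have "dot u v = c64.ds (c64.cw \<alpha>) v + 2 * c64.ds v s" .
      moreover have "4 dvd c64.ds (c64.cw \<alpha>) v"
        unfolding c64.ds_cw by (intro dvd_sum dvd_mult) (use uv(2) in \<open>simp add: I_def\<close>)
      moreover have "even (c64.ds v s)"
        by (rule c64.even_ds_if_mem) (use uv(2) s(2) in \<open>simp_all add: I_def\<close>)
      then have "4 dvd 2 * c64.ds v s" by presburger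
      ultimately show ?thesis by simp
    qed
    show "4 * int 2 dvd dot u u" if u: "I u" for u
    proof -
      obtain \<alpha> s where s: "\<forall>j<64. u j = c64.cw \<alpha> j + 2 * s j" "c64.orth s"
        using decomposition[OF u] by blast
      have "dot u u = c64.ds (\<lambda>j. c64.cw \<alpha> j + 2 * s j) (\<lambda>j. c64.cw \<alpha> j + 2 * s j)"
        unfolding dot_eq_ds by (rule c64.ds_cong) (simp_all add: s)
      also have "\<dots> = c64.ds (c64.cw \<alpha>) (c64.cw \<alpha>) + 4 * (c64.ds (c64.cw \<alpha>) s + c64.ds s s)"
        unfolding c64.ds_lin by (simp add: c64.ds_commute[of s "c64.cw \<alpha>"])
      finally have eq: "dot u u = c64.ds (c64.cw \<alpha>) (c64.cw \<alpha>) + 4 * (c64.ds (c64.cw \<alpha>) s + c64.ds s s)" .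
      have "8 dvd c64.ds (c64.cw \<alpha>) (c64.cw \<alpha>)"
        using c64.ds_cw_self[of 2 \<alpha>] ds64 by simp
      moreover have "even (c64.ds (c64.cw \<alpha>) s)"
        unfolding c64.ds_cw by (intro dvd_sum dvd_mult) (use s(2) in \<open>simp add: c64.orth_def\<close>)
      then have "even (c64.ds (c64.cw \<alpha>) s + c64.ds s s)" using c64.even_ds_self[OF s(2)] by simp
      then have "8 dvd 4 * (c64.ds (c64.cw \<alpha>) s + c64.ds s s)" by presburger
      ultimately show ?thesis unfolding eq by simp
    qed
    show "I u" if u: "\<And>v. I v \<Longrightarrow> 2 * int 2 dvd dot u v" for u
    proof -
      have "c64.mem u"
      proof (rule c64.mem_if_dual)
        fix v assume v: "c64.orth v"
        have "4 dvd 2 * c64.ds (c64.g a) v" if "a < length R64" for a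
        proof -
          have "even (c64.ds (c64.g a) v)" using v that by (simp add: c64.orth_def)
          then show ?thesis by presburger
        qed
        then have "I (\<lambda>i. 2 * v i)" by (simp add: I_def c64.ds_scale c64.mem_even)
        from u[OF this] have "4 dvd 2 * c64.ds u v" by (simp add: dot_eq_ds c64.ds_scale)
        then show "even (c64.ds u v)" by presburger
      qed
      moreover have "4 dvd c64.ds (c64.g a) u" if a: "a < length R64" for a
      proof -
        have "I (c64.g a)" using c64.mem_g[OF a] ds64(1)[OF _ a] by (simp add: I_def)
        from u[OF this] show ?thesis by (simp add: dot_eq_ds c64.ds_commute)
      qed
      ultimately show ?thesis by (simp add: I_def)
    qed
    show "2 * int 2 dvd u i" if u: "I u" "dot u u < 12 * int 2" "i < 64" for u i
    proof -
      have even: "even (u j)" if j: "j < 64" for j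
      proof (rule ccontr)
        assume "odd (u j)"
        then have "24 \<le> card {j. j < 64 \<and> odd (u j)}"
          using u(1) c64.mem_weight[OF minwt64, of u j] j by (simp add: I_def)
        then show False using c64.card_odd_le[of u] u(2) unfolding dot_eq_ds by simp
      qed
      \<comment> \<open>An even word is twice a torsion word, and a torsion word with an odd entry
        has at least six of them, giving norm at least 4 * 6 = 24.\<close>
      define v where "v = (\<lambda>j. u j div 2)"
      have v: "u j = 2 * v j" if "j < 64" for j using even[OF that] by (simp add: v_def)
      have ds_v: "c64.ds w u = 2 * c64.ds w v" for w
        unfolding c64.ds_scale(2)[symmetric] by (rule c64.ds_cong) (simp_all add: v)
      have "even (c64.ds (c64.g a) v)" if "a < length R64" for a
      proof -
        have "4 dvd c64.ds (c64.g a) u" using u(1) that by (simp add: I_def)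
        then have "4 dvd 2 * c64.ds (c64.g a) v" by (simp only: ds_v)
        then show ?thesis by presburger
      qed
      then have orth: "c64.orth v" by (simp add: c64.orth_def)
      have "dot u u = 4 * c64.ds v v"
        unfolding dot_eq_ds using ds_v[of u] ds_v[of v] by (simp add: c64.ds_commute[of u v])
      then have "c64.ds v v < 6" using u(2) by simp
      then have "even (v i)"
        using c64.orth_weight_columns[OF columns64 orth, of i] u(3) c64.card_odd_le[of v] by force
      then show ?thesis using v[OF u(3)] by auto
    qed
    have "list_all (\<lambda>x. even (x ! 0 + x ! 1 + x ! 2 + x ! 5 + x ! 42 + x ! 44)) R64"
      by (simp add: R64_def)
    then have "even (c64.g a 0 + c64.g a 1 + c64.g a 2 + c64.g a 5 + c64.g a 42 + c64.g a 44)"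
      if "a < length R64" for a using that by (simp only: list_all_length)
    note sum_even = this
    have double: "even m \<Longrightarrow> 4 dvd 2 * m" for m :: int by presburger
    have "4 dvd c64.ds (c64.g a) u0" if "a < length R64" for a
      unfolding u0 by (rule double[OF sum_even[OF that]])
    moreover have "c64.mem u0" by (rule c64.mem_even) (simp add: u0_def)
    ultimately show "I u0" by (simp add: I_def)
    show "dot u0 u0 = 12 * int 2" unfolding dot_eq_ds u0 by (simp add: u0_def T_def)
    show "(0 :: nat) < 64" "\<not> 2 * int 2 dvd u0 0" by (simp_all add: u0_def T_def)
  qed
qed

theorem theorem7p5:
  fixes k :: nat
  assumes "k \<ge> 1"
  shows "\<exists>C. extremal_typeII k 64 C"
proof -
  consider "k = 1" | "k = 2" | "3 \<le> k" using assms by linarith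
  then show ?thesis
    using extremal_typeII_1 extremal_typeII_2 extremal_typeII_if_ge_3 by cases simp_all
qed

end
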